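(* Let $\nu^\pm=\nu_1^\pm+\nu_2^\pm$ and $$\theta=\frac{\sqrt{(\nu^+\beta_4^2+\nu^-\beta_1^2)^2+4\nu^+\nu^-(\beta_1\beta_2\beta_3\beta_4-\beta_1^2\beta_4^2)}-(\nu^+\beta_4^2+\nu^-\beta_1^2)}{2\nu^+\nu^-},$$ which is positive because $\beta_1\beta_4-\beta_2\beta_3<0$. Then for any $\vartheta>0$ the linear system on $\mathbb{R}^3$ $$\begin{cases}\partial_t\tilde n^++\beta_1\operatorname{div}\tilde u^+=0,\\ \partial_t\tilde u^++\beta_1\nabla\tilde n^++\beta_2\nabla\tilde n^--\nu_1^+\Delta\tilde u^+-\nu_2^+\nabla\operatorname{div}\tilde u^+=0,\\ \partial_t\tilde n^-+\beta_4\operatorname{div}\tilde u^-=0,\\ \partial_t\tilde u^-+\beta_3\nabla\tilde n^++\beta_4\nabla\tilde n^--\nu_1^-\Delta\tilde u^--\nu_2^-\nabla\operatorname{div}\tilde u^-=0\end{cases}$$ (with $\tilde n^\pm$ scalar-valued and $\tilde u^\pm$ $\mathbb{R}^3$-valued) admits an (unstable) solution $(\tilde n^+_\vartheta,\tilde u^+_\vartheta,\tilde n^-_\vartheta,\tilde u^-_\vartheta)$ satisfying $$\tilde n^\pm_\vartheta\in C^0(0,\infty;H^2(\mathbb{R}^3))\cap C^1(0,\infty;H^1(\mathbb{R}^3)),\qquad \tilde u^\pm_\vartheta\in C^0(0,\infty;H^2(\mathbb{R}^3))\cap C^1(0,\infty;L^2(\mathbb{R}^3)),$$ whose initial data $(\tilde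 n^+_{0,\vartheta},\tilde u^+_{0,\vartheta},\tilde n^-_{0,\vartheta},\tilde u^-_{0,\vartheta})$ at $t=0$ satisfy $$\|\tilde n^+_{0,\vartheta}\|_{L^2}\,\|\tilde u^+_{0,\vartheta}\|_{L^2}\,\|\tilde n^-_{0,\vartheta}\|_{L^2}\,\|\tilde u^-_{0,\vartheta}\|_{L^2}>0.$$ Moreover, for all $t\ge0$ (for each of the signs $+$ and $-$), $$e^{(\theta-\vartheta)t}\|\tilde n^\pm_{0,\vartheta}\|_{L^2}\le\|\tilde n^\pm_\vartheta(t)\|_{L^2}\le e^{\theta t}\|\tilde n^\pm_{0,\vartheta}\|_{L^2}\quad\text{and}\quad e^{(\theta-\vartheta)t}\|\tilde u^\pm_{0,\vartheta}\|_{L^2}\le\|\tilde u^\pm_\vartheta(t)\|_{L^2}\le e^{\theta t}\|\tilde u^\pm_{0,\vartheta}\|_{L^2}.$$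
   Context: Coefficients. Fix constants $\bar\gamma^\pm\ge1$, $\mu^\pm>0$, $\lambda^\pm$ with $2\mu^\pm+3\lambda^\pm\ge0$ (so $\mu^\pm+\lambda^\pm>0$), and a function $f\in C^3([0,\infty))$ with $f'(1)>0$. Put $P^\pm(\rho)=\rho^{\bar\gamma^\pm}$. For $R^\pm>0$ let $\rho^+=\rho^+(R^+,R^-)\in(R^+,\infty)$ be the unique solution of $P^+(\rho^+)-P^-\big(\tfrac{R^-\rho^+}{\rho^+-R^+}\big)-f(R^-)=0$, and let $\rho^-=\tfrac{R^-\rho^+}{\rho^+-R^+}$, $\alpha^\pm=R^\pm/\rho^\pm$ (so $\alpha^++\alpha^-=1$), $s_\pm^2=\bar\gamma^\pm P^\pm(\rho^\pm)/\rho^\pm$, $\mathcal C^2=\dfrac{s_-^2s_+^2}{\alpha^-\rho^+s_+^2+\alpha^+\rho^-s_-^2}$, all regarded as functions of $(R^+,R^-)$. With all these evaluated at $(R^+,R^-)=(1,1)$, set $$\alpha_1=\frac{\mathcal C^2\rho^-}{\rho^+},\quad \alpha_2=\mathcal C^2+\frac{\mathcal C^2\alpha^-f'(1)}{s_-^2},\quad \alpha_3=\mathcal C^2,\quad \alpha_4=\frac{\mathcal C^2\rho^+}{\rho^-}-\frac{\mathcal C^2\alpha^+f'(1)}{s_+^2},$$ $$\nu_1^\pm=\frac{\mu^\pm}{\rho^\pm},\qquad \nu_2^\pm=\frac{\mu^\pm+\lambda^\pm}{\rho^\pm}>0 .$$ It is assumed that $\alpha_4>0$. Set $\beta_1=\sqrt{\alpha_1}$,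 $\beta_2=\alpha_2\sqrt{\alpha_1}/\alpha_4$, $\beta_3=\alpha_3\sqrt{\alpha_4}/\alpha_1$, $\beta_4=\sqrt{\alpha_4}$. All $\beta_i$ are positive, and $\beta_1\beta_4-\beta_2\beta_3=-\dfrac{\mathcal C^2(1,1)f'(1)}{\sqrt{\alpha_1\alpha_4}\,\rho^+(1,1)}<0$. Convention: $C^k(0,\infty;X)$ denotes $X$-valued functions of time of class $C^k$ on $[0,\infty)$. *)

theory Defs
  imports "HOL-Analysis.Analysis"
begin

section \<open>Classically differentiable functions\<close>

text \<open>Functions of class \<open>C\<^sup>k\<close> on the closed half-line; derivatives at \<open>0\<close> are one-sided.\<close>

primrec C_halfline :: "nat \<Rightarrow> (real \<Rightarrow> real) \<Rightarrow> bool" where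
  "C_halfline 0 f \<longleftrightarrow> continuous_on {0..} f"
| "C_halfline (Suc k) f \<longleftrightarrow>
     (\<exists>g. (\<forall>x\<ge>0. (f has_real_derivative g x) (at x within {0..})) \<and> C_halfline k g)"

definition pd :: "'n \<Rightarrow> (real^'n \<Rightarrow> real) \<Rightarrow> real^'n::finite \<Rightarrow> real" where
  "pd i \<phi> x = frechet_derivative \<phi> (at x) (axis i 1)"

primrec C_space :: "nat \<Rightarrow> (real^'n::finite \<Rightarrow> real) \<Rightarrow> bool" where
  "C_space 0 \<phi> \<longleftrightarrow> continuous_on UNIV \<phi>"
| "C_space (Suc k) \<phi> \<longleftrightarrow> (\<forall>x. \<phi> differentiable (at x)) \<and> (\<forall>i. C_space k (pd i \<phi>))"

definition test_function :: "(real^'n::finite \<Rightarrow> real) \<Rightarrow> bool" where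
  "test_function \<phi> \<longleftrightarrow> (\<forall>k. C_space k \<phi>) \<and> compact (closure {x. \<phi> x \<noteq> 0})"

text \<open>Iterated partial derivative: the list of coordinates \<open>[i\<^sub>1, \<dots>, i\<^sub>m]\<close> stands for
  \<open>\<partial>\<^sub>i\<^sub>1 \<dots> \<partial>\<^sub>i\<^sub>m\<close>.\<close>

primrec pds :: "'n list \<Rightarrow> (real^'n \<Rightarrow> real) \<Rightarrow> real^'n::finite \<Rightarrow> real" where
  "pds [] \<phi> = \<phi>"
| "pds (i # is) \<phi> = pd i (pds is \<phi>)"


section \<open>\<open>L\<^sup>2\<close> and Sobolev spaces\<close>

text \<open>Elements of \<open>L\<^sup>2\<close> and \<open>H\<^sup>k\<close> are represented by functions rather than by classes modulo
  null sets; all the notions below are invariant under changes on null sets. The codomain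
  covers scalar-valued and vector-valued functions alike.\<close>

definition L2_space :: "('a::euclidean_space \<Rightarrow> 'b::euclidean_space) set" where
  "L2_space = {u. u \<in> borel_measurable lebesgue \<and> integrable lebesgue (\<lambda>x. (norm (u x))\<^sup>2)}"

definition L2_norm :: "('a::euclidean_space \<Rightarrow> 'b::euclidean_space) \<Rightarrow> real" where
  "L2_norm u = sqrt (LINT x|lebesgue. (norm (u x))\<^sup>2)"

definition has_weak_deriv ::
  "(real^'n::finite \<Rightarrow> 'b::euclidean_space) \<Rightarrow> 'n list \<Rightarrow> (real^'n \<Rightarrow> 'b) \<Rightarrow> bool" where
  "has_weak_deriv u is g \<longleftrightarrow> u \<in> L2_space \<and> g \<in> L2_space \<and>
     (\<forall>\<phi>. test_function \<phi> \<longrightarrow>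
        (LINT x|lebesgue. pds is \<phi> x *\<^sub>R u x)
          = (-1) ^ length is *\<^sub>R (LINT x|lebesgue. \<phi> x *\<^sub>R g x))"

text \<open>A representative of the weak derivative, which is unique up to null sets.\<close>

definition weak_deriv ::
  "'n list \<Rightarrow> (real^'n::finite \<Rightarrow> 'b::euclidean_space) \<Rightarrow> real^'n \<Rightarrow> 'b" where
  "weak_deriv is u = (SOME g. has_weak_deriv u is g)"

definition H_space :: "nat \<Rightarrow> (real^'n::finite \<Rightarrow> 'b::euclidean_space) set" where
  "H_space k = {u. u \<in> L2_space \<and> (\<forall>is. length is \<le> k \<longrightarrow> (\<exists>g. has_weak_deriv u is g))}"

text \<open>The norm with square \<open>\<Sum>\<^sub>j\<^sub>\<le>\<^sub>k \<parallel>\<nabla>\<^sup>j u\<parallel>\<^sup>2\<close>, where \<open>\<nabla>\<^sup>j u\<close> is the array of all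
  iterated derivatives of order \<open>j\<close>.\<close>

definition H_norm :: "nat \<Rightarrow> (real^'n::finite \<Rightarrow> 'b::euclidean_space) \<Rightarrow> real" where
  "H_norm k u = sqrt (\<Sum>is | length is \<le> k. (L2_norm (weak_deriv is u))\<^sup>2)"

definition weak_grad :: "(real^'n::finite \<Rightarrow> real) \<Rightarrow> real^'n \<Rightarrow> real^'n" where
  "weak_grad n x = (\<chi> i. weak_deriv [i] n x)"

definition weak_div :: "(real^'n::finite \<Rightarrow> real^'n) \<Rightarrow> real^'n \<Rightarrow> real" where
  "weak_div u x = (\<Sum>i\<in>UNIV. weak_deriv [i] u x $ i)"

definition weak_laplacian ::
  "(real^'n::finite \<Rightarrow> 'b::euclidean_space) \<Rightarrow> real^'n \<Rightarrow> 'b" where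
  "weak_laplacian u x = (\<Sum>i\<in>UNIV. weak_deriv [i, i] u x)"


section \<open>Functions of time with values in a function space\<close>

text \<open>In the following, \<open>X\<close> is a space of functions and \<open>N\<close> its norm; time runs through
  \<open>[0,\<infty>)\<close>, with one-sided limits at \<open>0\<close>.\<close>

definition has_time_deriv ::
  "('a \<Rightarrow> 'b::real_vector) set \<Rightarrow> (('a \<Rightarrow> 'b) \<Rightarrow> real) \<Rightarrow> (real \<Rightarrow> 'a \<Rightarrow> 'b) \<Rightarrow> ('a \<Rightarrow> 'b) \<Rightarrow> real \<Rightarrow> bool"
  where
  "has_time_deriv X N U v t \<longleftrightarrow> (\<forall>s\<ge>0. U s \<in> X) \<and> v \<in> X \<and>
     ((\<lambda>s. N (\<lambda>x. (U s x - U t x) /\<^sub>R (s - t) - v x)) \<longlongrightarrow> 0) (at t within {0..})"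

primrec C_time ::
  "nat \<Rightarrow> ('a \<Rightarrow> 'b::real_vector) set \<Rightarrow> (('a \<Rightarrow> 'b) \<Rightarrow> real) \<Rightarrow> (real \<Rightarrow> 'a \<Rightarrow> 'b) \<Rightarrow> bool"
  where
  "C_time 0 X N U \<longleftrightarrow> (\<forall>t\<ge>0. U t \<in> X) \<and>
     (\<forall>t\<ge>0. ((\<lambda>s. N (\<lambda>x. U s x - U t x)) \<longlongrightarrow> 0) (at t within {0..}))"
| "C_time (Suc k) X N U \<longleftrightarrow>
     (\<exists>V. (\<forall>t\<ge>0. has_time_deriv X N U (V t) t) \<and> C_time k X N V)"


section \<open>The linear system\<close>

text \<open>At every time \<open>t \<ge> 0\<close> the equations hold almost everywhere in space, the time derivatives
  being taken in \<open>L\<^sup>2\<close>.\<close>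

definition solves_linear_system ::
  "real \<Rightarrow> real \<Rightarrow> real \<Rightarrow> real \<Rightarrow> real \<Rightarrow> real \<Rightarrow> real \<Rightarrow> real \<Rightarrow>
   (real \<Rightarrow> real^3 \<Rightarrow> real) \<Rightarrow> (real \<Rightarrow> real^3 \<Rightarrow> real^3) \<Rightarrow>
   (real \<Rightarrow> real^3 \<Rightarrow> real) \<Rightarrow> (real \<Rightarrow> real^3 \<Rightarrow> real^3) \<Rightarrow> bool" where
  "solves_linear_system \<beta>1 \<beta>2 \<beta>3 \<beta>4 \<nu>1p \<nu>2p \<nu>1m \<nu>2m np up nm um \<longleftrightarrow>
     (\<forall>t\<ge>0. \<exists>dnp dup dnm dum.
        has_time_deriv L2_space L2_norm np dnp t \<and>
        has_time_deriv L2_space L2_norm up dup t \<and>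
        has_time_deriv L2_space L2_norm nm dnm t \<and>
        has_time_deriv L2_space L2_norm um dum t \<and>
        (AE x in lebesgue. dnp x + \<beta>1 * weak_div (up t) x = 0) \<and>
        (AE x in lebesgue. dup x + \<beta>1 *\<^sub>R weak_grad (np t) x + \<beta>2 *\<^sub>R weak_grad (nm t) x
            - \<nu>1p *\<^sub>R weak_laplacian (up t) x - \<nu>2p *\<^sub>R weak_grad (weak_div (up t)) x = 0) \<and>
        (AE x in lebesgue. dnm x + \<beta>4 * weak_div (um t) x = 0) \<and>
        (AE x in lebesgue. dum x + \<beta>3 *\<^sub>R weak_grad (np t) x + \<beta>4 *\<^sub>R weak_grad (nm t) x
            - \<nu>1m *\<^sub>R weak_laplacian (um t) x - \<nu>2m *\<^sub>R weak_grad (weak_div (um t)) x = 0))"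


section \<open>The coefficients\<close>

text \<open>The letters \<open>p\<close> and \<open>m\<close> stand for the superscripts \<open>+\<close> and \<open>-\<close>; \<open>gp\<close>, \<open>gm\<close> are the
  adiabatic exponents of the two pressure laws and \<open>f\<close> is the capillary pressure.\<close>

definition pressure :: "real \<Rightarrow> real \<Rightarrow> real" where
  "pressure g \<rho> = \<rho> powr g"

definition rho_p :: "real \<Rightarrow> real \<Rightarrow> (real \<Rightarrow> real) \<Rightarrow> real \<Rightarrow> real \<Rightarrow> real" where
  "rho_p gp gm f Rp Rm =
     (THE r. Rp < r \<and> pressure gp r - pressure gm (Rm * r / (r - Rp)) - f Rm = 0)"

definition rho_m :: "real \<Rightarrow> real \<Rightarrow> (real \<Rightarrow> real) \<Rightarrow> real \<Rightarrow> real \<Rightarrow> real" where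
  "rho_m gp gm f Rp Rm = Rm * rho_p gp gm f Rp Rm / (rho_p gp gm f Rp Rm - Rp)"

definition frac_p :: "real \<Rightarrow> real \<Rightarrow> (real \<Rightarrow> real) \<Rightarrow> real \<Rightarrow> real \<Rightarrow> real" where
  "frac_p gp gm f Rp Rm = Rp / rho_p gp gm f Rp Rm"

definition frac_m :: "real \<Rightarrow> real \<Rightarrow> (real \<Rightarrow> real) \<Rightarrow> real \<Rightarrow> real \<Rightarrow> real" where
  "frac_m gp gm f Rp Rm = Rm / rho_m gp gm f Rp Rm"

text \<open>Squared sound speeds \<open>s\<^sub>\<plusminus>\<^sup>2\<close>.\<close>

definition ssq_p :: "real \<Rightarrow> real \<Rightarrow> (real \<Rightarrow> real) \<Rightarrow> real \<Rightarrow> real \<Rightarrow> real" where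
  "ssq_p gp gm f Rp Rm = gp * pressure gp (rho_p gp gm f Rp Rm) / rho_p gp gm f Rp Rm"

definition ssq_m :: "real \<Rightarrow> real \<Rightarrow> (real \<Rightarrow> real) \<Rightarrow> real \<Rightarrow> real \<Rightarrow> real" where
  "ssq_m gp gm f Rp Rm = gm * pressure gm (rho_m gp gm f Rp Rm) / rho_m gp gm f Rp Rm"

definition Csq :: "real \<Rightarrow> real \<Rightarrow> (real \<Rightarrow> real) \<Rightarrow> real \<Rightarrow> real \<Rightarrow> real" where
  "Csq gp gm f Rp Rm =
     ssq_m gp gm f Rp Rm * ssq_p gp gm f Rp Rm /
     (frac_m gp gm f Rp Rm * rho_p gp gm f Rp Rm * ssq_p gp gm f Rp Rm
       + frac_p gp gm f Rp Rm * rho_m gp gm f Rp Rm * ssq_m gp gm f Rp Rm)"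

definition alpha1 :: "real \<Rightarrow> real \<Rightarrow> (real \<Rightarrow> real) \<Rightarrow> real" where
  "alpha1 gp gm f = Csq gp gm f 1 1 * rho_m gp gm f 1 1 / rho_p gp gm f 1 1"

definition alpha2 :: "real \<Rightarrow> real \<Rightarrow> (real \<Rightarrow> real) \<Rightarrow> real" where
  "alpha2 gp gm f =
     Csq gp gm f 1 1 + Csq gp gm f 1 1 * frac_m gp gm f 1 1 * deriv f 1 / ssq_m gp gm f 1 1"

definition alpha3 :: "real \<Rightarrow> real \<Rightarrow> (real \<Rightarrow> real) \<Rightarrow> real" where
  "alpha3 gp gm f = Csq gp gm f 1 1"

definition alpha4 :: "real \<Rightarrow> real \<Rightarrow> (real \<Rightarrow> real) \<Rightarrow> real" where
  "alpha4 gp gm f =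
     Csq gp gm f 1 1 * rho_p gp gm f 1 1 / rho_m gp gm f 1 1
       - Csq gp gm f 1 1 * frac_p gp gm f 1 1 * deriv f 1 / ssq_p gp gm f 1 1"

end

(*
  A solution is sought as a superposition of gradient modes: at the frequency xi the system reduces
  to four scalar equations, whose characteristic polynomial has a positive root lambda(|xi|) that
  stays below theta and tends to theta as |xi| grows. Taking amplitudes supported in an annulus on
  which theta - eps <= lambda < theta, every unknown is the transform of exp(lambda t) times a fixed
  amplitude, so by Plancherel all bounds for the L2 norms hold frequency by frequency.

  Two devices keep the analysis elementary. The Hartley transform (kernel cos + sin) replaces the
  Fourier transform: it is real, and d/dx_i becomes F(xi) |-> - xi_i F(- xi). And lambda is never
  obtained from a quartic: for given lambda the dispersion relation is quadratic in s = lambda^2 / |xi|^2,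
  so |xi|^2 is an explicit increasing function of lambda, which is then inverted.
*)
theory Submission
  imports Defs "HOL-Probability.Characteristic_Functions"
begin

section \<open>Gaussian integrals on Euclidean space\<close>

text \<open>For velocities that are gradients, eliminating the velocity amplitudes leaves a 2 x 2
  system for the densities. Its determinant vanishes when (s + \<nu>+ \<lambda> + \<beta>1^2)(s +
  \<nu>- \<lambda> + \<beta>4^2) = \<beta>1 \<beta>2 \<beta>3 \<beta>4 with s = \<lambda>^2 /
  |\<xi>|^2. At s = \<lambda> = 0 the left side is \<beta>1^2 \<beta>4^2, which \<beta>1 \<beta>4 <
  \<beta>2 \<beta>3 puts below the right side: this is the source of the instability. The constant
  \<theta> solves the relation with s = 0, the limit of infinite frequency. As s > 0 at every finite
  frequency, the rate stays strictly below \<theta>, and a single plane wave is not square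
  integrable; hence a band of frequencies and the loss of a small exponent. The other obstacle lies
  in the definitions: \<open>weak_deriv\<close> is a choice among representatives, so an explicit
  derivative says nothing about it before uniqueness is known. This is why smooth bump functions and
  Lebesgue differentiation appear. The reflection in the multiplier of a derivative is the reason
  why every scalar amplitude is even in the frequency.\<close>

lemma has_bochner_integral_lborel_prod:
  fixes f :: "'a::euclidean_space \<Rightarrow> real \<Rightarrow> 'c::{real_normed_field,banach,second_countable_topology}"
  assumes "\<And>b. b \<in> Basis \<Longrightarrow> integrable lborel (f b)"
  shows "has_bochner_integral lborel (\<lambda>x::'a. \<Prod>b\<in>Basis. f b (x \<bullet> b)) (\<Prod>b\<in>Basis. integral\<^sup>L lborel (f b))"
proof -
  interpret product_sigma_finite "\<lambda>b::'a. lborel :: real measure"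
    by unfold_locales
  have [measurable]: "\<And>b. b \<in> Basis \<Longrightarrow> f b \<in> borel_measurable borel"
    using assms by (auto dest: borel_measurable_integrable)
  have *: "integrable (\<Pi>\<^sub>M b\<in>Basis. lborel) (\<lambda>x. \<Prod>b\<in>Basis. f b (x b))"
    "(\<integral>x. (\<Prod>b\<in>Basis. f b (x b)) \<partial>(\<Pi>\<^sub>M b\<in>Basis. lborel)) = (\<Prod>b\<in>Basis. integral\<^sup>L lborel (f b))"
    by (auto intro!: product_integrable_prod product_integral_prod assms)
  have eq: "(\<Prod>b\<in>Basis. f b ((\<Sum>b\<in>Basis. x b *\<^sub>R b) \<bullet> b)) = (\<Prod>b\<in>Basis. f b (x b))" for x :: "'a \<Rightarrow> real"
    by (rule prod.cong) auto
  show ?thesis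
    unfolding has_bochner_integral_iff
    using * by (subst (1 2) lborel_eq) (auto simp: integrable_distr_eq integral_distr eq cong del: prod.cong)
qed

lemma exp_norm_square_prod:
  "(\<Prod>b\<in>Basis. exp (- (x \<bullet> b)\<^sup>2 / 2)) = exp (- (norm (x::'a::euclidean_space))\<^sup>2 / 2)"
proof -
  have "(norm x)\<^sup>2 = (\<Sum>b\<in>Basis. (x \<bullet> b)\<^sup>2)"
    by (subst power2_norm_eq_inner, subst euclidean_inner) (simp add: power2_eq_square)
  then show ?thesis
    by (simp add: exp_sum[symmetric] sum_negf sum_divide_distrib)
qed

definition gauss :: "'a::euclidean_space \<Rightarrow> real" where
  "gauss x = (\<Prod>b\<in>Basis. std_normal_density (x \<bullet> b))"

lemma gauss_eq: "gauss (x::'a::euclidean_space) = exp (- (norm x)\<^sup>2 / 2) / sqrt (2 * pi) ^ DIM('a)"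
proof -
  have "gauss x = (\<Prod>b\<in>Basis. exp (- (x \<bullet> b)\<^sup>2 / 2) / sqrt (2 * pi))"
    unfolding gauss_def by (simp add: std_normal_density_def)
  also have "\<dots> = (\<Prod>b\<in>Basis. exp (- (x \<bullet> b)\<^sup>2 / 2)) / sqrt (2 * pi) ^ DIM('a)"
    by (simp add: prod_dividef)
  also have "(\<Prod>b\<in>Basis. exp (- (x \<bullet> b)\<^sup>2 / 2)) = exp (- (norm x)\<^sup>2 / 2)"
    by (rule exp_norm_square_prod)
  finally show ?thesis .
qed

lemma gauss_pos: "gauss x > 0"
  by (simp add: gauss_eq)

lemma gauss_measurable [measurable]: "gauss \<in> borel_measurable borel"
  unfolding gauss_def[abs_def] by measurable

lemma gauss_uminus [simp]: "gauss (- x) = gauss x"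
  by (simp add: gauss_eq)

lemma integrable_gauss: "integrable lborel (gauss :: 'a::euclidean_space \<Rightarrow> real)"
  and integral_gauss: "integral\<^sup>L lborel (gauss :: 'a::euclidean_space \<Rightarrow> real) = 1"
  using has_bochner_integral_lborel_prod[of "\<lambda>(b::'a). std_normal_density"]
  by (auto simp: gauss_def[abs_def] has_bochner_integral_iff)

text \<open>The detour through the complex exponential makes the integrand a product over the
  coordinates, which a cosine is not. Each factor is the characteristic function of the standard
  normal law, and the real part is taken at the end.\<close>

lemma integral_cos_gauss:
  "(LINT x|lborel. cos (\<zeta> \<bullet> x) * gauss x) = exp (- (norm (\<zeta>::'a::euclidean_space))\<^sup>2 / 2)"
proof -
  have 1: "has_bochner_integral lborel (\<lambda>x. std_normal_density x *\<^sub>R iexp (t * x))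
     (complex_of_real (exp (- (t^2) / 2)))" for t
  proof -
    have "(CLINT x|std_normal_distribution. iexp (t * x)) = complex_of_real (exp (- (t^2) / 2))"
      using char_std_normal_distribution by (auto simp: fun_eq_iff char_def)
    moreover have "(CLINT x|std_normal_distribution. iexp (t * x)) =
        (CLINT x|lborel. std_normal_density x *\<^sub>R iexp (t * x))"
      by (rule integral_density) (auto simp: normal_density_nonneg)
    moreover have "integrable lborel (\<lambda>x. std_normal_density x *\<^sub>R iexp (t * x))"
      by (rule Bochner_Integration.integrable_bound[where f=std_normal_density])
        (auto simp: normal_density_nonneg)
    ultimately show ?thesis by (simp add: has_bochner_integral_iff)
  qed
  have eq: "(\<Prod>b\<in>Basis. std_normal_density (x \<bullet> b) *\<^sub>R iexp (\<zeta> \<bullet> b * (x \<bullet> b))) = gauss x *\<^sub>R iexp (\<zeta> \<bullet> x)" for x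
  proof -
    have "(\<Prod>b\<in>Basis. std_normal_density (x \<bullet> b) *\<^sub>R iexp (\<zeta> \<bullet> b * (x \<bullet> b))) =
      of_real (gauss x) * (\<Prod>b\<in>Basis. iexp (\<zeta> \<bullet> b * (x \<bullet> b)))"
      by (simp add: gauss_def scaleR_conv_of_real prod.distrib)
    also have "(\<Prod>b\<in>Basis. iexp (\<zeta> \<bullet> b * (x \<bullet> b))) = iexp (\<zeta> \<bullet> x)"
      by (subst exp_sum[symmetric]) (auto simp: euclidean_inner[of \<zeta> x] sum_distrib_left)
    finally show ?thesis by (simp add: scaleR_conv_of_real)
  qed
  have eq2: "(\<Prod>b\<in>Basis. complex_of_real (exp (- ((\<zeta> \<bullet> b)^2) / 2))) = of_real (exp (- (norm \<zeta>)\<^sup>2 / 2))"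
    unfolding of_real_prod[symmetric] exp_norm_square_prod ..
  have "has_bochner_integral lborel (\<lambda>x. gauss x *\<^sub>R iexp (\<zeta> \<bullet> x)) (complex_of_real (exp (- (norm \<zeta>)\<^sup>2 / 2)))"
    using has_bochner_integral_lborel_prod[of "\<lambda>b x. std_normal_density x *\<^sub>R iexp (\<zeta> \<bullet> b * x)"] 1
    unfolding has_bochner_integral_iff eq eq2[symmetric] by simp
  from has_bochner_integral_Re[OF this]
  show ?thesis by (simp add: has_bochner_integral_iff mult.commute Re_exp)
qed

lemma integral_lborel_affine:
  fixes f :: "'a::euclidean_space \<Rightarrow> 'b::{banach,second_countable_topology}"
  assumes c: "c \<noteq> 0" and f[measurable]: "f \<in> borel_measurable borel"
  shows "(LINT x|lborel. f x) = \<bar>c\<bar> ^ DIM('a) *\<^sub>R (LINT x|lborel. f (t + c *\<^sub>R x))"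
  by (subst lborel_affine[OF c, of t]) (simp add: integral_density integral_distr)

lemma integral_lborel_uminus:
  fixes f :: "'a::euclidean_space \<Rightarrow> 'b::{banach,second_countable_topology}"
  assumes "f \<in> borel_measurable borel"
  shows "(LINT x|lborel. f (- x)) = (LINT x|lborel. f x)"
  using integral_lborel_affine[of "-1" f 0] assms by simp

lemma integrable_lborel_affine:
  fixes f :: "'a::euclidean_space \<Rightarrow> 'b::{banach,second_countable_topology}"
  assumes c: "c \<noteq> 0" and f: "integrable lborel f"
  shows "integrable lborel (\<lambda>x. f (t + c *\<^sub>R x))"
proof -
  have [measurable]: "f \<in> borel_measurable borel" using f by auto
  have "integrable (density (distr lborel borel (\<lambda>x. t + c *\<^sub>R x)) (\<lambda>_. ennreal (\<bar>c\<bar>^DIM('a)))) f"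
    using f by (subst (asm) lborel_affine[OF c, of t]) simp
  then have "integrable lborel (\<lambda>x. \<bar>c\<bar>^DIM('a) *\<^sub>R f (t + c *\<^sub>R x))"
    by (simp add: integrable_density integrable_distr_eq)
  from integrable_scaleR_right[OF this, of "inverse (\<bar>c\<bar>^DIM('a))"] show ?thesis
    using c by simp
qed

lemma integral_odd_lborel:
  fixes f :: "'a::euclidean_space \<Rightarrow> real"
  assumes "f \<in> borel_measurable borel" "\<And>x. f (- x) = - f x"
  shows "(LINT x|lborel. f x) = 0"
  using integral_lborel_uminus[OF assms(1)] assms(2) by simp

section \<open>The kernel of the Hartley transform\<close>

definition cas :: "real \<Rightarrow> real" where
  "cas r = cos r + sin r"

lemma abs_cas_le: "\<bar>cas r\<bar> \<le> 2"
  using abs_cos_le_one[of r] abs_sin_le_one[of r] unfolding cas_def by linarith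

lemma continuous_on_cas [continuous_intros]:
  fixes f :: "'a::t2_space \<Rightarrow> real"
  shows "continuous_on S f \<Longrightarrow> continuous_on S (\<lambda>x. cas (f x))"
  unfolding cas_def by (intro continuous_on_add continuous_on_cos continuous_on_sin)

lemma cas_measurable [measurable]: "cas \<in> borel_measurable borel"
  by (intro borel_measurable_continuous_onI continuous_on_cas continuous_on_id)

lemma cas_mult_cas: "cas a * cas b = cos (a - b) + sin (a + b)"
  unfolding cas_def by (simp add: cos_diff sin_add algebra_simps)

text \<open>Regularized orthogonality of the kernel: as a function of \<eta>, the right-hand side
  has mass (2 \<pi>)^n for every \<delta> and concentrates at \<xi> as \<delta> tends to 0.\<close>

lemma integral_cas_cas_gauss:
  fixes \<xi> \<eta> :: "'a::euclidean_space"
  assumes "\<delta> > 0"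
  shows "(LINT x|lborel. cas (\<xi> \<bullet> x) * cas (\<eta> \<bullet> x) * exp (- (norm (\<delta> *\<^sub>R x))\<^sup>2 / 2))
     = (2 * pi) ^ DIM('a) / \<delta> ^ DIM('a) * gauss ((\<xi> - \<eta>) /\<^sub>R \<delta>)"
proof -
  define c where "c = sqrt (2 * pi) ^ DIM('a)"
  have c: "c > 0" "c * c = (2 * pi) ^ DIM('a)"
    unfolding c_def power_mult_distrib[symmetric] by simp_all
  have g: "integrable lborel (\<lambda>x::'a. gauss (\<delta> *\<^sub>R x))"
    using integrable_lborel_affine[of \<delta> gauss 0] integrable_gauss assms by simp
  have e: "exp (- (norm (\<delta> *\<^sub>R x))\<^sup>2 / 2) = c * gauss (\<delta> *\<^sub>R x)" for x :: 'a
    using c by (simp add: gauss_eq c_def)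
  have i1: "integrable lborel (\<lambda>x. c * (cos ((\<xi> - \<eta>) \<bullet> x) * gauss (\<delta> *\<^sub>R x)))"
    by (intro integrable_mult_right Bochner_Integration.integrable_bound[OF g])
       (auto simp: abs_mult gauss_pos less_imp_le mult_left_le_one_le)
  have i2: "integrable lborel (\<lambda>x. c * (sin ((\<xi> + \<eta>) \<bullet> x) * gauss (\<delta> *\<^sub>R x)))"
    by (intro integrable_mult_right Bochner_Integration.integrable_bound[OF g])
       (auto simp: abs_mult gauss_pos less_imp_le mult_left_le_one_le)
  have "(LINT x|lborel. cas (\<xi> \<bullet> x) * cas (\<eta> \<bullet> x) * exp (- (norm (\<delta> *\<^sub>R x))\<^sup>2 / 2)) =
    (LINT x|lborel. c * (cos ((\<xi> - \<eta>) \<bullet> x) * gauss (\<delta> *\<^sub>R x)) + c * (sin ((\<xi> + \<eta>) \<bullet> x) * gauss (\<delta> *\<^sub>R x)))"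
    by (rule Bochner_Integration.integral_cong[OF refl],
        simp only: e cas_mult_cas inner_diff_left inner_add_left, simp only: ring_distribs mult_ac)
  also have "\<dots> = (LINT x|lborel. c * (cos ((\<xi> - \<eta>) \<bullet> x) * gauss (\<delta> *\<^sub>R x))) + (LINT x|lborel. c * (sin ((\<xi> + \<eta>) \<bullet> x) * gauss (\<delta> *\<^sub>R x)))"
    by (rule Bochner_Integration.integral_add[OF i1 i2])
  also have "(LINT x|lborel. c * (sin ((\<xi> + \<eta>) \<bullet> x) * gauss (\<delta> *\<^sub>R x))) = 0"
    by (rule integral_odd_lborel) auto
  also have "(LINT x|lborel. c * (cos ((\<xi> - \<eta>) \<bullet> x) * gauss (\<delta> *\<^sub>R x))) =
    c * (LINT x|lborel. cos ((\<xi> - \<eta>) \<bullet> x) * gauss (\<delta> *\<^sub>R x))"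
    by simp
  also have "(LINT x|lborel. cos ((\<xi> - \<eta>) \<bullet> x) * gauss (\<delta> *\<^sub>R x)) =
    \<bar>1 / \<delta>\<bar> ^ DIM('a) * (LINT x|lborel. cos (((\<xi> - \<eta>) /\<^sub>R \<delta>) \<bullet> x) * gauss x)"
    using assms by (subst integral_lborel_affine[of "1 / \<delta>" _ 0]) (auto simp: inverse_eq_divide)
  also have "(LINT x|lborel. cos (((\<xi> - \<eta>) /\<^sub>R \<delta>) \<bullet> x) * gauss x) = c * gauss ((\<xi> - \<eta>) /\<^sub>R \<delta>)"
    unfolding integral_cos_gauss using c by (simp add: gauss_eq c_def)
  finally show ?thesis unfolding c(2)[symmetric] using assms by (simp add: power_one_over)
qed

section \<open>The Hartley transform and its Plancherel identity\<close>

text \<open>Continuity and bounded support make every integral below absolutely convergent, and the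
  class is stable under multiplication by any continuous symbol, so unbounded multipliers such as
  |\<xi>|^2 demand no decay conditions.\<close>

definition adm :: "('a::euclidean_space \<Rightarrow> 'b::euclidean_space) \<Rightarrow> bool" where
  "adm F \<longleftrightarrow> continuous_on UNIV F \<and> (\<exists>R. \<forall>\<xi>. norm \<xi> > R \<longrightarrow> F \<xi> = 0)"

definition hartley :: "('a::euclidean_space \<Rightarrow> 'b::euclidean_space) \<Rightarrow> 'a \<Rightarrow> 'b" where
  "hartley F x = (LINT \<xi>|lborel. cas (\<xi> \<bullet> x) *\<^sub>R F \<xi>)"

lemma adm_continuous: "adm F \<Longrightarrow> continuous_on UNIV F"
  by (simp add: adm_def)

lemma adm_measurable: "adm F \<Longrightarrow> F \<in> borel_measurable borel"
  by (auto simp: adm_def intro: borel_measurable_continuous_onI)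

lemma adm_mult:
  assumes "adm F" "continuous_on UNIV m"
  shows "adm (\<lambda>\<xi>. m \<xi> *\<^sub>R F \<xi>)"
  using assms unfolding adm_def by (auto intro!: continuous_on_scaleR)

lemma adm_add: "adm F \<Longrightarrow> adm G \<Longrightarrow> adm (\<lambda>\<xi>. F \<xi> + G \<xi>)"
  unfolding adm_def
proof (safe, goal_cases)
  case (2 R S)
  then show ?case by (intro exI[of _ "max R S"]) auto
qed (intro continuous_on_add)

lemma adm_linear:
  assumes "adm F" "bounded_linear h"
  shows "adm (\<lambda>\<xi>. h (F \<xi>))"
proof -
  interpret h: bounded_linear h by fact
  show ?thesis using assms(1) unfolding adm_def
    by (metis h.continuous_on h.zero)
qed

lemma adm_uminus_arg: "adm F \<Longrightarrow> adm (\<lambda>\<xi>. F (- \<xi>))"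
  unfolding adm_def
proof (safe, goal_cases)
  case (1 R)
  then show ?case
    by (intro continuous_on_compose2[of UNIV F UNIV uminus] continuous_on_minus) auto
qed (metis norm_minus_cancel)

lemma adm_bounded:
  assumes "adm F"
  obtains B where "B > 0" "\<And>\<xi>. norm (F \<xi>) \<le> B"
proof -
  from assms obtain R where R: "\<And>\<xi>. norm \<xi> > R \<Longrightarrow> F \<xi> = 0" and c: "continuous_on UNIV F"
    by (auto simp: adm_def)
  have "compact (F ` cball 0 R)"
    by (intro compact_continuous_image continuous_on_subset[OF c]) auto
  then obtain B where B: "B > 0" "\<And>x. x \<in> F ` cball 0 R \<Longrightarrow> norm x \<le> B"
    by (meson bounded_pos compact_imp_bounded)
  have "norm (F \<xi>) \<le> B" for \<xi>
    using B R[of \<xi>] by (cases "norm \<xi> > R") auto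
  with B(1) that show ?thesis by blast
qed

lemma adm_integrable:
  assumes "adm F"
  shows "integrable lborel F"
proof -
  from assms obtain R where R: "\<And>\<xi>. norm \<xi> > R \<Longrightarrow> F \<xi> = 0" and c: "continuous_on UNIV F"
    by (auto simp: adm_def)
  have "integrable lborel (\<lambda>x. indicator (cball 0 R) x *\<^sub>R F x)"
    by (intro borel_integrable_compact continuous_on_subset[OF c]) auto
  also have "(\<lambda>x. indicator (cball 0 R) x *\<^sub>R F x) = F"
    using R by (force simp: indicator_def fun_eq_iff)
  finally show ?thesis .
qed

lemma hartley_integrable:
  assumes "adm F"
  shows "integrable lborel (\<lambda>\<xi>. cas (\<xi> \<bullet> x) *\<^sub>R F \<xi>)"
  by (intro adm_integrable adm_mult assms continuous_on_cas continuous_intros)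

lemma hartley_bounded:
  assumes "adm F"
  shows "norm (hartley F x) \<le> 2 * (LINT \<xi>|lborel. norm (F \<xi>))"
proof -
  have "norm (hartley F x) \<le> (LINT \<xi>|lborel. 2 * norm (F \<xi>))"
    unfolding hartley_def
    by (intro Bochner_Integration.integral_norm_bound_integral hartley_integrable[OF assms] integrable_mult_right integrable_norm
        adm_integrable[OF assms])
      (auto intro!: mult_right_mono abs_cas_le)
  then show ?thesis by simp
qed

lemma hartley_measurable:
  assumes "adm F"
  shows "hartley F \<in> borel_measurable borel"
proof -
  note [measurable] = adm_measurable[OF assms]
  show ?thesis unfolding hartley_def[abs_def] by measurable
qed

lemma hartley_inner:
  assumes "adm F"
  shows "hartley (\<lambda>\<xi>. F \<xi> \<bullet> b) x = hartley F x \<bullet> b"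
  unfolding hartley_def
  using integral_inner_left[of b lborel "\<lambda>\<xi>. cas (\<xi> \<bullet> x) *\<^sub>R F \<xi>"] hartley_integrable[OF assms, of x]
  by simp

lemma hartley_linear:
  assumes "adm F" "bounded_linear h"
  shows "hartley (\<lambda>\<xi>. h (F \<xi>)) x = h (hartley F x)"
proof -
  interpret h: bounded_linear h by fact
  show ?thesis
  unfolding hartley_def
  using integral_bounded_linear[OF assms(2) hartley_integrable[OF assms(1), of x]]
  by (simp add: h.scaleR)
qed

lemma hartley_add:
  assumes "adm F" "adm G"
  shows "hartley (\<lambda>\<xi>. F \<xi> + G \<xi>) x = hartley F x + hartley G x"
  unfolding hartley_def scaleR_right_distrib
  by (intro Bochner_Integration.integral_add hartley_integrable assms)

lemma hartley_scaleR: "hartley (\<lambda>\<xi>. c *\<^sub>R F \<xi>) x = c *\<^sub>R hartley F x"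
proof -
  have "(LINT \<xi>|lborel. cas (\<xi> \<bullet> x) *\<^sub>R c *\<^sub>R F \<xi>) = (LINT \<xi>|lborel. c *\<^sub>R cas (\<xi> \<bullet> x) *\<^sub>R F \<xi>)"
    by (simp only: scaleR_left_commute)
  then show ?thesis by (simp only: hartley_def integral_scaleR_right)
qed

text \<open>Since \<open>cas a * cas b = cos (a - b) + sin (a + b)\<close> and the sine is killed by the even Gaussian
  weight, the regularized square of the transform is a convolution with an approximate identity.\<close>

lemma hartley_regularized:
  fixes F :: "'a::euclidean_space \<Rightarrow> real"
  assumes F: "adm F" and \<delta>: "\<delta> > 0"
  shows "(LINT x|lborel. exp (- (norm (\<delta> *\<^sub>R x))\<^sup>2 / 2) * (hartley F x)\<^sup>2) =
    (2 * pi) ^ DIM('a) * (LINT \<xi>|lborel. F \<xi> * (LINT \<zeta>|lborel. F (\<xi> - \<delta> *\<^sub>R \<zeta>) * gauss \<zeta>))"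
proof -
  let ?w = "\<lambda>x::'a. exp (- (norm (\<delta> *\<^sub>R x))\<^sup>2 / 2)"
  define c where "c = sqrt (2 * pi) ^ DIM('a)"
  have c: "c > 0" by (simp add: c_def)
  have w: "?w x = c * gauss (\<delta> *\<^sub>R x)" for x :: 'a
    using c by (simp add: gauss_eq c_def)
  have wi: "integrable lborel ?w"
    unfolding w using integrable_lborel_affine[of \<delta> "gauss :: 'a \<Rightarrow> real" 0] integrable_gauss[where 'a='a] \<delta> by simp
  note [measurable] = adm_measurable[OF F] hartley_measurable[OF F]
  note Fi = adm_integrable[OF F]
  obtain H where H: "\<And>x. \<bar>hartley F x\<bar> \<le> H" using hartley_bounded[OF F] by auto
  have H0: "0 \<le> H" using H[of 0] by linarith
  have prod: "integrable (lborel \<Otimes>\<^sub>M lborel) (\<lambda>(x, \<xi>). ?w x * F \<xi>)"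
    using wi Fi by (intro lborel_pair.Fubini_integrable) (auto simp: abs_mult)
  \<comment> \<open>The two exchanges of integration below share this shape, with the bounded weight
    \<open>g\<close> equal first to \<open>hartley F\<close> and then to the kernel at a fixed
    frequency.\<close>
  have fub: "(LINT x|lborel. LINT \<xi>|lborel. ?w x * g x * (cas (\<xi> \<bullet> x) * F \<xi>)) =
     (LINT \<xi>|lborel. LINT x|lborel. ?w x * g x * (cas (\<xi> \<bullet> x) * F \<xi>))"
    if [measurable]: "g \<in> borel_measurable borel" and g: "\<And>x. \<bar>g x\<bar> \<le> G" for g and G :: real
  proof (rule lborel_pair.Fubini_integral[symmetric])
    have "\<bar>?w x * g x * (cas (\<xi> \<bullet> x) * F \<xi>)\<bar> \<le> \<bar>2 * G * (?w x * F \<xi>)\<bar>" for x \<xi>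
    proof -
      have "\<bar>?w x * g x * (cas (\<xi> \<bullet> x) * F \<xi>)\<bar> = (\<bar>g x\<bar> * \<bar>cas (\<xi> \<bullet> x)\<bar>) * \<bar>?w x * F \<xi>\<bar>"
        by (simp add: abs_mult)
      also have "\<dots> \<le> (G * 2) * \<bar>?w x * F \<xi>\<bar>"
        using g[of x] abs_cas_le by (intro mult_right_mono mult_mono) auto
      also have "\<dots> = \<bar>2 * G * (?w x * F \<xi>)\<bar>"
        using g[of x] by (simp add: abs_mult)
      finally show ?thesis .
    qed
    then show "integrable (lborel \<Otimes>\<^sub>M lborel) (\<lambda>(x, \<xi>). ?w x * g x * (cas (\<xi> \<bullet> x) * F \<xi>))"
      by (intro Bochner_Integration.integrable_bound[OF integrable_mult_right[OF prod, of "2 * G"]])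
        (auto simp: split_beta)
  qed
  have "(LINT x|lborel. ?w x * (hartley F x)\<^sup>2) =
    (LINT x|lborel. LINT \<xi>|lborel. ?w x * hartley F x * (cas (\<xi> \<bullet> x) * F \<xi>))"
    by (simp add: hartley_def power2_eq_square mult.assoc)
  also have "\<dots> = (LINT \<xi>|lborel. LINT x|lborel. ?w x * hartley F x * (cas (\<xi> \<bullet> x) * F \<xi>))"
    by (rule fub[OF _ H]) simp
  also have "\<dots> = (LINT \<xi>|lborel. F \<xi> * (LINT x|lborel. LINT \<eta>|lborel. ?w x * cas (\<xi> \<bullet> x) * (cas (\<eta> \<bullet> x) * F \<eta>)))"
  proof (rule Bochner_Integration.integral_cong[OF refl])
    fix \<xi> :: 'a
    have "(LINT x|lborel. ?w x * hartley F x * (cas (\<xi> \<bullet> x) * F \<xi>)) =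
       (LINT x|lborel. F \<xi> * (?w x * cas (\<xi> \<bullet> x) * hartley F x))"
      by (simp add: mult_ac)
    also have "\<dots> = F \<xi> * (LINT x|lborel. ?w x * cas (\<xi> \<bullet> x) * hartley F x)"
      by simp
    finally show "(LINT x|lborel. ?w x * hartley F x * (cas (\<xi> \<bullet> x) * F \<xi>)) =
        F \<xi> * (LINT x|lborel. LINT \<eta>|lborel. ?w x * cas (\<xi> \<bullet> x) * (cas (\<eta> \<bullet> x) * F \<eta>))"
      by (simp add: hartley_def)
  qed
  also have "\<dots> = (LINT \<xi>|lborel. F \<xi> * ((2 * pi) ^ DIM('a) * (LINT \<zeta>|lborel. F (\<xi> - \<delta> *\<^sub>R \<zeta>) * gauss \<zeta>)))"
  proof (rule Bochner_Integration.integral_cong[OF refl])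
    fix \<xi> :: 'a
    have "(LINT x|lborel. LINT \<eta>|lborel. ?w x * cas (\<xi> \<bullet> x) * (cas (\<eta> \<bullet> x) * F \<eta>)) =
      (LINT \<eta>|lborel. LINT x|lborel. ?w x * cas (\<xi> \<bullet> x) * (cas (\<eta> \<bullet> x) * F \<eta>))"
      by (rule fub[OF _ abs_cas_le]) simp
    also have "\<dots> = (LINT \<eta>|lborel. F \<eta> * (LINT x|lborel. cas (\<xi> \<bullet> x) * cas (\<eta> \<bullet> x) * ?w x))"
      by (simp add: mult_ac flip: integral_mult_right_zero)
    also have "\<dots> = (LINT \<eta>|lborel. F \<eta> * ((2 * pi) ^ DIM('a) / \<delta> ^ DIM('a) * gauss ((\<xi> - \<eta>) /\<^sub>R \<delta>)))"
      by (simp only: integral_cas_cas_gauss[OF \<delta>])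
    \<comment> \<open>The substitution \<eta> = \<xi> - \<delta> \<zeta>, whose Jacobian cancels the
      factor 1 / \<delta>^n.\<close>
    also have "\<dots> = \<bar>- \<delta>\<bar> ^ DIM('a) *\<^sub>R (LINT \<zeta>|lborel. F (\<xi> + (- \<delta>) *\<^sub>R \<zeta>) *
        ((2 * pi) ^ DIM('a) / \<delta> ^ DIM('a) * gauss ((\<xi> - (\<xi> + (- \<delta>) *\<^sub>R \<zeta>)) /\<^sub>R \<delta>)))"
      using \<delta> by (intro integral_lborel_affine) auto
    also have "\<dots> = \<delta> ^ DIM('a) * (LINT \<zeta>|lborel. ((2 * pi) ^ DIM('a) / \<delta> ^ DIM('a)) * (F (\<xi> - \<delta> *\<^sub>R \<zeta>) * gauss \<zeta>))"
      using \<delta> by (simp add: mult_ac)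
    also have "\<dots> = (2 * pi) ^ DIM('a) * (LINT \<zeta>|lborel. F (\<xi> - \<delta> *\<^sub>R \<zeta>) * gauss \<zeta>)"
      using \<delta> by simp
    finally show "F \<xi> * (LINT x|lborel. LINT \<eta>|lborel. ?w x * cas (\<xi> \<bullet> x) * (cas (\<eta> \<bullet> x) * F \<eta>)) =
      F \<xi> * ((2 * pi) ^ DIM('a) * (LINT \<zeta>|lborel. F (\<xi> - \<delta> *\<^sub>R \<zeta>) * gauss \<zeta>))" by simp
  qed
  also have "\<dots> = (2 * pi) ^ DIM('a) * (LINT \<xi>|lborel. F \<xi> * (LINT \<zeta>|lborel. F (\<xi> - \<delta> *\<^sub>R \<zeta>) * gauss \<zeta>))"
    by (simp only: mult.left_commute[of "F _"] integral_mult_right_zero)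
  finally show ?thesis .
qed

text \<open>Let \<delta> tend to 0 in \<open>hartley_regularized\<close>. The frequency side
  converges dominatedly. On the space side the Gaussian weights increase to 1, and monotone
  convergence yields the integrability of the squared transform together with the value of its
  integral.\<close>

lemma plancherel_real:
  fixes F :: "'a::euclidean_space \<Rightarrow> real"
  assumes F: "adm F"
  shows "has_bochner_integral lborel (\<lambda>x. (hartley F x)\<^sup>2) ((2 * pi) ^ DIM('a) * (LINT \<xi>|lborel. (F \<xi>)\<^sup>2))"
proof -
  note [measurable] = adm_measurable[OF F] hartley_measurable[OF F]
  obtain B where B: "B > 0" "\<And>\<xi>. \<bar>F \<xi>\<bar> \<le> B" using adm_bounded[OF F] by auto
  define d :: "nat \<Rightarrow> real" where "d k = inverse (Suc k)" for k
  have d: "d k > 0" "d \<longlonglongrightarrow> 0" for k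
    using LIMSEQ_inverse_real_of_nat by (auto simp: d_def[abs_def])
  let ?w = "\<lambda>k x::'a. exp (- (norm (d k *\<^sub>R x))\<^sup>2 / 2)"
  let ?I = "\<lambda>k \<xi>. (LINT \<zeta>|lborel. F (\<xi> - d k *\<^sub>R \<zeta>) * gauss \<zeta>)"
  have I_lim: "(\<lambda>k. ?I k \<xi>) \<longlonglongrightarrow> F \<xi>" for \<xi>
  proof -
    have "(\<lambda>k. ?I k \<xi>) \<longlonglongrightarrow> (LINT \<zeta>|lborel. F \<xi> * gauss (\<zeta>::'a))"
    proof (rule integral_dominated_convergence[where w="\<lambda>\<zeta>. B * gauss \<zeta>"])
      have "(\<lambda>k. F (\<xi> - d k *\<^sub>R \<zeta>) * gauss \<zeta>) \<longlonglongrightarrow> F (\<xi> - 0 *\<^sub>R \<zeta>) * gauss \<zeta>" for \<zeta>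
        by (intro tendsto_mult tendsto_const isCont_tendsto_compose[of _ F] tendsto_diff tendsto_scaleR d)
          (use adm_continuous[OF F] in \<open>auto simp: continuous_on_eq_continuous_at\<close>)
      then show "AE \<zeta> in lborel. (\<lambda>k. F (\<xi> - d k *\<^sub>R \<zeta>) * gauss \<zeta>) \<longlonglongrightarrow> F \<xi> * gauss \<zeta>"
        by simp
    qed (auto simp: integrable_gauss abs_mult gauss_pos less_imp_le B intro!: mult_right_mono)
    then show ?thesis by (simp add: integral_gauss)
  qed
  have I_le: "\<bar>?I k \<xi>\<bar> \<le> B" for k \<xi>
  proof -
    have "\<bar>?I k \<xi>\<bar> \<le> (LINT \<zeta>|lborel. B * gauss (\<zeta>::'a))"
      unfolding real_norm_def[symmetric]
      by (intro Bochner_Integration.integral_norm_bound_integral Bochner_Integration.integrable_bound[OF integrable_mult_right[OF integrable_gauss, of B]] integrable_mult_right integrable_gauss)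
        (use B in \<open>auto simp: abs_mult gauss_pos less_imp_le intro!: mult_right_mono\<close>)
    then show ?thesis by (simp add: integral_gauss)
  qed
  have lim1: "(\<lambda>k. LINT \<xi>|lborel. F \<xi> * ?I k \<xi>) \<longlonglongrightarrow> (LINT \<xi>|lborel. F \<xi> * F \<xi>)"
  proof (rule integral_dominated_convergence[where w="\<lambda>\<xi>. \<bar>F \<xi>\<bar> * B"])
    show "AE \<xi> in lborel. (\<lambda>k. F \<xi> * ?I k \<xi>) \<longlonglongrightarrow> F \<xi> * F \<xi>"
      by (intro AE_I2 tendsto_mult tendsto_const I_lim)
    show "AE \<xi> in lborel. norm (F \<xi> * ?I k \<xi>) \<le> \<bar>F \<xi>\<bar> * B" for k
      using I_le by (auto simp: abs_mult intro!: mult_left_mono)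
    show "integrable lborel (\<lambda>\<xi>. \<bar>F \<xi>\<bar> * B)"
      using adm_integrable[OF F] by auto
  qed auto
  have lim: "(\<lambda>k. LINT x|lborel. ?w k x * (hartley F x)\<^sup>2) \<longlonglongrightarrow>
      (2 * pi) ^ DIM('a) * (LINT \<xi>|lborel. (F \<xi>)\<^sup>2)"
    unfolding hartley_regularized[OF F d(1)] power2_eq_square[of "F _"]
    by (intro tendsto_mult_left lim1)
  obtain H where H: "\<And>x. \<bar>hartley F x\<bar> \<le> H" using hartley_bounded[OF F] by auto
  show ?thesis
  proof (rule has_bochner_integral_monotone_convergence[OF _ _ _ lim])
    fix k
    have "integrable lborel (\<lambda>x::'a. gauss (d k *\<^sub>R x))"
      using integrable_lborel_affine[of "d k" "gauss::'a\<Rightarrow>real" 0] integrable_gauss[where 'a='a] d(1)[of k] by simp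
    then have "integrable lborel (\<lambda>x::'a. H\<^sup>2 * (sqrt (2 * pi) ^ DIM('a) * gauss (d k *\<^sub>R x)))"
      by simp
    then show "integrable lborel (\<lambda>x. ?w k x * (hartley F x)\<^sup>2)"
    proof (rule Bochner_Integration.integrable_bound)
      have "(hartley F x)\<^sup>2 \<le> H\<^sup>2" for x
        using H[of x] by (metis abs_ge_zero power2_abs power_mono)
      then show "AE x in lborel. norm (?w k x * (hartley F x)\<^sup>2) \<le> norm (H\<^sup>2 * (sqrt (2 * pi) ^ DIM('a) * gauss (d k *\<^sub>R x)))"
        by (auto simp: gauss_eq abs_mult mult.commute)
    qed simp
  next
    show "AE x in lborel. mono (\<lambda>k. ?w k x * (hartley F x)\<^sup>2)"
    proof (intro AE_I2 monoI mult_right_mono)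
      fix x :: 'a and i j :: nat assume "i \<le> j"
      then have "d j \<le> d i" by (auto simp: d_def)
      then have "(norm (d j *\<^sub>R x))\<^sup>2 \<le> (norm (d i *\<^sub>R x))\<^sup>2"
        using d(1)[of i] d(1)[of j] by (intro power_mono) (auto intro!: mult_right_mono)
      then show "?w i x \<le> ?w j x" by simp
    qed simp
    show "AE x in lborel. (\<lambda>k. ?w k x * (hartley F x)\<^sup>2) \<longlonglongrightarrow> (hartley F x)\<^sup>2"
    proof (intro AE_I2)
      fix x :: 'a
      have "(\<lambda>k. ?w k x * (hartley F x)\<^sup>2) \<longlonglongrightarrow> exp (- (norm (0 *\<^sub>R x))\<^sup>2 / 2) * (hartley F x)\<^sup>2"
        by (intro tendsto_intros d) auto
      then show "(\<lambda>k. ?w k x * (hartley F x)\<^sup>2) \<longlonglongrightarrow> (hartley F x)\<^sup>2" by simp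
    qed
  qed simp
qed

lemma norm_square_eq_sum_Basis: "(norm (y::'b::euclidean_space))\<^sup>2 = (\<Sum>b\<in>Basis. (y \<bullet> b)\<^sup>2)"
  by (subst power2_norm_eq_inner, subst euclidean_inner) (simp add: power2_eq_square)

lemma adm_norm_square_integrable:
  assumes F: "adm (F :: 'a::euclidean_space \<Rightarrow> 'b::euclidean_space)"
  shows "integrable lborel (\<lambda>\<xi>. (norm (F \<xi>))\<^sup>2)"
proof -
  have "adm (\<lambda>\<xi>. norm (F \<xi>) *\<^sub>R norm (F \<xi>))"
    using F by (intro adm_mult) (auto simp: adm_def intro!: continuous_on_norm)
  from adm_integrable[OF this] show ?thesis by (simp add: power2_eq_square)
qed

theorem plancherel:
  fixes F :: "'a::euclidean_space \<Rightarrow> 'b::euclidean_space"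
  assumes F: "adm F"
  shows "has_bochner_integral lborel (\<lambda>x. (norm (hartley F x))\<^sup>2) ((2 * pi) ^ DIM('a) * (LINT \<xi>|lborel. (norm (F \<xi>))\<^sup>2))"
proof -
  have a: "adm (\<lambda>\<xi>. F \<xi> \<bullet> b)" for b
    by (intro adm_linear[OF F] bounded_linear_inner_left)
  have "has_bochner_integral lborel (\<lambda>x. \<Sum>b\<in>Basis. (hartley F x \<bullet> b)\<^sup>2)
     (\<Sum>b\<in>Basis. (2 * pi) ^ DIM('a) * (LINT \<xi>|lborel. (F \<xi> \<bullet> b)\<^sup>2))"
    using plancherel_real[OF a] unfolding hartley_inner[OF F]
    by (intro has_bochner_integral_sum)
  moreover have "(LINT \<xi>|lborel. (norm (F \<xi>))\<^sup>2) = (\<Sum>b\<in>Basis. (LINT \<xi>|lborel. (F \<xi> \<bullet> b)\<^sup>2))"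
    unfolding norm_square_eq_sum_Basis
    using adm_norm_square_integrable[OF a] by (intro Bochner_Integration.integral_sum) simp
  ultimately show ?thesis by (simp add: norm_square_eq_sum_Basis sum_distrib_left)
qed

lemma L2_norm_lborel:
  assumes "u \<in> borel_measurable borel"
  shows "L2_norm u = sqrt (LINT x|lborel. (norm (u x))\<^sup>2)"
  unfolding L2_norm_def using assms by (subst integral_completion) auto

lemma hartley_L2: "adm F \<Longrightarrow> hartley F \<in> L2_space"
  using plancherel[of F] hartley_measurable[of F] unfolding L2_space_def
  by (auto simp: has_bochner_integral_iff integrable_completion intro!: measurable_completion)

lemma L2_norm_hartley:
  fixes F :: "'a::euclidean_space \<Rightarrow> 'b::euclidean_space"
  shows "adm F \<Longrightarrow> L2_norm (hartley F) = sqrt ((2 * pi) ^ DIM('a)) * L2_norm F"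
  using plancherel[of F]
  by (simp add: L2_norm_lborel has_bochner_integral_iff real_sqrt_mult hartley_measurable adm_measurable)

section \<open>Weak derivatives of a Hartley transform\<close>

lemma test_function_C_space: "test_function \<phi> \<Longrightarrow> C_space k \<phi>"
  by (simp add: test_function_def)

lemma test_function_continuous: "test_function \<phi> \<Longrightarrow> continuous_on UNIV \<phi>"
  using test_function_C_space[of \<phi> 0] by simp

lemma test_function_differentiable: "test_function \<phi> \<Longrightarrow> \<phi> differentiable (at x)"
  using test_function_C_space[of \<phi> 1] by simp

lemma test_function_support:
  assumes "test_function \<phi>"
  obtains R where "R > 0" "\<And>x. norm x > R \<Longrightarrow> \<phi> x = 0"
proof -
  have "bounded {x. \<phi> x \<noteq> 0}"
    using assms unfolding test_function_def
    by (meson bounded_subset closure_subset compact_imp_bounded)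
  then obtain R where "R > 0" "\<And>x. \<phi> x \<noteq> 0 \<Longrightarrow> norm x \<le> R"
    by (auto simp: bounded_pos)
  with that show ?thesis by (metis linorder_not_less)
qed

lemma test_function_adm: "test_function \<phi> \<Longrightarrow> adm \<phi>"
  using test_function_support test_function_continuous unfolding adm_def by metis

lemma pd_eq_0:
  assumes "open S" "x \<in> S" "\<And>y. y \<in> S \<Longrightarrow> \<phi> y = 0"
  shows "pd i \<phi> x = 0"
proof -
  have "(\<phi> has_derivative (\<lambda>_. 0)) (at x)"
    by (rule has_derivative_transform_within_open[of "\<lambda>_. 0" "\<lambda>_. 0" x UNIV S])
      (simp_all add: assms(1,2) assms(3)[symmetric])
  then have "frechet_derivative \<phi> (at x) = (\<lambda>_. 0)"
    using frechet_derivative_at by metis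
  then show ?thesis by (simp add: pd_def)
qed

lemma test_function_pd:
  assumes "test_function \<phi>"
  shows "test_function (pd i \<phi>)"
proof -
  have "C_space k (pd i \<phi>)" for k
    using test_function_C_space[OF assms, of "Suc k"] by simp
  moreover have "{x. pd i \<phi> x \<noteq> 0} \<subseteq> closure {x. \<phi> x \<noteq> 0}"
  proof (rule ccontr)
    assume "\<not> ?thesis"
    then obtain x where x: "pd i \<phi> x \<noteq> 0" "x \<in> - closure {x. \<phi> x \<noteq> 0}" by blast
    have "pd i \<phi> x = 0"
    proof (rule pd_eq_0[OF _ x(2)])
      show "\<phi> y = 0" if "y \<in> - closure {x. \<phi> x \<noteq> 0}" for y
        using that closure_subset[of "{x. \<phi> x \<noteq> 0}"] by auto
    qed (simp add: open_Compl)
    with x show False by simp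
  qed
  then have "closure {x. pd i \<phi> x \<noteq> 0} \<subseteq> closure {x. \<phi> x \<noteq> 0}"
    by (simp add: closure_minimal)
  ultimately show ?thesis
    using assms unfolding test_function_def
    by (meson bounded_subset closed_closure compact_eq_bounded_closed)
qed

lemma test_function_pds: "test_function \<phi> \<Longrightarrow> test_function (pds is \<phi>)"
  by (induction "is") (auto intro: test_function_pd)

lemma test_function_has_derivative_line:
  assumes "test_function \<phi>"
  shows "((\<lambda>h. \<phi> (x + h *\<^sub>R axis i 1)) has_real_derivative pd i \<phi> (x + h *\<^sub>R axis i 1)) (at h)"
proof -
  let ?y = "x + h *\<^sub>R axis i 1"
  have d: "(\<phi> has_derivative frechet_derivative \<phi> (at ?y)) (at ?y)"
    using test_function_differentiable[OF assms] frechet_derivative_works by blast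
  have "((\<lambda>h. x + h *\<^sub>R axis i 1) has_derivative (\<lambda>k. k *\<^sub>R axis i 1)) (at h)"
    by (auto intro!: derivative_eq_intros)
  from has_derivative_compose[OF this d]
  have "((\<lambda>h. \<phi> (x + h *\<^sub>R axis i 1)) has_derivative (\<lambda>k. frechet_derivative \<phi> (at ?y) (k *\<^sub>R axis i 1))) (at h)" .
  moreover have "frechet_derivative \<phi> (at ?y) (k *\<^sub>R axis i 1) = pd i \<phi> ?y * k" for k
    using linear_scale[OF has_derivative_linear[OF d]] by (simp add: pd_def)
  ultimately show ?thesis by (simp add: has_field_derivative_def)
qed

text \<open>The multiplier of a partial derivative: the kernel satisfies \<open>cas' r = cas (- r)\<close>, and the
  substitution \<open>\<xi> \<mapsto> - \<xi>\<close> restores \<open>cas\<close>.\<close>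

definition dsym :: "'n \<Rightarrow> (real^'n \<Rightarrow> 'b) \<Rightarrow> real^'n \<Rightarrow> 'b::real_vector" where
  "dsym i F \<xi> = (- (\<xi> $ i)) *\<^sub>R F (- \<xi>)"

text \<open>The head of the list acts first here but last in \<open>pds\<close>: integration by
  parts takes the outermost derivative off the test function first.\<close>

primrec dsyms :: "'n list \<Rightarrow> (real^'n \<Rightarrow> 'b) \<Rightarrow> real^'n \<Rightarrow> 'b::real_vector" where
  "dsyms [] F = F"
| "dsyms (i # is) F = dsyms is (dsym i F)"

lemma adm_dsym: "adm F \<Longrightarrow> adm (dsym i F)"
  unfolding dsym_def[abs_def]
  by (intro adm_mult adm_uminus_arg continuous_on_minus continuous_on_component continuous_on_id)

lemma adm_dsyms: "adm F \<Longrightarrow> adm (dsyms is F)"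
  by (induction "is" arbitrary: F) (auto intro: adm_dsym)

lemma cas_has_derivative: "(cas has_real_derivative cas (- r)) (at r)"
  unfolding cas_def[abs_def] by (auto intro!: derivative_eq_intros)

lemma cas_lipschitz: "\<bar>cas a - cas b\<bar> \<le> 2 * \<bar>a - b\<bar>"
proof -
  have "norm (cas a - cas b) \<le> 2 * norm (a - b)"
    by (rule field_differentiable_bound[of UNIV cas "\<lambda>r. cas (- r)"])
      (auto intro: cas_has_derivative abs_cas_le)
  then show ?thesis by simp
qed

text \<open>The kernel is Lipschitz with constant 2, so the difference quotients under the integral
  are dominated by a multiple of |\<xi>_i| |F|, uniformly in the step and in x. The second claim
  records that uniform bound, which serves as the dominating constant when the quotient is
  integrated against a test function.\<close>

lemma hartley_diff_quotient:
  fixes F :: "real^'n::finite \<Rightarrow> 'b::euclidean_space"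
  assumes F: "adm F" and d: "\<And>k. d k \<noteq> 0" "d \<longlonglongrightarrow> 0"
  shows "(\<lambda>k. (hartley F (x + d k *\<^sub>R axis i 1) - hartley F x) /\<^sub>R d k) \<longlonglongrightarrow> hartley (dsym i F) x"
    and "norm ((hartley F (x + d k *\<^sub>R axis i 1) - hartley F x) /\<^sub>R d k) \<le> 2 * (LINT \<xi>|lborel. \<bar>\<xi> $ i\<bar> * norm (F \<xi>))"
proof -
  note [measurable] = adm_measurable[OF F]
  have [measurable]: "(\<lambda>\<xi>::real^'n. \<xi> $ i) \<in> borel_measurable borel"
    by (intro borel_measurable_continuous_onI continuous_on_component continuous_on_id)
  let ?q = "\<lambda>k \<xi>. ((cas (\<xi> \<bullet> (x + d k *\<^sub>R axis i 1)) - cas (\<xi> \<bullet> x)) / d k) *\<^sub>R F \<xi>"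
  have in_ax: "\<xi> \<bullet> (x + h *\<^sub>R axis i 1) = \<xi> \<bullet> x + h * \<xi> $ i" for \<xi> h
    by (simp add: inner_add_right inner_axis)
  have eq: "(hartley F (x + d k *\<^sub>R axis i 1) - hartley F x) /\<^sub>R d k = (LINT \<xi>|lborel. ?q k \<xi>)" for k
    unfolding hartley_def Bochner_Integration.integral_diff[OF hartley_integrable[OF F] hartley_integrable[OF F], symmetric]
      integral_scaleR_right[symmetric]
    by (simp add: scaleR_diff_left[symmetric] divide_inverse mult.commute)
  have adm: "adm (\<lambda>\<xi>. \<bar>\<xi> $ i\<bar> *\<^sub>R norm (F \<xi>))"
    using F by (intro adm_mult continuous_intros continuous_on_rabs continuous_on_component continuous_on_id)
       (auto simp: adm_def intro: continuous_on_norm)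
  have dom: "norm (?q k \<xi>) \<le> 2 * (\<bar>\<xi> $ i\<bar> * norm (F \<xi>))" for k \<xi>
  proof -
    have "\<bar>cas (\<xi> \<bullet> (x + d k *\<^sub>R axis i 1)) - cas (\<xi> \<bullet> x)\<bar> \<le> 2 * \<bar>d k * \<xi> $ i\<bar>"
      using cas_lipschitz[of "\<xi> \<bullet> (x + d k *\<^sub>R axis i 1)" "\<xi> \<bullet> x"] by (simp add: in_ax)
    then have "\<bar>cas (\<xi> \<bullet> (x + d k *\<^sub>R axis i 1)) - cas (\<xi> \<bullet> x)\<bar> / \<bar>d k\<bar> \<le> 2 * \<bar>\<xi> $ i\<bar>"
      using d(1)[of k] by (simp add: pos_divide_le_eq abs_mult mult_ac)
    then have "\<bar>cas (\<xi> \<bullet> (x + d k *\<^sub>R axis i 1)) - cas (\<xi> \<bullet> x)\<bar> / \<bar>d k\<bar> * norm (F \<xi>) \<le> 2 * \<bar>\<xi> $ i\<bar> * norm (F \<xi>)"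
      by (rule mult_right_mono) simp
    then show ?thesis by simp
  qed
  have int2: "integrable lborel (\<lambda>\<xi>. 2 * (\<bar>\<xi> $ i\<bar> * norm (F \<xi>)))"
    using adm_integrable[OF adm] by auto
  have qlim: "(\<lambda>k. ?q k \<xi>) \<longlonglongrightarrow> (cas (- (\<xi> \<bullet> x)) * \<xi> $ i) *\<^sub>R F \<xi>" for \<xi>
  proof (intro tendsto_scaleR tendsto_const)
    have "((\<lambda>h. cas (\<xi> \<bullet> x + h * \<xi> $ i)) has_real_derivative cas (- (\<xi> \<bullet> x + 0 * \<xi> $ i)) * \<xi> $ i) (at 0)"
      by (rule DERIV_chain'[where f="\<lambda>h. \<xi> \<bullet> x + h * \<xi> $ i" and g=cas])
        (auto intro!: derivative_eq_intros cas_has_derivative)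
    then have "((\<lambda>h. (cas (\<xi> \<bullet> x + h * \<xi> $ i) - cas (\<xi> \<bullet> x)) / h) \<longlongrightarrow> cas (- (\<xi> \<bullet> x)) * \<xi> $ i) (at 0)"
      by (simp add: DERIV_def)
    then have "(\<lambda>k. (cas (\<xi> \<bullet> x + d k * \<xi> $ i) - cas (\<xi> \<bullet> x)) / d k) \<longlonglongrightarrow> cas (- (\<xi> \<bullet> x)) * \<xi> $ i"
      by (rule filterlim_compose) (use d in \<open>auto simp: filterlim_at\<close>)
    then show "(\<lambda>k. (cas (\<xi> \<bullet> (x + d k *\<^sub>R axis i 1)) - cas (\<xi> \<bullet> x)) / d k) \<longlonglongrightarrow> cas (- (\<xi> \<bullet> x)) * \<xi> $ i"
      by (simp add: in_ax)
  qed
  have "(\<lambda>k. LINT \<xi>|lborel. ?q k \<xi>) \<longlonglongrightarrow> (LINT \<xi>|lborel. (cas (- (\<xi> \<bullet> x)) * \<xi> $ i) *\<^sub>R F \<xi>)"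
    by (rule integral_dominated_convergence[OF _ _ int2]) (use qlim dom in auto)
  also have "(LINT \<xi>|lborel. (cas (- (\<xi> \<bullet> x)) * \<xi> $ i) *\<^sub>R F \<xi>) = hartley (dsym i F) x"
    unfolding hartley_def dsym_def
    by (subst integral_lborel_uminus[symmetric]) auto
  finally show "(\<lambda>k. (hartley F (x + d k *\<^sub>R axis i 1) - hartley F x) /\<^sub>R d k) \<longlonglongrightarrow> hartley (dsym i F) x"
    unfolding eq .
  have "norm (LINT \<xi>|lborel. ?q k \<xi>) \<le> (LINT \<xi>|lborel. 2 * (\<bar>\<xi> $ i\<bar> * norm (F \<xi>)))"
    by (rule Bochner_Integration.integral_norm_bound_integral[OF _ int2 dom])
      (rule Bochner_Integration.integrable_bound[OF int2], use dom in auto)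
  then show "norm ((hartley F (x + d k *\<^sub>R axis i 1) - hartley F x) /\<^sub>R d k) \<le> 2 * (LINT \<xi>|lborel. \<bar>\<xi> $ i\<bar> * norm (F \<xi>))"
    unfolding eq by simp
qed

lemma integrable_test_mult:
  fixes u :: "real^'n::finite \<Rightarrow> 'b::euclidean_space"
  assumes "adm \<phi>" and [measurable]: "u \<in> borel_measurable borel" and B: "\<And>x. norm (u x) \<le> B"
  shows "integrable lborel (\<lambda>x. \<phi> x *\<^sub>R u x)"
proof (rule Bochner_Integration.integrable_bound)
  note [measurable] = adm_measurable[OF assms(1)]
  show "integrable lborel (\<lambda>x. B *\<^sub>R \<phi> x)" using adm_integrable[OF assms(1)] by simp
  have "B \<ge> 0" using B[of 0] norm_ge_zero order_trans by blast
  then show "AE x in lborel. norm (\<phi> x *\<^sub>R u x) \<le> norm (B *\<^sub>R \<phi> x)"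
    using B by (auto simp: abs_mult mult.commute[of B] intro!: mult_left_mono)
  show "(\<lambda>x. \<phi> x *\<^sub>R u x) \<in> borel_measurable lborel" by measurable
qed

lemma adm_translate: "adm F \<Longrightarrow> adm (\<lambda>x. F (x + a))"
  unfolding adm_def
proof (safe, goal_cases)
  case (1 R)
  then show ?case
    by (intro continuous_on_compose2[of UNIV F UNIV "\<lambda>x. x + a"] continuous_on_add continuous_on_id continuous_on_const) auto
next
  case (2 R)
  then show ?case
    by (intro exI[of _ "R + norm a"]) (smt (verit) norm_diff_ineq)
qed

text \<open>Translation invariance of the integral moves the difference quotient from the test function
  to the transform; both sides converge dominatedly.\<close>

lemma integral_pd_mult_hartley:
  fixes F :: "real^'n::finite \<Rightarrow> 'b::euclidean_space"
  assumes F: "adm F" and \<phi>: "test_function \<phi>"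
  shows "(LINT x|lborel. pd i \<phi> x *\<^sub>R hartley F x) = - (LINT x|lborel. \<phi> x *\<^sub>R hartley (dsym i F) x)"
proof -
  let ?e = "axis i (1::real)"
  note [measurable] = hartley_measurable[OF F] hartley_measurable[OF adm_dsym[OF F]]
    adm_measurable[OF test_function_adm[OF \<phi>]] adm_measurable[OF test_function_adm[OF test_function_pd[OF \<phi>]]]
  define d :: "nat \<Rightarrow> real" where "d k = inverse (Suc k)" for k
  have d: "d k > 0" "d k \<le> 1" "d \<longlonglongrightarrow> 0" for k
    using LIMSEQ_inverse_real_of_nat by (auto simp: d_def[abs_def] field_simps)
  obtain H where H: "\<And>x. norm (hartley F x) \<le> H" using hartley_bounded[OF F] by auto
  obtain R where R: "R > 0" "\<And>x. norm x > R \<Longrightarrow> \<phi> x = 0" using test_function_support[OF \<phi>] by metis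
  obtain L where L: "L > 0" "\<And>x. \<bar>pd i \<phi> x\<bar> \<le> L"
    using adm_bounded[OF test_function_adm[OF test_function_pd[OF \<phi>]]] by (metis real_norm_def)
  let ?p = "\<lambda>k x. (\<phi> (x + d k *\<^sub>R ?e) - \<phi> x) / d k"
  \<comment> \<open>The step is negative because translating the test function by \<open>d k\<close>
    amounts to translating the transform by \<open>- d k\<close>; the sign of the step becomes the
    sign in the integration by parts.\<close>
  let ?h = "\<lambda>k x. (hartley F (x + (- d k) *\<^sub>R ?e) - hartley F x) /\<^sub>R (- d k)"
  \<comment> \<open>The mean value theorem along the axis gives the bound \<open>L\<close>, and
    steps of length at most 1 keep the support in the ball of radius \<open>R + 1\<close>.\<close>
  have p_le: "\<bar>?p k x\<bar> \<le> L * indicator (cball 0 (R + 1)) x" for k x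
  proof (cases "norm x \<le> R + 1")
    case True
    have "\<exists>z>0. z < d k \<and> \<phi> (x + d k *\<^sub>R ?e) - \<phi> (x + 0 *\<^sub>R ?e) = (d k - 0) * pd i \<phi> (x + z *\<^sub>R ?e)"
      using d(1)[of k] by (intro MVT2 test_function_has_derivative_line[OF \<phi>])
    then obtain z where "\<phi> (x + d k *\<^sub>R ?e) - \<phi> x = d k * pd i \<phi> (x + z *\<^sub>R ?e)" by auto
    then show ?thesis using True L d(1)[of k] by (simp add: indicator_def)
  next
    case False
    have "norm (x + d k *\<^sub>R ?e) \<ge> norm x - norm (d k *\<^sub>R ?e)"
      using norm_diff_ineq[of x "d k *\<^sub>R ?e"] by simp
    moreover have "norm (d k *\<^sub>R ?e) \<le> 1" using d(1,2)[of k] by simp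
    ultimately show ?thesis using False R by (simp add: indicator_def)
  qed
  have p_lim: "(\<lambda>k. ?p k x) \<longlonglongrightarrow> pd i \<phi> x" for x
  proof -
    have "((\<lambda>h. (\<phi> (x + h *\<^sub>R ?e) - \<phi> x) / h) \<longlongrightarrow> pd i \<phi> x) (at 0)"
      using test_function_has_derivative_line[OF \<phi>, where x=x and i=i and h=0] by (simp add: DERIV_def)
    then show ?thesis
      by (rule filterlim_compose) (use d in \<open>auto simp: filterlim_at eventually_sequentially less_imp_neq[THEN not_sym]\<close>)
  qed
  have 1: "(\<lambda>k. LINT x|lborel. ?p k x *\<^sub>R hartley F x) \<longlonglongrightarrow> (LINT x|lborel. pd i \<phi> x *\<^sub>R hartley F x)"
  proof (rule integral_dominated_convergence[where w="\<lambda>x. L * indicator (cball 0 (R + 1)) x * H"])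
    show "AE x in lborel. norm (?p k x *\<^sub>R hartley F x) \<le> L * indicator (cball 0 (R + 1)) x * H" for k
      using p_le H L by (intro AE_I2) (auto simp del: abs_divide intro!: mult_mono)
    show "integrable lborel (\<lambda>x::real^'n. L * indicator (cball 0 (R + 1)) x * H)"
      by (intro integrable_mult_left integrable_mult_right integrable_real_indicator)
        (use emeasure_bounded_finite[OF bounded_cball] in \<open>auto\<close>)
    show "AE x in lborel. (\<lambda>k. ?p k x *\<^sub>R hartley F x) \<longlonglongrightarrow> pd i \<phi> x *\<^sub>R hartley F x"
      by (intro AE_I2 tendsto_scaleR p_lim tendsto_const)
  qed auto
  have 2: "(\<lambda>k. LINT x|lborel. \<phi> x *\<^sub>R ?h k x) \<longlonglongrightarrow> (LINT x|lborel. \<phi> x *\<^sub>R hartley (dsym i F) x)"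
  proof (rule integral_dominated_convergence[where w="\<lambda>x. \<bar>\<phi> x\<bar> * (2 * (LINT \<xi>|lborel. \<bar>\<xi> $ i\<bar> * norm (F \<xi>)))"])
    have d': "(\<lambda>k. - d k) \<longlonglongrightarrow> 0" "\<And>k. - d k \<noteq> 0" using d(1) tendsto_minus[OF d(3)] by (auto simp: less_imp_neq[THEN not_sym])
    show "AE x in lborel. norm (\<phi> x *\<^sub>R ?h k x) \<le> \<bar>\<phi> x\<bar> * (2 * (LINT \<xi>|lborel. \<bar>\<xi> $ i\<bar> * norm (F \<xi>)))" for k
      unfolding norm_scaleR[of "\<phi> _"]
      by (intro AE_I2 mult_left_mono hartley_diff_quotient(2)[where d="\<lambda>k. - d k"] F d') auto
    show "AE x in lborel. (\<lambda>k. \<phi> x *\<^sub>R ?h k x) \<longlonglongrightarrow> \<phi> x *\<^sub>R hartley (dsym i F) x"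
      by (intro AE_I2 tendsto_scaleR tendsto_const hartley_diff_quotient(1)[where d="\<lambda>k. - d k"] F d')
    show "integrable lborel (\<lambda>x. \<bar>\<phi> x\<bar> * (2 * (LINT \<xi>|lborel. \<bar>\<xi> $ i\<bar> * norm (F \<xi>))))"
      using adm_integrable[OF test_function_adm[OF \<phi>]] by auto
  qed auto
  have "(LINT x|lborel. ?p k x *\<^sub>R hartley F x) = - (LINT x|lborel. \<phi> x *\<^sub>R ?h k x)" for k
  proof -
    have i1: "integrable lborel (\<lambda>x. \<phi> (x + d k *\<^sub>R ?e) *\<^sub>R hartley F x)"
      by (rule integrable_test_mult[OF adm_translate[OF test_function_adm[OF \<phi>]] _ H]) simp
    have i2: "integrable lborel (\<lambda>x. \<phi> x *\<^sub>R hartley F x)"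
      by (rule integrable_test_mult[OF test_function_adm[OF \<phi>] _ H]) simp
    have i3: "integrable lborel (\<lambda>x. \<phi> x *\<^sub>R hartley F (x + (- d k) *\<^sub>R ?e))"
      by (rule integrable_test_mult[OF test_function_adm[OF \<phi>] _ H]) simp
    have tr: "(LINT x|lborel. \<phi> (x + d k *\<^sub>R ?e) *\<^sub>R hartley F x) = (LINT x|lborel. \<phi> x *\<^sub>R hartley F (x + (- d k) *\<^sub>R ?e))"
      by (subst integral_lborel_affine[of 1 _ "(- d k) *\<^sub>R ?e"]) (auto simp: algebra_simps)
    have "(LINT x|lborel. ?p k x *\<^sub>R hartley F x) =
      (LINT x|lborel. (\<phi> (x + d k *\<^sub>R ?e) *\<^sub>R hartley F x - \<phi> x *\<^sub>R hartley F x) /\<^sub>R d k)"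
      by (simp add: scaleR_diff_left[symmetric] divide_inverse mult.commute)
    also have "\<dots> = (LINT x|lborel. (\<phi> x *\<^sub>R hartley F (x + (- d k) *\<^sub>R ?e) - \<phi> x *\<^sub>R hartley F x) /\<^sub>R d k)"
      by (simp only: integral_scaleR_right Bochner_Integration.integral_diff[OF i1 i2]
          Bochner_Integration.integral_diff[OF i3 i2] tr)
    also have "\<dots> = (LINT x|lborel. - (\<phi> x *\<^sub>R ?h k x))"
      by (simp add: scaleR_diff_right[symmetric] mult.commute)
    finally show ?thesis by simp
  qed
  with 1 have "(\<lambda>k. - (LINT x|lborel. \<phi> x *\<^sub>R ?h k x)) \<longlonglongrightarrow> (LINT x|lborel. pd i \<phi> x *\<^sub>R hartley F x)"
    by simp
  from LIMSEQ_unique[OF this tendsto_minus[OF 2]] show ?thesis .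
qed

lemma integral_pds_mult_hartley:
  fixes F :: "real^'n::finite \<Rightarrow> 'b::euclidean_space"
  assumes "adm F" "test_function \<phi>"
  shows "(LINT x|lborel. pds is \<phi> x *\<^sub>R hartley F x) = (-1) ^ length is *\<^sub>R (LINT x|lborel. \<phi> x *\<^sub>R hartley (dsyms is F) x)"
  using assms
proof (induction "is" arbitrary: F)
  case (Cons i "is")
  have "(LINT x|lborel. pds (i # is) \<phi> x *\<^sub>R hartley F x) = - (LINT x|lborel. pds is \<phi> x *\<^sub>R hartley (dsym i F) x)"
    using integral_pd_mult_hartley[OF Cons.prems(1) test_function_pds[OF Cons.prems(2)]] by simp
  then show ?case using Cons.IH[OF adm_dsym[OF Cons.prems(1)] Cons.prems(2)] by simp
qed simp

lemma has_weak_deriv_hartley: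
  fixes F :: "real^'n::finite \<Rightarrow> 'b::euclidean_space"
  assumes F: "adm F"
  shows "has_weak_deriv (hartley F) is (hartley (dsyms is F))"
  unfolding has_weak_deriv_def
proof (intro conjI allI impI hartley_L2 F adm_dsyms)
  fix \<phi> :: "real^'n \<Rightarrow> real" assume \<phi>: "test_function \<phi>"
  note [measurable] = hartley_measurable[OF F] hartley_measurable[OF adm_dsyms[OF F]]
    adm_measurable[OF test_function_adm[OF \<phi>]] adm_measurable[OF test_function_adm[OF test_function_pds[OF \<phi>]]]
  show "(LINT x|lebesgue. pds is \<phi> x *\<^sub>R hartley F x) = (-1) ^ length is *\<^sub>R (LINT x|lebesgue. \<phi> x *\<^sub>R hartley (dsyms is F) x)"
    using integral_pds_mult_hartley[OF F \<phi>] by (subst (1 2) integral_completion) auto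
qed

section \<open>Uniqueness of weak derivatives\<close>

text \<open>For \<open>m = 0\<close> this is the classical smooth function that is flat at the
  origin. The powers in the denominator make the family closed under differentiation up to linear
  combinations.\<close>

definition flat_exp :: "nat \<Rightarrow> real \<Rightarrow> real" where
  "flat_exp m s = (if s \<le> 0 then 0 else exp (- (1 / s)) / s ^ m)"

lemma flat_exp_tendsto_0: "((\<lambda>s. exp (- (1 / s)) / s ^ m) \<longlongrightarrow> 0) (at_right (0::real))"
proof -
  have "((\<lambda>s. inverse s ^ m / exp (inverse s)) \<longlongrightarrow> 0) (at_right (0::real))"
    using filterlim_compose[OF tendsto_power_div_exp_0 filterlim_inverse_at_top_right] .
  then show ?thesis
    by (simp add: exp_minus field_simps)
qed

lemma flat_exp_has_derivative:
  "(flat_exp m has_real_derivative flat_exp (m + 2) s - m * flat_exp (m + 1) s) (at s)"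
proof -
  consider "s < 0" | "s = 0" | "s > 0" by linarith
  then show ?thesis
  proof cases
    case 1
    have "((\<lambda>_. 0) has_real_derivative 0) (at s)" by simp
    then have "(flat_exp m has_real_derivative 0) (at s)"
      by (rule has_field_derivative_transform_within_open[where S="{..<0}"]) (use 1 in \<open>auto simp: flat_exp_def\<close>)
    then show ?thesis using 1 by (simp add: flat_exp_def)
  next
    case 2
    \<comment> \<open>To the right of 0 the difference quotient is again a member of the family,
      with exponent \<open>m + 1\<close>; to the left it is 0.\<close>
    have "((\<lambda>h. flat_exp m h / h) \<longlongrightarrow> 0) (at_right 0)"
      using flat_exp_tendsto_0[of "m + 1"]
      by (rule Lim_transform_eventually) (auto simp: flat_exp_def eventually_at_filter)
    moreover have "((\<lambda>h. flat_exp m h / h) \<longlongrightarrow> 0) (at_left 0)"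
      by (rule Lim_transform_eventually[OF tendsto_const]) (auto simp: flat_exp_def eventually_at_filter)
    ultimately have "((\<lambda>h. flat_exp m h / h) \<longlongrightarrow> 0) (at 0)"
      using filterlim_split_at by blast
    then show ?thesis using 2 by (simp add: DERIV_def flat_exp_def)
  next
    case 3
    have "((\<lambda>s. exp (- (1 / s)) / s ^ m) has_real_derivative
        exp (- (1 / s)) / s ^ (m + 2) - m * (exp (- (1 / s)) / s ^ (m + 1))) (at s)"
      using 3 by (auto intro!: derivative_eq_intros)
        (cases m, auto simp: field_simps power2_eq_square power_add)
    then have "(flat_exp m has_real_derivative
        exp (- (1 / s)) / s ^ (m + 2) - m * (exp (- (1 / s)) / s ^ (m + 1))) (at s)"
      by (rule has_field_derivative_transform_within_open[where S="{0<..}"]) (use 3 in \<open>auto simp: flat_exp_def\<close>)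
    then show ?thesis using 3 by (simp add: flat_exp_def)
  qed
qed

text \<open>An algebra of functions closed under partial differentiation, so that smoothness in the sense
  of \<open>C_space\<close> needs no induction over explicit derivatives.\<close>

inductive bump_alg :: "(real^'n::finite \<Rightarrow> real) \<Rightarrow> bool" where
  const: "bump_alg (\<lambda>_. c)"
| flat: "bump_alg (\<lambda>x. flat_exp m (a * x $ i + b))"
| add: "bump_alg \<phi> \<Longrightarrow> bump_alg \<psi> \<Longrightarrow> bump_alg (\<lambda>x. \<phi> x + \<psi> x)"
| mult: "bump_alg \<phi> \<Longrightarrow> bump_alg \<psi> \<Longrightarrow> bump_alg (\<lambda>x. \<phi> x * \<psi> x)"

lemma pd_eqI: "(\<And>x. (\<phi> has_derivative D x) (at x)) \<Longrightarrow> pd i \<phi> = (\<lambda>x. D x (axis i 1))"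
  unfolding pd_def using frechet_derivative_at by (metis (no_types, opaque_lifting))

text \<open>Both claims go through one induction because the sum and product rules for
  \<open>pd\<close> require the differentiability of the parts.\<close>

lemma bump_alg_step:
  "bump_alg \<phi> \<Longrightarrow> (\<forall>x. \<phi> differentiable (at x)) \<and> (\<forall>i. bump_alg (pd i \<phi>))"
proof (induction rule: bump_alg.induct)
  case (const c)
  have "((\<lambda>_. c) has_derivative (\<lambda>_. 0)) (at x)" for x :: "real^'a" by simp
  from pd_eqI[OF this] show ?case by (auto intro: bump_alg.const)
next
  case (flat m a i b)
  let ?g = "\<lambda>x. flat_exp (m + 2) (a * x $ i + b) - m * flat_exp (m + 1) (a * x $ i + b)"
  have d: "((\<lambda>x. flat_exp m (a * x $ i + b)) has_derivative (\<lambda>h. (a * h $ i) * ?g x)) (at x)" for x :: "real^'a"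
  proof -
    have "((\<lambda>x. a * x $ i + b) has_derivative (\<lambda>h. a * h $ i)) (at x)"
      by (auto intro!: derivative_eq_intros bounded_linear.has_derivative[OF bounded_linear_vec_nth])
    from has_derivative_compose[OF this flat_exp_has_derivative[unfolded has_field_derivative_def]]
    show ?thesis by (simp add: mult.commute)
  qed
  have "bump_alg (\<lambda>x::real^'a. (a * axis j 1 $ i) * (flat_exp (m + 2) (a * x $ i + b) + (- real m) * flat_exp (m + 1) (a * x $ i + b)))" for j
    by (intro bump_alg.intros)
  then show ?case unfolding pd_eqI[OF d] using d by (auto simp: differentiable_def)
next
  case (add \<phi> \<psi>)
  have d: "\<phi> differentiable (at x)" "\<psi> differentiable (at x)" for x using add.IH by auto
  have "pd i (\<lambda>x. \<phi> x + \<psi> x) = (\<lambda>x. pd i \<phi> x + pd i \<psi> x)" for i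
    by (subst pd_eqI[OF has_derivative_add[OF d[unfolded frechet_derivative_works]]]) (simp add: pd_def)
  then show ?case using add.IH by (auto intro: bump_alg.add)
next
  case (mult \<phi> \<psi>)
  have d: "\<phi> differentiable (at x)" "\<psi> differentiable (at x)" for x using mult.IH by auto
  have "pd i (\<lambda>x. \<phi> x * \<psi> x) = (\<lambda>x. \<phi> x * pd i \<psi> x + pd i \<phi> x * \<psi> x)" for i
    by (subst pd_eqI[OF has_derivative_mult[OF d[unfolded frechet_derivative_works]]]) (simp add: pd_def)
  moreover have "bump_alg (\<lambda>x. \<phi> x * pd i \<psi> x + pd i \<phi> x * \<psi> x)" for i
    using mult by (intro bump_alg.add bump_alg.mult) auto
  ultimately show ?case using d by simp
qed

lemma bump_alg_C_space: "bump_alg \<phi> \<Longrightarrow> C_space k \<phi>"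
proof (induction k arbitrary: \<phi>)
  case 0
  have "isCont \<phi> x" for x
    using bump_alg_step[OF 0] differentiable_imp_continuous_within by blast
  then show ?case by (simp add: continuous_at_imp_continuous_on)
qed (use bump_alg_step in auto)

text \<open>All these functions vanish outside the same box, and inside it each factor exp(-1/(k s))
  tends to 1 as \<open>k\<close> grows.\<close>

definition box_bump :: "nat \<Rightarrow> real^'n::finite \<Rightarrow> real^'n \<Rightarrow> real^'n \<Rightarrow> real" where
  "box_bump k a b x = (\<Prod>i\<in>UNIV. flat_exp 0 (k * (x $ i - a $ i)) * flat_exp 0 (k * (b $ i - x $ i)))"

lemma bump_alg_box_bump: "bump_alg (box_bump k a b)"
proof -
  have "bump_alg (\<lambda>x. \<Prod>i\<in>I. flat_exp 0 (k * (x $ i - a $ i)) * flat_exp 0 (k * (b $ i - x $ i)))"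
    if "finite I" for I
    using that
  proof induction
    case (insert i I)
    have "bump_alg (\<lambda>x. flat_exp 0 (real k * x $ i + (- k * a $ i)) * flat_exp 0 ((- real k) * x $ i + k * b $ i))"
      by (intro bump_alg.intros)
    then have "bump_alg (\<lambda>x. flat_exp 0 (k * (x $ i - a $ i)) * flat_exp 0 (k * (b $ i - x $ i)))"
      by (simp add: algebra_simps)
    with insert show ?case by (simp add: bump_alg.mult)
  qed (simp add: bump_alg.const)
  then show ?thesis unfolding box_bump_def[abs_def] by simp
qed

lemma flat_exp_0_bounds: "0 \<le> flat_exp 0 s" "flat_exp 0 s \<le> 1"
  by (auto simp: flat_exp_def)

lemma box_bump_outside:
  assumes "x \<notin> box a b"
  shows "box_bump k a b x = 0"
proof -
  obtain i where "x $ i - a $ i \<le> 0 \<or> b $ i - x $ i \<le> 0"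
    using assms by (auto simp: mem_box_cart not_less)
  then have "real k * (x $ i - a $ i) \<le> 0 \<or> real k * (b $ i - x $ i) \<le> 0"
    by (meson mult_nonneg_nonpos of_nat_0_le_iff)
  then have "flat_exp 0 (k * (x $ i - a $ i)) * flat_exp 0 (k * (b $ i - x $ i)) = 0"
    by (auto simp: flat_exp_def)
  then show ?thesis unfolding box_bump_def by (intro prod_zero bexI[of _ i]) simp_all
qed

lemma box_bump_bounds: "0 \<le> box_bump k a b x" "box_bump k a b x \<le> 1"
  unfolding box_bump_def by (auto intro!: prod_nonneg prod_le_1 mult_le_one simp: flat_exp_0_bounds)

lemma test_function_box_bump: "test_function (box_bump k a b)"
proof -
  have "bounded {x. box_bump k a b x \<noteq> 0}"
    by (rule bounded_subset[OF bounded_box[of a b]]) (use box_bump_outside in auto)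
  then show ?thesis
    unfolding test_function_def by (auto intro: bump_alg_C_space bump_alg_box_bump)
qed

lemma box_bump_tendsto: "(\<lambda>k. box_bump k a b x) \<longlonglongrightarrow> indicator (box a b) x"
proof (cases "x \<in> box a b")
  case True
  have 1: "(\<lambda>k. flat_exp 0 (real k * s)) \<longlonglongrightarrow> 1" if "s > 0" for s
  proof -
    have "(\<lambda>k. exp (- ((1 / s) / real k))) \<longlonglongrightarrow> exp (- 0)"
      by (intro tendsto_exp tendsto_minus lim_const_over_n)
    then have "(\<lambda>k. exp (- ((1 / s) / real k))) \<longlonglongrightarrow> 1" by simp
    then show ?thesis
    proof (rule Lim_transform_eventually)
      show "\<forall>\<^sub>F k in sequentially. exp (- ((1 / s) / real k)) = flat_exp 0 (real k * s)"
        using eventually_gt_at_top[of 0]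
      proof eventually_elim
        case (elim k)
        then have "\<not> real k * s \<le> 0" using that by (simp add: not_le)
        then show ?case by (simp add: flat_exp_def mult.commute)
      qed
    qed
  qed
  have "(\<lambda>k. box_bump k a b x) \<longlonglongrightarrow> (\<Prod>i\<in>(UNIV::'a set). 1 * 1)"
    unfolding box_bump_def using True
    by (intro tendsto_prod tendsto_mult 1) (auto simp: mem_box_cart)
  then show ?thesis using True by simp
qed (simp add: box_bump_outside)

section \<open>The fundamental lemma of the calculus of variations\<close>

lemma L2_integrable_box:
  fixes g :: "real^'n::finite \<Rightarrow> 'b::euclidean_space"
  assumes "g \<in> L2_space"
  shows "set_integrable lebesgue (box a b) g"
proof -
  have g: "g \<in> borel_measurable lebesgue" "integrable lebesgue (\<lambda>x. (norm (g x))\<^sup>2)"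
    using assms by (auto simp: L2_space_def)
  have "integrable lebesgue (indicator (box a b) :: _ \<Rightarrow> real)"
    by (intro integrable_real_indicator) (use emeasure_bounded_finite[OF bounded_box] in auto)
  from Bochner_Integration.integrable_add[OF this g(2)]
  have "integrable lebesgue (\<lambda>x. indicator (box a b) x *\<^sub>R g x)"
  proof (rule Bochner_Integration.integrable_bound)
    have "norm y \<le> 1 + (norm y)\<^sup>2" for y :: 'b
      using zero_le_power2[of "norm y - 1"] norm_ge_zero[of y] unfolding power2_diff by (simp del: norm_ge_zero)
    then have "norm (indicator (box a b) x *\<^sub>R g x) \<le> \<bar>indicator (box a b) x + (norm (g x))\<^sup>2\<bar>" for x
      by (auto simp: indicator_def)
    then show "AE x in lebesgue. norm (indicator (box a b) x *\<^sub>R g x) \<le> norm (indicator (box a b) x + (norm (g x))\<^sup>2)"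
      by simp
    show "(\<lambda>x. indicator (box a b) x *\<^sub>R g x) \<in> borel_measurable lebesgue"
      using g(1) by (intro borel_measurable_scaleR borel_measurable_indicator) auto
  qed
  then show ?thesis by (simp add: set_integrable_def)
qed

text \<open>Testing with \<open>box_bump\<close> and letting \<open>k\<close> grow shows that the
  integral of \<open>g\<close> over every box is 0; by Lebesgue differentiation \<open>g\<close> is
  then 0 almost everywhere.\<close>

lemma AE_eq_0_if_test_integrals_0:
  fixes g :: "real^'n::finite \<Rightarrow> 'b::euclidean_space"
  assumes g: "g \<in> L2_space" and 0: "\<And>\<phi>. test_function \<phi> \<Longrightarrow> (LINT x|lebesgue. \<phi> x *\<^sub>R g x) = 0"
  shows "AE x in lebesgue. g x = 0"
proof -
  have gm: "g \<in> borel_measurable lebesgue" using g by (simp add: L2_space_def)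
  have int: "set_integrable lebesgue (box a b) g" for a b by (rule L2_integrable_box[OF g])
  have box0: "(LINT x:box a b|lebesgue. g x) = 0" for a b
  proof -
    have bm: "box_bump k a b \<in> borel_measurable lebesgue" for k
      using adm_measurable[OF test_function_adm[OF test_function_box_bump]] by (intro measurable_completion) simp
    have "(\<lambda>k. LINT x|lebesgue. box_bump k a b x *\<^sub>R g x) \<longlonglongrightarrow> (LINT x|lebesgue. indicator (box a b) x *\<^sub>R g x)"
    proof (rule integral_dominated_convergence[where w="\<lambda>x. norm (indicator (box a b) x *\<^sub>R g x)"])
      show "integrable lebesgue (\<lambda>x. norm (indicator (box a b) x *\<^sub>R g x))"
        using int unfolding set_integrable_def by (intro integrable_norm)
      show "AE x in lebesgue. (\<lambda>k. box_bump k a b x *\<^sub>R g x) \<longlonglongrightarrow> indicator (box a b) x *\<^sub>R g x"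
        by (intro AE_I2 tendsto_scaleR box_bump_tendsto tendsto_const)
      have "norm (box_bump k a b x *\<^sub>R g x) \<le> norm (indicator (box a b) x *\<^sub>R g x)" for k x
        using box_bump_bounds[of k a b x] box_bump_outside[of x a b k]
        by (auto simp: indicator_def mult_left_le_one_le)
      then show "AE x in lebesgue. norm (box_bump k a b x *\<^sub>R g x) \<le> norm (indicator (box a b) x *\<^sub>R g x)" for k
        by simp
      show "(\<lambda>x. indicator (box a b) x *\<^sub>R g x) \<in> borel_measurable lebesgue"
        using gm by (intro borel_measurable_scaleR borel_measurable_indicator) auto
      show "(\<lambda>x. box_bump k a b x *\<^sub>R g x) \<in> borel_measurable lebesgue" for k
        using gm bm by (intro borel_measurable_scaleR)
    qed
    then show ?thesis
      using 0[OF test_function_box_bump] by (simp add: set_lebesgue_integral_def LIMSEQ_const_iff)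
  qed
  have "(g has_integral 0) (cbox a b)" for a b
    using has_integral_set_lebesgue[OF int, of a b] box0 by (simp add: has_integral_open_interval)
  then have i: "g integrable_on cbox a b" "integral (cbox a b) g = 0" for a b
    by (auto intro: integral_unique)
  \<comment> \<open>Outside the null set \<open>N\<close> the averages of \<open>g\<close> over
    small cubes with corner x converge to \<open>g x\<close>, and all these averages are 0.\<close>
  obtain N where N: "negligible N" "\<And>x e. \<lbrakk>x \<notin> N; 0 < e\<rbrakk> \<Longrightarrow>
       \<exists>d>0. \<forall>h. 0 < h \<and> h < d \<longrightarrow> norm(integral (cbox x (x + h *\<^sub>R One)) g /\<^sub>R h ^ DIM(real^'n) - g x) < e"
    using integrable_ccontinuous_explicit[OF i(1)] by metis
  have "g x = 0" if x: "x \<notin> N" for x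
  proof (rule ccontr)
    assume "g x \<noteq> 0"
    then have "\<exists>d>0::real. \<forall>h. 0 < h \<and> h < d \<longrightarrow> norm (g x) < norm (g x)"
      using N(2)[OF x, of "norm (g x)"] unfolding i(2) by simp
    then show False using dense by blast
  qed
  then show ?thesis
    using N(1) by (intro AE_I'[of N]) (auto simp: negligible_iff_null_sets)
qed

lemma L2_space_diff:
  fixes g h :: "'a::euclidean_space \<Rightarrow> 'b::euclidean_space"
  assumes "g \<in> L2_space" "h \<in> L2_space"
  shows "(\<lambda>x. g x - h x) \<in> L2_space"
proof -
  have m: "g \<in> borel_measurable lebesgue" "h \<in> borel_measurable lebesgue"
    and i: "integrable lebesgue (\<lambda>x. 2 * (norm (g x))\<^sup>2 + 2 * (norm (h x))\<^sup>2)"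
    using assms by (auto simp: L2_space_def)
  have m': "(\<lambda>x. g x - h x) \<in> borel_measurable lebesgue"
    using m by (rule borel_measurable_diff)
  have "(norm (x - y))\<^sup>2 \<le> 2 * (norm x)\<^sup>2 + 2 * (norm y)\<^sup>2" for x y :: 'b
  proof -
    have "(norm (x - y))\<^sup>2 + (norm (x + y))\<^sup>2 = 2 * (norm x)\<^sup>2 + 2 * (norm y)\<^sup>2"
      by (simp add: power2_norm_eq_inner inner_diff_left inner_diff_right inner_add_left inner_add_right inner_commute)
    then show ?thesis by (smt (verit) zero_le_power2)
  qed
  then have "integrable lebesgue (\<lambda>x. (norm (g x - h x))\<^sup>2)"
    using m' by (intro Bochner_Integration.integrable_bound[OF i]) (auto intro!: borel_measurable_power borel_measurable_norm)
  with m' show ?thesis by (simp add: L2_space_def)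
qed

lemma L2_test_integrable:
  fixes g :: "real^'n::finite \<Rightarrow> 'b::euclidean_space"
  assumes "g \<in> L2_space" and \<phi>: "test_function \<phi>"
  shows "integrable lebesgue (\<lambda>x. \<phi> x *\<^sub>R g x)"
proof -
  have m: "g \<in> borel_measurable lebesgue" and i: "integrable lebesgue (\<lambda>x. (norm (g x))\<^sup>2)"
    using assms by (auto simp: L2_space_def)
  have pm: "\<phi> \<in> borel_measurable borel" using adm_measurable[OF test_function_adm[OF \<phi>]] .
  have p: "integrable lebesgue (\<lambda>x. (\<phi> x)\<^sup>2)"
    using adm_norm_square_integrable[OF test_function_adm[OF \<phi>]] pm by (subst integrable_completion) auto
  have pm': "\<phi> \<in> borel_measurable lebesgue" using pm by (intro measurable_completion) simp
  have m': "(\<lambda>x. \<phi> x *\<^sub>R g x) \<in> borel_measurable lebesgue"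
    by (rule borel_measurable_scaleR[OF pm' m])
  have "norm (\<phi> x *\<^sub>R g x) \<le> \<bar>(\<phi> x)\<^sup>2 + (norm (g x))\<^sup>2\<bar>" for x
  proof -
    have "2 * (\<bar>\<phi> x\<bar> * norm (g x)) \<le> (\<phi> x)\<^sup>2 + (norm (g x))\<^sup>2"
      using zero_le_power2[of "\<bar>\<phi> x\<bar> - norm (g x)"] by (simp add: power2_diff)
    moreover have "0 \<le> \<bar>\<phi> x\<bar> * norm (g x)" by simp
    ultimately have "\<bar>\<phi> x\<bar> * norm (g x) \<le> (\<phi> x)\<^sup>2 + (norm (g x))\<^sup>2" by linarith
    then show ?thesis by simp
  qed
  then show ?thesis
    by (intro Bochner_Integration.integrable_bound[OF Bochner_Integration.integrable_add[OF p i] m'] AE_I2)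
      (simp only: real_norm_def)
qed

lemma has_weak_deriv_unique:
  assumes g: "has_weak_deriv u is g" and h: "has_weak_deriv u is h"
  shows "AE x in lebesgue. g x = h x"
proof -
  have L: "g \<in> L2_space" "h \<in> L2_space" using assms by (auto simp: has_weak_deriv_def)
  have "(LINT x|lebesgue. \<phi> x *\<^sub>R (g x - h x)) = 0" if \<phi>: "test_function \<phi>" for \<phi>
  proof -
    have "(-1) ^ length is *\<^sub>R (LINT x|lebesgue. \<phi> x *\<^sub>R g x) = (-1) ^ length is *\<^sub>R (LINT x|lebesgue. \<phi> x *\<^sub>R h x)"
    proof -
      have "(LINT x|lebesgue. pds is \<phi> x *\<^sub>R u x) = (-1) ^ length is *\<^sub>R (LINT x|lebesgue. \<phi> x *\<^sub>R g x)"
        "(LINT x|lebesgue. pds is \<phi> x *\<^sub>R u x) = (-1) ^ length is *\<^sub>R (LINT x|lebesgue. \<phi> x *\<^sub>R h x)"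
        using g h \<phi> by (simp_all add: has_weak_deriv_def)
      then show ?thesis by (rule trans[OF sym])
    qed
    then have "(LINT x|lebesgue. \<phi> x *\<^sub>R g x) = (LINT x|lebesgue. \<phi> x *\<^sub>R h x)" by simp
    then show ?thesis
      by (simp add: scaleR_diff_right Bochner_Integration.integral_diff[OF L2_test_integrable L2_test_integrable] L \<phi>)
  qed
  from AE_eq_0_if_test_integrals_0[OF L2_space_diff[OF L] this]
  show ?thesis by simp
qed

text \<open>\<open>weak_deriv\<close> selects an unspecified representative. Existence shows that
  the selected function is a weak derivative, and uniqueness identifies it with the explicit
  transform almost everywhere.\<close>

lemma weak_deriv_hartley:
  fixes F :: "real^'n::finite \<Rightarrow> 'b::euclidean_space"
  assumes "adm F"
  shows "AE x in lebesgue. weak_deriv is (hartley F) x = hartley (dsyms is F) x"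
    and "weak_deriv is (hartley F) \<in> L2_space"
proof -
  have "has_weak_deriv (hartley F) is (weak_deriv is (hartley F))"
    unfolding weak_deriv_def by (rule someI[of _ "hartley (dsyms is F)"]) (rule has_weak_deriv_hartley[OF assms])
  with has_weak_deriv_unique[OF this has_weak_deriv_hartley[OF assms]]
  show "AE x in lebesgue. weak_deriv is (hartley F) x = hartley (dsyms is F) x"
    and "weak_deriv is (hartley F) \<in> L2_space" by (auto simp: has_weak_deriv_def)
qed

section \<open>Invariance under changes on null sets\<close>

lemma L2_space_cong_AE:
  assumes "AE x in lebesgue. u x = v x" "u \<in> borel_measurable lebesgue" "v \<in> borel_measurable lebesgue"
  shows "u \<in> L2_space \<longleftrightarrow> v \<in> L2_space"
proof -
  have "integrable lebesgue (\<lambda>x. (norm (u x))\<^sup>2) \<longleftrightarrow> integrable lebesgue (\<lambda>x. (norm (v x))\<^sup>2)"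
    using assms by (intro integrable_cong_AE borel_measurable_power borel_measurable_norm) auto
  with assms show ?thesis by (simp add: L2_space_def)
qed

lemma L2_norm_cong_AE:
  assumes "AE x in lebesgue. u x = v x" "u \<in> borel_measurable lebesgue" "v \<in> borel_measurable lebesgue"
  shows "L2_norm u = L2_norm v"
  unfolding L2_norm_def using assms
  by (intro arg_cong[where f=sqrt] integral_cong_AE borel_measurable_power borel_measurable_norm) auto

lemma has_weak_deriv_cong_AE:
  assumes "AE x in lebesgue. u x = v x" "u \<in> borel_measurable lebesgue" "v \<in> borel_measurable lebesgue"
  shows "has_weak_deriv u is = has_weak_deriv v is"
proof
  fix g
  have "(LINT x|lebesgue. pds is \<phi> x *\<^sub>R u x) = (LINT x|lebesgue. pds is \<phi> x *\<^sub>R v x)" if "test_function \<phi>" for \<phi>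
  proof -
    have "pds is \<phi> \<in> borel_measurable lebesgue"
      using adm_measurable[OF test_function_adm[OF test_function_pds[OF that]]] by (intro measurable_completion) simp
    then show ?thesis
      using assms by (intro integral_cong_AE borel_measurable_scaleR) auto
  qed
  with L2_space_cong_AE[OF assms] show "has_weak_deriv u is g = has_weak_deriv v is g"
    by (auto simp: has_weak_deriv_def)
qed

text \<open>This is an equality of functions and not merely almost everywhere: the two predicates
  coincide, so the choice operator picks the same representative.\<close>

lemma weak_deriv_cong_AE:
  assumes "AE x in lebesgue. u x = v x" "u \<in> borel_measurable lebesgue" "v \<in> borel_measurable lebesgue"
  shows "weak_deriv is u = weak_deriv is v"
  by (simp add: weak_deriv_def has_weak_deriv_cong_AE[OF assms])

section \<open>Norms and time regularity of modulated transforms\<close>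

lemma L2_norm_nonneg: "L2_norm u \<ge> 0"
  by (simp add: L2_norm_def)

text \<open>By Plancherel a pointwise bound on the multiplier is a bound on the operator. Continuity
  in time and the growth estimates all come from this inequality.\<close>

lemma L2_norm_hartley_mult_le:
  fixes F :: "'a::euclidean_space \<Rightarrow> 'b::euclidean_space"
  assumes F: "adm F" and m: "continuous_on UNIV m" "\<And>\<xi>. \<bar>m \<xi>\<bar> \<le> M"
  shows "L2_norm (hartley (\<lambda>\<xi>. m \<xi> *\<^sub>R F \<xi>)) \<le> M * L2_norm (hartley F)"
proof -
  note mF = adm_mult[OF F m(1)]
  have M: "M \<ge> 0" using m(2)[of 0] by linarith
  have "(LINT \<xi>|lborel. (norm (m \<xi> *\<^sub>R F \<xi>))\<^sup>2) \<le> (LINT \<xi>|lborel. M\<^sup>2 * (norm (F \<xi>))\<^sup>2)"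
  proof (rule integral_mono)
    fix \<xi>
    have "norm (m \<xi> *\<^sub>R F \<xi>) \<le> M * norm (F \<xi>)" using m(2) by (simp add: mult_right_mono)
    then have "(norm (m \<xi> *\<^sub>R F \<xi>))\<^sup>2 \<le> (M * norm (F \<xi>))\<^sup>2" by (intro power_mono) auto
    then show "(norm (m \<xi> *\<^sub>R F \<xi>))\<^sup>2 \<le> M\<^sup>2 * (norm (F \<xi>))\<^sup>2" by (simp only: power_mult_distrib)
  qed (use adm_norm_square_integrable[OF mF] adm_norm_square_integrable[OF F] in auto)
  then have "sqrt (LINT \<xi>|lborel. (norm (m \<xi> *\<^sub>R F \<xi>))\<^sup>2) \<le> sqrt (M\<^sup>2 * (LINT \<xi>|lborel. (norm (F \<xi>))\<^sup>2))"
    by simp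
  then have "L2_norm (\<lambda>\<xi>. m \<xi> *\<^sub>R F \<xi>) \<le> M * L2_norm F"
    using M by (simp only: L2_norm_lborel adm_measurable mF F real_sqrt_mult real_sqrt_abs abs_of_nonneg)
  then have "sqrt ((2 * pi) ^ DIM('a)) * L2_norm (\<lambda>\<xi>. m \<xi> *\<^sub>R F \<xi>) \<le> sqrt ((2 * pi) ^ DIM('a)) * (M * L2_norm F)"
    by (rule mult_left_mono) simp
  then show ?thesis by (simp only: L2_norm_hartley mF F mult_ac)
qed

text \<open>A continuous amplitude that is nonzero at one point is nonzero on a nonempty open set,
  and such a set is not negligible.\<close>

lemma L2_norm_hartley_pos:
  fixes F :: "'a::euclidean_space \<Rightarrow> 'b::euclidean_space"
  assumes F: "adm F" and "F \<xi> \<noteq> 0"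
  shows "L2_norm (hartley F) > 0"
proof -
  have "(LINT \<xi>|lborel. (norm (F \<xi>))\<^sup>2) \<noteq> 0"
  proof
    assume "(LINT \<xi>|lborel. (norm (F \<xi>))\<^sup>2) = 0"
    then have "AE \<xi> in lborel. F \<xi> = 0"
      using adm_norm_square_integrable[OF F] by (subst (asm) integral_nonneg_eq_0_iff_AE) auto
    then have "AE \<xi> in lebesgue. F \<xi> = 0" by (rule AE_completion)
    moreover have o: "open {\<xi>. F \<xi> \<noteq> 0}"
      using adm_continuous[OF F] by (intro open_Collect_neq) auto
    moreover have "{\<xi>. F \<xi> \<noteq> 0} \<in> sets lebesgue"
      using o by simp
    ultimately have "negligible {\<xi>. F \<xi> \<noteq> 0}"
      by (simp add: negligible_iff_null_sets AE_iff_null_sets)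
    then show False using o assms(2) open_not_negligible by blast
  qed
  moreover have "(LINT \<xi>|lborel. (norm (F \<xi>))\<^sup>2) \<ge> 0" by simp
  ultimately have "(LINT \<xi>|lborel. (norm (F \<xi>))\<^sup>2) > 0" by linarith
  then have "L2_norm F > 0"
    by (simp add: L2_norm_lborel[OF adm_measurable[OF F]])
  then show ?thesis by (simp add: L2_norm_hartley[OF F])
qed

text \<open>\<open>dsym\<close> evaluates its argument at the reflected frequency, so a multiplier
  passes through unchanged when it is even. This is how the evenness of the growth rate enters the
  Sobolev estimates.\<close>

lemma dsyms_even_mult:
  assumes "\<And>\<xi>. m (- \<xi>) = m \<xi>"
  shows "dsyms is (\<lambda>\<xi>. m \<xi> *\<^sub>R F \<xi>) = (\<lambda>\<xi>. m \<xi> *\<^sub>R dsyms is F \<xi>)"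
proof (induction "is" arbitrary: F)
  case (Cons i "is")
  have "dsym i (\<lambda>\<xi>. m \<xi> *\<^sub>R F \<xi>) = (\<lambda>\<xi>. m \<xi> *\<^sub>R dsym i F \<xi>)"
    by (auto simp: dsym_def assms)
  then show ?case by (simp add: Cons)
qed simp

lemma H_norm_nonneg: "H_norm k u \<ge> 0"
  by (simp add: H_norm_def sum_nonneg)

lemma hartley_H_space:
  "adm F \<Longrightarrow> hartley F \<in> H_space k"
  using has_weak_deriv_hartley hartley_L2 unfolding H_space_def by blast

lemma hartley_lebesgue_measurable: "adm F \<Longrightarrow> hartley F \<in> borel_measurable lebesgue"
  using hartley_L2[of F] by (simp add: L2_space_def)

lemma H_norm_hartley:
  fixes F :: "real^'n::finite \<Rightarrow> 'b::euclidean_space"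
  assumes "adm F"
  shows "H_norm k (hartley F) = sqrt (\<Sum>is | length is \<le> k. (L2_norm (hartley (dsyms is F)))\<^sup>2)"
proof -
  have "L2_norm (weak_deriv is (hartley F)) = L2_norm (hartley (dsyms is F))" for "is"
    using weak_deriv_hartley[OF assms, of "is"]
    by (intro L2_norm_cong_AE hartley_lebesgue_measurable adm_dsyms assms) (auto simp: L2_space_def)
  then show ?thesis by (simp add: H_norm_def)
qed

lemma H_norm_hartley_mult_le:
  fixes F :: "real^'n::finite \<Rightarrow> 'b::euclidean_space"
  assumes F: "adm F" and m: "continuous_on UNIV m" "\<And>\<xi>. m (- \<xi>) = m \<xi>" "\<And>\<xi>. \<bar>m \<xi>\<bar> \<le> M"
  shows "H_norm k (hartley (\<lambda>\<xi>. m \<xi> *\<^sub>R F \<xi>)) \<le> M * H_norm k (hartley F)"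
proof -
  have M: "M \<ge> 0" using m(3)[of 0] by linarith
  have "(\<Sum>is | length is \<le> k. (L2_norm (hartley (dsyms is (\<lambda>\<xi>. m \<xi> *\<^sub>R F \<xi>))))\<^sup>2)
    \<le> (\<Sum>is | length is \<le> k. M\<^sup>2 * (L2_norm (hartley (dsyms is F)))\<^sup>2)"
    unfolding dsyms_even_mult[of m, OF m(2)] power_mult_distrib[symmetric]
    by (intro sum_mono power_mono L2_norm_hartley_mult_le adm_dsyms F m L2_norm_nonneg)
  then have "sqrt (\<Sum>is | length is \<le> k. (L2_norm (hartley (dsyms is (\<lambda>\<xi>. m \<xi> *\<^sub>R F \<xi>))))\<^sup>2)
    \<le> sqrt (M\<^sup>2 * (\<Sum>is | length is \<le> k. (L2_norm (hartley (dsyms is F)))\<^sup>2))"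
    by (simp add: sum_distrib_left)
  then show ?thesis
    using M by (simp add: H_norm_hartley adm_mult F m(1) real_sqrt_mult)
qed

section \<open>Differentiability in time\<close>

lemma exp_remainder_le:
  assumes "\<bar>x\<bar> \<le> (1::real)"
  shows "\<bar>exp x - 1 - x\<bar> \<le> x\<^sup>2"
proof -
  have "exp x \<le> 1 + x + x\<^sup>2"
  proof (cases "x \<ge> 0")
    case True
    then show ?thesis using assms exp_bound[of x] by simp
  next
    case False
    define y where "y = - x"
    have y: "0 < y" using False by (simp add: y_def)
    have "exp x = inverse (exp y)" by (simp add: y_def exp_minus)
    also have "\<dots> \<le> inverse (1 + y)"
      using y exp_ge_add_one_self[of y] by (intro le_imp_inverse_le) auto
    also have "\<dots> \<le> 1 - y + y\<^sup>2"
    proof -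
      \<comment> \<open>The product equals 1 + y^3.\<close>
      have "1 \<le> (1 - y + y\<^sup>2) * (1 + y)"
        using y by (simp add: algebra_simps power2_eq_square)
      then show ?thesis using y by (simp add: inverse_eq_divide pos_divide_le_eq)
    qed
    finally show ?thesis by (simp add: y_def)
  qed
  moreover have "exp x \<ge> 1 + x" by (rule exp_ge_add_one_self)
  ultimately show ?thesis by linarith
qed

text \<open>The space \<open>X\<close> and its norm \<open>N\<close> are left abstract so that one
  argument covers both L^2 and the Sobolev spaces. The last assumption is the property they share:
  an even multiplier bounded by \<open>M\<close> enlarges the norm of a transform at most by the
  factor \<open>M\<close>.\<close>

context
  fixes \<Lambda> :: "real^'n::finite \<Rightarrow> real" and K :: real
    and X :: "(real^'n \<Rightarrow> 'b::euclidean_space) set" and N :: "(real^'n \<Rightarrow> 'b) \<Rightarrow> real"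
  assumes L: "continuous_on UNIV \<Lambda>" "\<And>\<xi>. \<Lambda> (- \<xi>) = \<Lambda> \<xi>" "\<And>\<xi>. 0 \<le> \<Lambda> \<xi>" "\<And>\<xi>. \<Lambda> \<xi> \<le> K"
    and K: "K > 0"
    and X: "\<And>G. adm G \<Longrightarrow> hartley G \<in> X"
    and N0: "\<And>u. 0 \<le> N u"
    and N: "\<And>G m M. \<lbrakk>adm G; continuous_on UNIV m; \<And>\<xi>. m (- \<xi>) = m \<xi>; \<And>\<xi>. \<bar>m \<xi>\<bar> \<le> M\<rbrakk>
              \<Longrightarrow> N (hartley (\<lambda>\<xi>. m \<xi> *\<^sub>R G \<xi>)) \<le> M * N (hartley G)"
begin

lemma hartley_multiplier_tendsto_0:
  assumes G: "adm G" and m: "\<And>s. continuous_on UNIV (m s)" "\<And>s \<xi>. m s (- \<xi>) = m s \<xi>"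
    and le: "\<And>s \<xi>. s \<noteq> t \<Longrightarrow> \<bar>s - t\<bar> < 1 / K \<Longrightarrow> \<bar>m s \<xi>\<bar> \<le> C * \<bar>s - t\<bar>"
  shows "((\<lambda>s. N (hartley (\<lambda>\<xi>. m s \<xi> *\<^sub>R G \<xi>))) \<longlongrightarrow> 0) (at t within {0..})"
proof (rule tendsto_sandwich[OF _ _ tendsto_const])
  show "\<forall>\<^sub>F s in at t within {0..}. 0 \<le> N (hartley (\<lambda>\<xi>. m s \<xi> *\<^sub>R G \<xi>))"
    by (simp add: N0)
  show "\<forall>\<^sub>F s in at t within {0..}. N (hartley (\<lambda>\<xi>. m s \<xi> *\<^sub>R G \<xi>)) \<le> C * \<bar>s - t\<bar> * N (hartley G)"
    unfolding eventually_at
    by (intro exI[of _ "1 / K"] conjI ballI impI N G m le) (use K in \<open>auto simp: dist_real_def\<close>)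
  have "((\<lambda>s. C * \<bar>s - t\<bar> * N (hartley G)) \<longlongrightarrow> C * \<bar>t - t\<bar> * N (hartley G)) (at t within {0..})"
    by (intro tendsto_intros)
  then show "((\<lambda>s. C * \<bar>s - t\<bar> * N (hartley G)) \<longlongrightarrow> 0) (at t within {0..})" by simp
qed

lemma continuous_on_exp_symbol: "continuous_on UNIV (\<lambda>\<xi>. exp (\<Lambda> \<xi> * t))"
  by (intro continuous_intros L)

text \<open>The radius 1 / K keeps the exponent \<Lambda> (s - t) in [-1, 1], where
  \<open>exp_remainder_le\<close> applies. All constants are independent of the frequency, as the
  passage to norms demands.\<close>

lemma exp_symbol_remainder:
  assumes t: "t \<ge> 0" and s: "\<bar>s - t\<bar> < 1 / K"
  shows "\<bar>exp (\<Lambda> \<xi> * s) - exp (\<Lambda> \<xi> * t) - \<Lambda> \<xi> * exp (\<Lambda> \<xi> * t) * (s - t)\<bar> \<le> exp (K * t) * K\<^sup>2 * \<bar>s - t\<bar>\<^sup>2"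
    and "\<Lambda> \<xi> * \<bar>s - t\<bar> \<le> 1"
proof -
  let ?x = "\<Lambda> \<xi> * (s - t)"
  have "\<Lambda> \<xi> * \<bar>s - t\<bar> \<le> K * (1 / K)"
    using s L(3,4)[of \<xi>] K by (intro mult_mono) auto
  then show x: "\<Lambda> \<xi> * \<bar>s - t\<bar> \<le> 1" using K by simp
  then have x': "\<bar>?x\<bar> \<le> 1" using L(3)[of \<xi>] by (simp add: abs_mult)
  have "exp (\<Lambda> \<xi> * s) = exp (\<Lambda> \<xi> * t) * exp ?x"
    by (simp add: exp_add[symmetric] algebra_simps)
  then have "\<bar>exp (\<Lambda> \<xi> * s) - exp (\<Lambda> \<xi> * t) - \<Lambda> \<xi> * exp (\<Lambda> \<xi> * t) * (s - t)\<bar> = \<bar>exp (\<Lambda> \<xi> * t) * (exp ?x - 1 - ?x)\<bar>"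
    by (simp add: algebra_simps)
  also have "\<dots> = exp (\<Lambda> \<xi> * t) * \<bar>exp ?x - 1 - ?x\<bar>" by (simp add: abs_mult)
  also have "\<dots> \<le> exp (K * t) * (K\<^sup>2 * \<bar>s - t\<bar>\<^sup>2)"
  proof (intro mult_mono)
    show "exp (\<Lambda> \<xi> * t) \<le> exp (K * t)" using L(4)[of \<xi>] t by (simp add: mult_right_mono)
    have "\<bar>exp ?x - 1 - ?x\<bar> \<le> ?x\<^sup>2" by (rule exp_remainder_le[OF x'])
    also have "\<dots> = (\<Lambda> \<xi>)\<^sup>2 * \<bar>s - t\<bar>\<^sup>2" by (simp add: power_mult_distrib)
    also have "\<dots> \<le> K\<^sup>2 * \<bar>s - t\<bar>\<^sup>2" using L(3,4)[of \<xi>] by (intro mult_right_mono power_mono) auto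
    finally show "\<bar>exp ?x - 1 - ?x\<bar> \<le> K\<^sup>2 * \<bar>s - t\<bar>\<^sup>2" .
  qed auto
  finally show "\<bar>exp (\<Lambda> \<xi> * s) - exp (\<Lambda> \<xi> * t) - \<Lambda> \<xi> * exp (\<Lambda> \<xi> * t) * (s - t)\<bar> \<le> exp (K * t) * K\<^sup>2 * \<bar>s - t\<bar>\<^sup>2"
    by (simp add: mult.assoc)
qed

lemma has_time_deriv_hartley:
  assumes G: "adm G" and t: "t \<ge> 0"
  shows "has_time_deriv X N (\<lambda>t. hartley (\<lambda>\<xi>. exp (\<Lambda> \<xi> * t) *\<^sub>R G \<xi>)) (hartley (\<lambda>\<xi>. exp (\<Lambda> \<xi> * t) *\<^sub>R \<Lambda> \<xi> *\<^sub>R G \<xi>)) t"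
proof -
  have a: "adm (\<lambda>\<xi>. exp (\<Lambda> \<xi> * s) *\<^sub>R G \<xi>)" "adm (\<lambda>\<xi>. exp (\<Lambda> \<xi> * s) *\<^sub>R \<Lambda> \<xi> *\<^sub>R G \<xi>)" for s
    by (intro adm_mult G continuous_on_exp_symbol L)+
  \<comment> \<open>The error of the difference quotient is itself a transform with this multiplier.
    As \<open>inverse 0 = 0\<close>, the identity \<open>eq\<close> holds at \<open>s = t\<close>
    too and rewrites without a side condition.\<close>
  let ?m = "\<lambda>s \<xi>. (exp (\<Lambda> \<xi> * s) - exp (\<Lambda> \<xi> * t)) * inverse (s - t) - \<Lambda> \<xi> * exp (\<Lambda> \<xi> * t)"
  have eq: "(\<lambda>x. (hartley (\<lambda>\<xi>. exp (\<Lambda> \<xi> * s) *\<^sub>R G \<xi>) x - hartley (\<lambda>\<xi>. exp (\<Lambda> \<xi> * t) *\<^sub>R G \<xi>) x) /\<^sub>R (s - t)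
      - hartley (\<lambda>\<xi>. exp (\<Lambda> \<xi> * t) *\<^sub>R \<Lambda> \<xi> *\<^sub>R G \<xi>) x) = hartley (\<lambda>\<xi>. ?m s \<xi> *\<^sub>R G \<xi>)" (is "?l = ?r") for s
  proof
    fix x
    have "?r x = hartley (\<lambda>\<xi>. (inverse (s - t) *\<^sub>R (exp (\<Lambda> \<xi> * s) *\<^sub>R G \<xi>) + (- inverse (s - t)) *\<^sub>R (exp (\<Lambda> \<xi> * t) *\<^sub>R G \<xi>))
        + (-1) *\<^sub>R (exp (\<Lambda> \<xi> * t) *\<^sub>R \<Lambda> \<xi> *\<^sub>R G \<xi>)) x"
      by (intro arg_cong[where f="\<lambda>f. hartley f x"] ext)
        (simp add: algebra_simps flip: scaleR_add_left scaleR_diff_left)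
    also have "\<dots> = ?l x"
      unfolding hartley_add[OF adm_add[OF adm_mult[OF a(1) continuous_on_const] adm_mult[OF a(1) continuous_on_const]] adm_mult[OF a(2) continuous_on_const]]
        hartley_add[OF adm_mult[OF a(1) continuous_on_const] adm_mult[OF a(1) continuous_on_const]] hartley_scaleR
      by (simp add: algebra_simps)
    finally show "?l x = ?r x" ..
  qed
  have "((\<lambda>s. N (hartley (\<lambda>\<xi>. ?m s \<xi> *\<^sub>R G \<xi>))) \<longlongrightarrow> 0) (at t within {0..})"
  proof (rule hartley_multiplier_tendsto_0[OF G])
    show "continuous_on UNIV (?m s)" for s
      by (intro continuous_intros continuous_on_exp_symbol L)
    show "?m s (- \<xi>) = ?m s \<xi>" for s \<xi> by (simp add: L)
    show "\<bar>?m s \<xi>\<bar> \<le> (exp (K * t) * K\<^sup>2) * \<bar>s - t\<bar>" if "s \<noteq> t" "\<bar>s - t\<bar> < 1 / K" for s \<xi>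
    proof -
      have "?m s \<xi> = (exp (\<Lambda> \<xi> * s) - exp (\<Lambda> \<xi> * t) - \<Lambda> \<xi> * exp (\<Lambda> \<xi> * t) * (s - t)) / (s - t)"
        using that(1) by (simp add: field_simps)
      also have "\<bar>\<dots>\<bar> \<le> (exp (K * t) * K\<^sup>2 * \<bar>s - t\<bar>\<^sup>2) / \<bar>s - t\<bar>"
        unfolding abs_divide by (intro divide_right_mono exp_symbol_remainder t that) simp
      also have "\<dots> = exp (K * t) * K\<^sup>2 * \<bar>s - t\<bar>"
        using that(1) by (simp add: power2_eq_square del: abs_mult_self_eq)
      finally show ?thesis .
    qed
  qed
  then show ?thesis
    unfolding has_time_deriv_def eq using X a by auto
qed

text \<open>A time derivative only replaces the amplitude \<open>G\<close> by \<Lambda> G, which is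
  admissible again; hence the induction on \<open>k\<close> for arbitrary \<open>G\<close>.\<close>

lemma C_time_hartley: "adm G \<Longrightarrow> C_time k X N (\<lambda>t. hartley (\<lambda>\<xi>. exp (\<Lambda> \<xi> * t) *\<^sub>R G \<xi>))"
proof (induction k arbitrary: G)
  case (0 G)
  have a: "adm (\<lambda>\<xi>. exp (\<Lambda> \<xi> * s) *\<^sub>R G \<xi>)" for s
    by (intro adm_mult 0 continuous_on_exp_symbol L)+
  have "((\<lambda>s. N (\<lambda>x. hartley (\<lambda>\<xi>. exp (\<Lambda> \<xi> * s) *\<^sub>R G \<xi>) x - hartley (\<lambda>\<xi>. exp (\<Lambda> \<xi> * t) *\<^sub>R G \<xi>) x)) \<longlongrightarrow> 0) (at t within {0..})"
    if t: "t \<ge> 0" for t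
  proof -
    let ?m = "\<lambda>s \<xi>. exp (\<Lambda> \<xi> * s) - exp (\<Lambda> \<xi> * t)"
    have eq: "(\<lambda>x. hartley (\<lambda>\<xi>. exp (\<Lambda> \<xi> * s) *\<^sub>R G \<xi>) x - hartley (\<lambda>\<xi>. exp (\<Lambda> \<xi> * t) *\<^sub>R G \<xi>) x) = hartley (\<lambda>\<xi>. ?m s \<xi> *\<^sub>R G \<xi>)"
      for s
      using hartley_add[OF a adm_mult[OF a continuous_on_const], of s "-1" t]
      unfolding hartley_scaleR by (simp add: scaleR_diff_left fun_eq_iff)
    show ?thesis unfolding eq
    proof (rule hartley_multiplier_tendsto_0[OF 0])
      show "continuous_on UNIV (?m s)" for s
        by (intro continuous_intros continuous_on_exp_symbol L)
      show "?m s (- \<xi>) = ?m s \<xi>" for s \<xi> by (simp add: L)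
      show "\<bar>?m s \<xi>\<bar> \<le> 2 * K * exp (K * t) * \<bar>s - t\<bar>" if "s \<noteq> t" "\<bar>s - t\<bar> < 1 / K" for s \<xi>
      proof -
        have "\<Lambda> \<xi> * exp (\<Lambda> \<xi> * t) * \<bar>s - t\<bar> \<le> K * exp (K * t) * \<bar>s - t\<bar>"
          using L(3,4)[of \<xi>] K t by (intro mult_right_mono mult_mono) (auto intro: mult_right_mono)
        moreover have "\<bar>\<Lambda> \<xi> * exp (\<Lambda> \<xi> * t) * (s - t)\<bar> = \<Lambda> \<xi> * exp (\<Lambda> \<xi> * t) * \<bar>s - t\<bar>"
          using L(3)[of \<xi>] by (simp add: abs_mult)
        moreover have "exp (K * t) * K\<^sup>2 * \<bar>s - t\<bar>\<^sup>2 \<le> K * exp (K * t) * \<bar>s - t\<bar>"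
        proof -
          have "K * \<bar>s - t\<bar> \<le> 1" using that(2) K by (simp add: field_simps)
          then have "(K * exp (K * t) * \<bar>s - t\<bar>) * (K * \<bar>s - t\<bar>) \<le> (K * exp (K * t) * \<bar>s - t\<bar>) * 1"
            using K by (intro mult_left_mono) auto
          then show ?thesis by (simp add: power2_eq_square mult_ac)
        qed
        ultimately show ?thesis
          using exp_symbol_remainder(1)[OF t that(2), of \<xi>] by linarith
      qed
    qed
  qed
  then show ?case using X a by simp
next
  case (Suc k)
  show ?case
    unfolding C_time.simps
    by (rule exI[of _ "\<lambda>t. hartley (\<lambda>\<xi>. exp (\<Lambda> \<xi> * t) *\<^sub>R \<Lambda> \<xi> *\<^sub>R G \<xi>)"])
      (intro conjI allI impI has_time_deriv_hartley Suc.prems Suc.IH adm_mult L(1))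
qed

end

section \<open>Symbols of the differential operators\<close>

text \<open>For even \<open>G\<close> this is the amplitude of the gradient of
  \<open>hartley G\<close>. Velocities are sought in this form: on gradients, the Laplacian and the
  gradient of the divergence have the same multiplier -|\<xi>|^2.\<close>

definition grad_symbol :: "(real^'n::finite \<Rightarrow> real) \<Rightarrow> real^'n \<Rightarrow> real^'n" where
  "grad_symbol G \<xi> = (- G \<xi>) *\<^sub>R \<xi>"

lemma adm_scaleR_right:
  assumes "adm G" "continuous_on UNIV h"
  shows "adm (\<lambda>\<xi>. G \<xi> *\<^sub>R h \<xi>)"
  using assms unfolding adm_def by (auto intro!: continuous_on_scaleR)

lemma adm_grad_symbol: "adm G \<Longrightarrow> adm (grad_symbol G)"
  unfolding grad_symbol_def scaleR_minus_left
  using adm_mult[OF adm_scaleR_right[OF _ continuous_on_id], of G "\<lambda>_. - 1"] by simp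

lemma norm_square_vec: "(norm (\<xi>::real^'n::finite))\<^sup>2 = (\<Sum>i\<in>UNIV. (\<xi> $ i)\<^sup>2)"
  by (subst power2_norm_eq_inner) (simp add: inner_vec_def power2_eq_square)

lemma adm_norm_square_mult: "adm G \<Longrightarrow> adm (\<lambda>\<xi>. (norm \<xi>)\<^sup>2 *\<^sub>R G \<xi>)"
  by (intro adm_mult continuous_intros)

lemma hartley_sum:
  assumes "finite I" "\<And>i. i \<in> I \<Longrightarrow> adm (F i)"
  shows "adm (\<lambda>\<xi>. \<Sum>i\<in>I. F i \<xi>) \<and> hartley (\<lambda>\<xi>. \<Sum>i\<in>I. F i \<xi>) x = (\<Sum>i\<in>I. hartley (F i) x)"
  using assms
proof (induction I)
  case empty
  then show ?case by (auto simp: adm_def hartley_def)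
next
  case (insert i I)
  then show ?case using hartley_add[of "F i" "\<lambda>\<xi>. \<Sum>i\<in>I. F i \<xi>"] by (simp add: adm_add)
qed

lemma weak_grad_hartley:
  fixes G :: "real^'n::finite \<Rightarrow> real"
  assumes G: "adm G" "\<And>\<xi>. G (- \<xi>) = G \<xi>"
  shows "AE x in lebesgue. weak_grad (hartley G) x = hartley (grad_symbol G) x"
proof -
  have "AE x in lebesgue. \<forall>i. weak_deriv [i] (hartley G) x = hartley (dsyms [i] G) x"
    by (intro eventually_all_finite weak_deriv_hartley G)
  moreover have "hartley (dsyms [i] G) x = hartley (grad_symbol G) x $ i" for i x
    using hartley_linear[OF adm_grad_symbol[OF G(1)] bounded_linear_vec_nth, of i x]
    by (simp add: dsym_def[abs_def] grad_symbol_def G(2) mult.commute)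
  ultimately show ?thesis by (simp add: weak_grad_def vec_eq_iff)
qed

text \<open>\<open>weak_div\<close> is assembled from chosen representatives, whose measurability
  comes from their membership in \<open>L2_space\<close>. This is required for replacing it inside
  another weak derivative.\<close>

lemma weak_div_measurable:
  fixes F :: "real^'n::finite \<Rightarrow> real^'n"
  assumes "adm F"
  shows "weak_div (hartley F) \<in> borel_measurable lebesgue"
proof -
  have "(\<lambda>x. weak_deriv [i] (hartley F) x $ i) \<in> borel_measurable lebesgue" for i
  proof -
    have 1: "weak_deriv [i] (hartley F) \<in> borel_measurable lebesgue"
      using weak_deriv_hartley(2)[OF assms] by (simp add: L2_space_def)
    have 2: "(\<lambda>y::real^'n. y $ i) \<in> borel_measurable borel"
      by (intro borel_measurable_continuous_onI continuous_on_component continuous_on_id)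
    from measurable_compose[OF 1 2] show ?thesis .
  qed
  then show ?thesis unfolding weak_div_def[abs_def] by (intro borel_measurable_sum)
qed

lemma weak_div_hartley:
  fixes V :: "real^'n::finite \<Rightarrow> real"
  assumes V: "adm V" "\<And>\<xi>. V (- \<xi>) = V \<xi>"
  shows "AE x in lebesgue. weak_div (hartley (grad_symbol V)) x = hartley (\<lambda>\<xi>. - ((norm \<xi>)\<^sup>2 * V \<xi>)) x"
proof -
  note gV = adm_grad_symbol[OF V(1)]
  have a: "adm (\<lambda>\<xi>. dsyms [i] (grad_symbol V) \<xi> $ i)" for i
    by (intro adm_linear[OF adm_dsyms[OF gV]] bounded_linear_vec_nth)
  have "AE x in lebesgue. \<forall>i. weak_deriv [i] (hartley (grad_symbol V)) x = hartley (dsyms [i] (grad_symbol V)) x"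
    by (intro eventually_all_finite weak_deriv_hartley gV)
  moreover have "(\<Sum>i\<in>UNIV. hartley (dsyms [i] (grad_symbol V)) x $ i) = hartley (\<lambda>\<xi>. - ((norm \<xi>)\<^sup>2 * V \<xi>)) x" for x
  proof -
    have "(\<Sum>i\<in>UNIV. hartley (dsyms [i] (grad_symbol V)) x $ i) = hartley (\<lambda>\<xi>. \<Sum>i\<in>UNIV. dsyms [i] (grad_symbol V) \<xi> $ i) x"
      using hartley_sum[of UNIV "\<lambda>i \<xi>. dsyms [i] (grad_symbol V) \<xi> $ i" x] a
      by (simp add: hartley_linear[OF adm_dsym[OF gV] bounded_linear_vec_nth])
    also have "(\<lambda>\<xi>. \<Sum>i\<in>UNIV. dsyms [i] (grad_symbol V) \<xi> $ i) = (\<lambda>\<xi>. - ((norm \<xi>)\<^sup>2 * V \<xi>))"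
      unfolding norm_square_vec
      by (simp add: dsym_def[abs_def] grad_symbol_def V(2) sum_distrib_left sum_negf power2_eq_square mult_ac)
    finally show ?thesis .
  qed
  ultimately show ?thesis by (auto simp: weak_div_def elim!: eventually_mono)
qed

text \<open>The reflections of two successive derivatives cancel, so the symbol is -|\<xi>|^2
  whatever the parity of \<open>F\<close>; this matters because the amplitude of a velocity is
  odd.\<close>

lemma weak_laplacian_hartley:
  fixes F :: "real^'n::finite \<Rightarrow> 'b::euclidean_space"
  assumes F: "adm F"
  shows "AE x in lebesgue. weak_laplacian (hartley F) x = hartley (\<lambda>\<xi>. - ((norm \<xi>)\<^sup>2 *\<^sub>R F \<xi>)) x"
proof -
  have "AE x in lebesgue. \<forall>i. weak_deriv [i, i] (hartley F) x = hartley (dsyms [i, i] F) x"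
    by (intro eventually_all_finite weak_deriv_hartley F)
  moreover have "(\<Sum>i\<in>UNIV. hartley (dsyms [i, i] F) x) = hartley (\<lambda>\<xi>. - ((norm \<xi>)\<^sup>2 *\<^sub>R F \<xi>)) x" for x
  proof -
    have "(\<Sum>i\<in>UNIV. hartley (dsyms [i, i] F) x) = hartley (\<lambda>\<xi>. \<Sum>i\<in>UNIV. dsyms [i, i] F \<xi>) x"
      by (rule conjunct2[OF hartley_sum[OF finite adm_dsyms[OF F]], symmetric])
    also have "(\<lambda>\<xi>. \<Sum>i\<in>UNIV. dsyms [i, i] F \<xi>) = (\<lambda>\<xi>. - ((norm \<xi>)\<^sup>2 *\<^sub>R F \<xi>))"
      unfolding norm_square_vec
      by (simp add: dsym_def[abs_def] scaleR_sum_left sum_negf power2_eq_square)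
    finally show ?thesis .
  qed
  ultimately show ?thesis by (auto simp: weak_laplacian_def elim!: eventually_mono)
qed

text \<open>The divergence is known only almost everywhere, and the outer gradient differentiates
  that function; \<open>weak_deriv_cong_AE\<close> allows the replacement under the
  derivative.\<close>

lemma weak_grad_div_hartley:
  fixes V :: "real^'n::finite \<Rightarrow> real"
  assumes V: "adm V" "\<And>\<xi>. V (- \<xi>) = V \<xi>"
  shows "AE x in lebesgue. weak_grad (weak_div (hartley (grad_symbol V))) x = hartley (\<lambda>\<xi>. - ((norm \<xi>)\<^sup>2 *\<^sub>R grad_symbol V \<xi>)) x"
proof -
  let ?Q = "\<lambda>\<xi>. - ((norm \<xi>)\<^sup>2 * V \<xi>)"
  have Q: "adm ?Q"
    using adm_mult[OF adm_norm_square_mult[OF V(1)] continuous_on_const, of "-1"] by simp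
  have "weak_grad (weak_div (hartley (grad_symbol V))) = weak_grad (hartley ?Q)"
    unfolding weak_grad_def[abs_def]
    by (subst weak_deriv_cong_AE[OF weak_div_hartley[OF V]
          weak_div_measurable[OF adm_grad_symbol[OF V(1)]] hartley_lebesgue_measurable[OF Q]]) (rule refl)
  moreover have "grad_symbol ?Q = (\<lambda>\<xi>. - ((norm \<xi>)\<^sup>2 *\<^sub>R grad_symbol V \<xi>))"
    by (auto simp: grad_symbol_def)
  ultimately show ?thesis
    using weak_grad_hartley[OF Q] V(2) by simp
qed

section \<open>The equations of the system in terms of symbols\<close>

lemma continuity_equation_hartley:
  fixes V :: "real^'n::finite \<Rightarrow> real"
  assumes V: "adm V" "\<And>\<xi>. V (- \<xi>) = V \<xi>" and D: "adm D"
    and eq: "\<And>\<xi>. D \<xi> = \<beta> * (norm \<xi>)\<^sup>2 * V \<xi>"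
  shows "AE x in lebesgue. hartley D x + \<beta> * weak_div (hartley (grad_symbol V)) x = 0"
  using weak_div_hartley[OF V]
proof eventually_elim
  case (elim x)
  have "D = (\<lambda>\<xi>. (- \<beta>) *\<^sub>R (- ((norm \<xi>)\<^sup>2 * V \<xi>)))"
    by (simp add: eq mult.assoc fun_eq_iff)
  then have "hartley D x = hartley (\<lambda>\<xi>. (- \<beta>) *\<^sub>R (- ((norm \<xi>)\<^sup>2 * V \<xi>))) x"
    by simp
  also have "\<dots> = - \<beta> * hartley (\<lambda>\<xi>. - ((norm \<xi>)\<^sup>2 * V \<xi>)) x"
    unfolding hartley_scaleR by simp
  finally show ?case using elim by simp
qed

text \<open>Every term has an amplitude parallel to \<xi>, so the vector equation collapses to one
  scalar relation, in which the two viscosities occur only through their sum.\<close>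

lemma momentum_equation_hartley:
  fixes N1 N2 V D :: "real^'n::finite \<Rightarrow> real"
  assumes a: "adm N1" "adm N2" "adm V" "adm D"
    and even: "\<And>\<xi>. N1 (- \<xi>) = N1 \<xi>" "\<And>\<xi>. N2 (- \<xi>) = N2 \<xi>" "\<And>\<xi>. V (- \<xi>) = V \<xi>"
    and eq: "\<And>\<xi>. D \<xi> + b * N1 \<xi> + c * N2 \<xi> + (\<nu>1 + \<nu>2) * (norm \<xi>)\<^sup>2 * V \<xi> = 0"
  shows "AE x in lebesgue. hartley (grad_symbol D) x + b *\<^sub>R weak_grad (hartley N1) x + c *\<^sub>R weak_grad (hartley N2) x
    - \<nu>1 *\<^sub>R weak_laplacian (hartley (grad_symbol V)) x
    - \<nu>2 *\<^sub>R weak_grad (weak_div (hartley (grad_symbol V))) x = 0"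
  using weak_grad_hartley[OF a(1) even(1)] weak_grad_hartley[OF a(2) even(2)]
    weak_laplacian_hartley[OF adm_grad_symbol[OF a(3)]] weak_grad_div_hartley[OF a(3) even(3)]
proof eventually_elim
  case (elim x)
  note g = a[THEN adm_grad_symbol]
  have Q: "adm (\<lambda>\<xi>. - ((norm \<xi>)\<^sup>2 *\<^sub>R grad_symbol V \<xi>))"
    using adm_mult[OF adm_norm_square_mult[OF g(3)] continuous_on_const, of "-1"] by simp
  let ?Z = "\<lambda>\<xi>. ((grad_symbol D \<xi> + b *\<^sub>R grad_symbol N1 \<xi>) + c *\<^sub>R grad_symbol N2 \<xi>) + (- (\<nu>1 + \<nu>2)) *\<^sub>R (- ((norm \<xi>)\<^sup>2 *\<^sub>R grad_symbol V \<xi>))"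
  have c: "adm (\<lambda>\<xi>. k *\<^sub>R G \<xi>)" if "adm G" for k and G :: "real^'n \<Rightarrow> real^'n"
    using adm_mult[OF that continuous_on_const] .
  have "?Z \<xi> = 0" for \<xi>
  proof -
    have "?Z \<xi> = - (D \<xi> + b * N1 \<xi> + c * N2 \<xi> + (\<nu>1 + \<nu>2) * (norm \<xi>)\<^sup>2 * V \<xi>) *\<^sub>R \<xi>"
      by (simp add: grad_symbol_def algebra_simps)
    then show ?thesis by (simp add: eq)
  qed
  then have "0 = hartley ?Z x" by (simp add: hartley_def)
  also have "\<dots> = hartley (grad_symbol D) x + b *\<^sub>R hartley (grad_symbol N1) x + c *\<^sub>R hartley (grad_symbol N2) x
     + (- (\<nu>1 + \<nu>2)) *\<^sub>R hartley (\<lambda>\<xi>. - ((norm \<xi>)\<^sup>2 *\<^sub>R grad_symbol V \<xi>)) x"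
    by (simp only: hartley_add hartley_scaleR adm_add c g Q)
  finally show ?case by (simp add: elim scaleR_diff_left scaleR_add_left algebra_simps)
qed

section \<open>The dispersion relation and its inversion\<close>

text \<open>Here \<open>y\<close> is the squared frequency. With \<open>s = l\<^sup>2 / y\<close> the relation is quadratic in \<open>s\<close>, and its
  positive root decreases in \<open>l\<close>; \<open>g\<close> is the inverse of \<open>l \<mapsto> l\<^sup>2 / s l\<close>.\<close>

lemma dispersion_relation:
  fixes a b p m B \<theta> l1 l2 :: real
  assumes pos: "a > 0" "b > 0" "p > 0" "m > 0"
    and \<theta>: "(p * \<theta> + a) * (m * \<theta> + b) = B" and l: "0 < l1" "l1 < l2" "l2 < \<theta>"
  obtains c d g where "0 < c" "c < d" "continuous_on {c..d} g"
    "\<And>y. y \<in> {c..d} \<Longrightarrow> l1 \<le> g y \<and> g y \<le> l2 \<and>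
       ((g y)\<^sup>2 / y + p * g y + a) * ((g y)\<^sup>2 / y + m * g y + b) = B"
proof -
  define A where "A l = p * l + a" for l
  define C where "C l = m * l + b" for l
  \<comment> \<open>The larger root of (s + A)(s + C) = B; the discriminant (A + C)^2 - 4 (A C - B)
    is rewritten so that it is visibly positive.\<close>
  define s where "s l = (sqrt ((A l - C l)\<^sup>2 + 4 * B) - (A l + C l)) / 2" for l
  define \<kappa> where "\<kappa> l = l\<^sup>2 / s l" for l
  have AC: "A l > 0" "C l > 0" if "l > 0" for l
    using that pos by (auto simp: A_def C_def add_pos_pos)
  \<comment> \<open>The product A C increases in l and reaches B at \<theta>; below \<theta> it is
    smaller than B, and this makes the larger root positive.\<close>
  have AC_B: "A l * C l < B" if "0 < l" "l < \<theta>" for l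
  proof -
    have "A l * C l < A \<theta> * C \<theta>"
      using that pos AC[OF that(1)] by (intro mult_strict_mono) (auto simp: A_def C_def add_pos_pos)
    then show ?thesis using \<theta> by (simp add: A_def C_def)
  qed
  have B: "B > 0" using AC_B[of l1] AC[of l1] l by (smt (verit) mult_pos_pos)
  have s_root: "(s l + A l) * (s l + C l) = B" for l
  proof -
    have "(s l + A l) * (s l + C l) = ((sqrt ((A l - C l)\<^sup>2 + 4 * B))\<^sup>2 - (A l - C l)\<^sup>2) / 4"
      by (simp add: s_def field_simps power2_eq_square)
    also have "(sqrt ((A l - C l)\<^sup>2 + 4 * B))\<^sup>2 = (A l - C l)\<^sup>2 + 4 * B"
      using B by (intro real_sqrt_pow2) auto
    finally show ?thesis by simp
  qed
  have s_pos: "s l > 0" if "0 < l" "l < \<theta>" for l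
  proof -
    have "(A l + C l)\<^sup>2 < (A l - C l)\<^sup>2 + 4 * B"
      using AC_B[OF that] by (simp add: power2_eq_square algebra_simps)
    then have "\<bar>A l + C l\<bar> < sqrt ((A l - C l)\<^sup>2 + 4 * B)"
      by (metis real_sqrt_abs real_sqrt_less_iff)
    then show ?thesis by (simp add: s_def)
  qed
  have s_anti: "s l' < s l" if "0 < l" "l < l'" "l' < \<theta>" for l l'
  proof (rule ccontr)
    \<comment> \<open>Otherwise both factors would grow strictly from l to l', although their
      product is B at both points.\<close>
    assume "\<not> s l' < s l"
    then have "s l + A l < s l' + A l'" "s l + C l < s l' + C l'"
      using that pos by (auto simp: A_def C_def intro!: add_le_less_mono mult_strict_left_mono)
    then have "(s l + A l) * (s l + C l) < (s l' + A l') * (s l' + C l')"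
      using AC[of l] s_pos[of l] AC[of l'] s_pos[of l'] that by (intro mult_strict_mono) auto
    then show False by (simp add: s_root)
  qed
  have \<kappa>_mono: "\<kappa> l < \<kappa> l'" if "0 < l" "l < l'" "l' < \<theta>" for l l'
    unfolding \<kappa>_def using s_anti[OF that] s_pos[of l'] that
    by (intro frac_less) (auto intro!: power_strict_mono)
  have \<kappa>_pos: "\<kappa> l > 0" if "0 < l" "l < \<theta>" for l
    using s_pos[OF that] that by (simp add: \<kappa>_def)
  have cont: "continuous_on {l1..l2} \<kappa>"
    unfolding \<kappa>_def
  proof (intro continuous_on_divide ballI)
    show "continuous_on {l1..l2} s" unfolding s_def A_def C_def by (intro continuous_intros) auto
    show "s x \<noteq> 0" if "x \<in> {l1..l2}" for x using s_pos[of x] that l by auto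
  qed (intro continuous_intros)
  \<comment> \<open>The inverse of a continuous injection on a compact interval is continuous on the
    image, and the intermediate value theorem shows that the image contains the whole interval
    between the end values.\<close>
  define g where "g = the_inv_into {l1..l2} \<kappa>"
  have inj: "inj_on \<kappa> {l1..l2}"
  proof (rule inj_onI)
    fix x y assume "x \<in> {l1..l2}" "y \<in> {l1..l2}" "\<kappa> x = \<kappa> y"
    then show "x = y" using \<kappa>_mono[of x y] \<kappa>_mono[of y x] l by (cases x y rule: linorder_cases) auto
  qed
  have g_inv: "g (\<kappa> l) = l" if "l \<in> {l1..l2}" for l
    unfolding g_def using inj that by (rule the_inv_into_f_f)
  have "continuous_on (\<kappa> ` {l1..l2}) g"
    using g_inv by (intro continuous_on_inv[OF cont]) auto
  moreover have sub: "{\<kappa> l1..\<kappa> l2} \<subseteq> \<kappa> ` {l1..l2}"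
    using IVT'[of \<kappa> l1 _ l2] cont l by fastforce
  ultimately have "continuous_on {\<kappa> l1..\<kappa> l2} g" by (rule continuous_on_subset)
  moreover have "l1 \<le> g y \<and> g y \<le> l2 \<and> ((g y)\<^sup>2 / y + p * g y + a) * ((g y)\<^sup>2 / y + m * g y + b) = B"
    if "y \<in> {\<kappa> l1..\<kappa> l2}" for y
  proof -
    obtain l where l': "l \<in> {l1..l2}" "y = \<kappa> l" using sub \<open>y \<in> _\<close> by blast
    have gy: "g y = l" using g_inv l' by simp
    have "l > 0" using l' l by simp
    then have "(g y)\<^sup>2 / y = s l" unfolding gy by (simp add: l'(2) \<kappa>_def)
    then show ?thesis using s_root[of l] l'(1) unfolding gy by (simp add: A_def C_def add.assoc)
  qed
  ultimately show ?thesis using \<kappa>_pos[of l1] \<kappa>_mono[of l1 l2] l by (intro that[of "\<kappa> l1" "\<kappa> l2" g]) auto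
qed

section \<open>Coefficients and the growing mode\<close>

text \<open>\<open>rho_p\<close> is a definite description, so nothing is known about it until its
  equation has exactly one solution. The function \<open>h\<close> increases strictly on (1,
  \<infinity>), from -\<infinity> at 1 without upper bound; the endpoints for the intermediate value
  theorem are explicit.\<close>

lemma rho_p_gt_1:
  fixes gp gm :: real
  assumes "gp \<ge> 1" "gm \<ge> 1"
  shows "rho_p gp gm f 1 1 > 1"
proof -
  define h where "h r = r powr gp - (r / (r - 1)) powr gm" for r :: real
  have mono: "h r < h r'" if "1 < r" "r < r'" for r r'
  proof -
    have "r powr gp < r' powr gp" using that assms by (intro powr_less_mono2) auto
    moreover have "r' / (r' - 1) < r / (r - 1)" using that by (simp add: field_simps)
    then have "(r' / (r' - 1)) powr gm < (r / (r - 1)) powr gm"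
      using that assms by (intro powr_less_mono2) auto
    ultimately show ?thesis by (simp add: h_def)
  qed
  define c where "c = f 1"
  \<comment> \<open>Chosen so that h (1 + \<delta>) \<le> 2^gp - 1 / \<delta> = -|c| - 1, where the
    exponent gm \<ge> 1 permits dropping the power of (1 + \<delta>) / \<delta> \<ge> 1.\<close>
  define Q where "Q = 2 powr gp + \<bar>c\<bar> + 1"
  define \<delta> where "\<delta> = 1 / Q"
  have p2: "2 powr gp > 0" "2 powr gm > 0" by auto
  have "1 \<le> Q" using p2(1) unfolding Q_def by linarith
  then have \<delta>: "0 < \<delta>" "\<delta> \<le> 1" by (auto simp: \<delta>_def)
  have ge: "x \<le> x powr g" if "1 \<le> x" "1 \<le> g" for x g :: real
    using powr_mono[of 1 g x] that by simp
  have low: "h (1 + \<delta>) \<le> c"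
  proof -
    have "(1 + \<delta>) powr gp \<le> 2 powr gp" using \<delta> assms by (intro powr_mono2) auto
    moreover have "1 / \<delta> \<le> (1 + \<delta>) / \<delta>" using \<delta> by (simp add: divide_right_mono)
    moreover have "(1 + \<delta>) / \<delta> \<le> ((1 + \<delta>) / \<delta>) powr gm" using \<delta> assms by (intro ge) auto
    moreover have "1 / \<delta> = 2 powr gp + \<bar>c\<bar> + 1" by (simp add: \<delta>_def Q_def)
    ultimately show ?thesis by (simp add: h_def)
  qed
  \<comment> \<open>As M \<ge> 2, the quotient M / (M - 1) is at most 2, so h M \<ge> M - 2^gm = |c|
    + 2.\<close>
  define M where "M = 2 powr gm + \<bar>c\<bar> + 2"
  have M: "M \<ge> 2" using p2 by (simp add: M_def)
  have up: "c \<le> h M"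
  proof -
    have "M \<le> M powr gp" using M assms by (intro ge) auto
    moreover have "(M / (M - 1)) powr gm \<le> 2 powr gm"
      using M assms by (intro powr_mono2) (auto simp: field_simps)
    ultimately show ?thesis by (simp add: h_def M_def)
  qed
  have "continuous_on {1 + \<delta>..M} h"
    unfolding h_def using \<delta> by (intro continuous_intros) (auto simp: field_simps)
  then obtain r where r: "1 + \<delta> \<le> r" "h r = c"
    using IVT'[of h "1 + \<delta>" c M] low up \<delta> M by auto
  have "\<exists>!r. 1 < r \<and> pressure gp r - pressure gm (1 * r / (r - 1)) - f 1 = 0"
  proof (rule ex1I[of _ r])
    show "1 < r \<and> pressure gp r - pressure gm (1 * r / (r - 1)) - f 1 = 0"
      using r \<delta> by (simp add: h_def c_def pressure_def)
    fix r' assume "1 < r' \<and> pressure gp r' - pressure gm (1 * r' / (r' - 1)) - f 1 = 0"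
    then have "1 < r'" "h r' = h r" using r(2) by (auto simp: h_def c_def pressure_def)
    moreover have "1 < r" using r \<delta> by simp
    ultimately show "r' = r" using mono[of r r'] mono[of r' r] by linarith
  qed
  from theI'[OF this] show ?thesis by (simp add: rho_p_def)
qed

text \<open>The last inequality is the instability condition \<beta>1 \<beta>4 < \<beta>2 \<beta>3
  in terms of the \<alpha>. It holds because C^4 separates the two products: the capillary term
  f'(1) > 0 is subtracted in \<alpha>4 and added in \<alpha>2 (the local \<open>C\<close> stands for
  C^2).\<close>

lemma coefficients:
  fixes gp gm :: real and f :: "real \<Rightarrow> real"
  assumes "gp \<ge> 1" "gm \<ge> 1" "deriv f 1 > 0"
  shows "rho_p gp gm f 1 1 > 0" "rho_m gp gm f 1 1 > 0" "alpha1 gp gm f > 0" "alpha2 gp gm f > 0"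
    "alpha3 gp gm f > 0" "alpha1 gp gm f * alpha4 gp gm f < alpha2 gp gm f * alpha3 gp gm f"
proof -
  define rp where "rp = rho_p gp gm f 1 1"
  define rm where "rm = rho_m gp gm f 1 1"
  define sp where "sp = ssq_p gp gm f 1 1"
  define sm where "sm = ssq_m gp gm f 1 1"
  define ap where "ap = frac_p gp gm f 1 1"
  define am where "am = frac_m gp gm f 1 1"
  define C where "C = Csq gp gm f 1 1"
  define f' where "f' = deriv f 1"
  have "rp > 1" unfolding rp_def by (rule rho_p_gt_1[OF assms(1,2)])
  then have rp: "rp > 0" and rm: "rm > 0" by (auto simp: rm_def rho_m_def rp_def)
  have sp: "sp > 0" and sm: "sm > 0"
    using rp rm assms by (auto simp: sp_def sm_def ssq_p_def ssq_m_def pressure_def rp_def rm_def)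
  have ap: "ap > 0" and am: "am > 0"
    using rp rm by (auto simp: ap_def am_def frac_p_def frac_m_def rp_def rm_def)
  have "C = sm * sp / (am * rp * sp + ap * rm * sm)"
    by (simp add: C_def Csq_def sm_def sp_def am_def ap_def rp_def rm_def)
  then have C: "C > 0" using sp sm ap am rp rm by (simp add: add_pos_pos)
  have f': "f' > 0" using assms by (simp add: f'_def)
  have eqs: "alpha1 gp gm f = C * rm / rp" "alpha2 gp gm f = C + C * am * f' / sm"
    "alpha3 gp gm f = C" "alpha4 gp gm f = C * rp / rm - C * ap * f' / sp"
    by (simp_all add: alpha1_def alpha2_def alpha3_def alpha4_def C_def rm_def rp_def am_def ap_def sm_def sp_def f'_def)
  show "rho_p gp gm f 1 1 > 0" "rho_m gp gm f 1 1 > 0" "alpha1 gp gm f > 0" "alpha2 gp gm f > 0"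
    "alpha3 gp gm f > 0"
    using rp rm C am f' sm unfolding eqs by (auto simp: rp_def[symmetric] rm_def[symmetric] intro!: add_pos_pos)
  have "alpha1 gp gm f * alpha4 gp gm f = C * C - C * rm / rp * (C * ap * f' / sp)"
    unfolding eqs using rp rm by (simp add: field_simps)
  also have "\<dots> < C * C"
    using C rm rp ap f' sp by simp
  also have "\<dots> < (C + C * am * f' / sm) * C"
    using C am f' sm by (simp add: distrib_right)
  finally show "alpha1 gp gm f * alpha4 gp gm f < alpha2 gp gm f * alpha3 gp gm f"
    unfolding eqs .
qed

text \<open>\<theta> is the positive root of p m \<theta>^2 + (p b + m a) \<theta> + a b - B = 0,
  which is the dispersion relation with the term \<lambda>^2 / |\<xi>|^2 removed.\<close>

lemma growth_rate:
  fixes a b p m B :: real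
  assumes "a > 0" "b > 0" "p > 0" "m > 0" "a * b < B"
    and "\<theta> = (sqrt ((p * b + m * a)\<^sup>2 + 4 * p * m * (B - a * b)) - (p * b + m * a)) / (2 * p * m)"
  shows "\<theta> > 0" "(p * \<theta> + a) * (m * \<theta> + b) = B"
proof -
  define D where "D = sqrt ((p * b + m * a)\<^sup>2 + 4 * p * m * (B - a * b))"
  have pos: "p * b + m * a > 0" "4 * p * m * (B - a * b) > 0" using assms by (auto intro!: add_pos_pos)
  have "p * b + m * a < D"
    unfolding D_def using pos by (intro real_less_rsqrt) auto
  then show "\<theta> > 0" using assms by (simp add: D_def)
  have D2: "D\<^sup>2 = (p * b + m * a)\<^sup>2 + 4 * p * m * (B - a * b)"
    unfolding D_def using pos by (intro real_sqrt_pow2) (simp add: less_imp_le)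
  have "2 * p * m * \<theta> = D - (p * b + m * a)" using assms by (simp add: D_def)
  then have D: "D = 2 * p * m * \<theta> + (p * b + m * a)" by simp
  have "4 * (p * m) * ((p * \<theta> + a) * (m * \<theta> + b)) = 4 * (p * m) * B"
    using D2 unfolding D by (simp add: power2_eq_square algebra_simps)
  then show "(p * \<theta> + a) * (m * \<theta> + b) = B" using assms by simp
qed

section \<open>Superpositions of exponentially growing modes\<close>

definition evolve :: "(real^'n::finite \<Rightarrow> real) \<Rightarrow> (real^'n \<Rightarrow> 'b::euclidean_space) \<Rightarrow> real \<Rightarrow> real^'n \<Rightarrow> 'b" where
  "evolve \<Lambda> G t = hartley (\<lambda>\<xi>. exp (\<Lambda> \<xi> * t) *\<^sub>R G \<xi>)"

lemma evolve_0 [simp]: "evolve \<Lambda> G 0 = hartley G"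
  by (simp add: evolve_def)

lemma
  fixes G :: "real^'n::finite \<Rightarrow> 'b::euclidean_space"
  assumes L: "continuous_on UNIV \<Lambda>" "\<And>\<xi>. \<Lambda> (- \<xi>) = \<Lambda> \<xi>" "\<And>\<xi>. 0 \<le> \<Lambda> \<xi>" "\<And>\<xi>. \<Lambda> \<xi> \<le> K" and K: "K > 0"
    and G: "adm G"
  shows C_time_H_evolve: "C_time j (H_space k) (H_norm k) (evolve \<Lambda> G)"
    and C_time_L2_evolve: "C_time j L2_space L2_norm (evolve \<Lambda> G)"
    and has_time_deriv_evolve:
      "t \<ge> 0 \<Longrightarrow> has_time_deriv L2_space L2_norm (evolve \<Lambda> G) (evolve \<Lambda> (\<lambda>\<xi>. \<Lambda> \<xi> *\<^sub>R G \<xi>) t) t"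
  unfolding evolve_def[abs_def]
    by (rule C_time_hartley[OF L K hartley_H_space H_norm_nonneg H_norm_hartley_mult_le G]
        C_time_hartley[OF L K hartley_L2 L2_norm_nonneg L2_norm_hartley_mult_le G]
        has_time_deriv_hartley[OF L K hartley_L2 L2_norm_nonneg L2_norm_hartley_mult_le G]; assumption)+

text \<open>The lower bound is the upper bound read backwards in time: the multiplier exp(-\<Lambda>
  t), which is at most exp(-l t), recovers the initial amplitude.\<close>

lemma L2_norm_evolve_bounds:
  assumes L: "continuous_on UNIV \<Lambda>" "\<And>\<xi>. l \<le> \<Lambda> \<xi>" "\<And>\<xi>. \<Lambda> \<xi> \<le> h"
    and G: "adm G" and t: "t \<ge> 0"
  shows "exp (l * t) * L2_norm (evolve \<Lambda> G 0) \<le> L2_norm (evolve \<Lambda> G t) \<and>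
    L2_norm (evolve \<Lambda> G t) \<le> exp (h * t) * L2_norm (evolve \<Lambda> G 0)"
proof
  have c: "continuous_on UNIV (\<lambda>\<xi>. exp (\<Lambda> \<xi> * s))" for s
    by (intro continuous_intros L)
  show "L2_norm (evolve \<Lambda> G t) \<le> exp (h * t) * L2_norm (evolve \<Lambda> G 0)"
    unfolding evolve_0 unfolding evolve_def
    using L t by (intro L2_norm_hartley_mult_le G c) (auto intro: mult_right_mono)
  have "L2_norm (hartley (\<lambda>\<xi>. exp (\<Lambda> \<xi> * (- t)) *\<^sub>R exp (\<Lambda> \<xi> * t) *\<^sub>R G \<xi>)) \<le> exp (- (l * t)) * L2_norm (evolve \<Lambda> G t)"
    unfolding evolve_def
    using L t by (intro L2_norm_hartley_mult_le adm_mult G c) (auto intro: mult_right_mono)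
  then have "L2_norm (hartley G) \<le> exp (- (l * t)) * L2_norm (evolve \<Lambda> G t)"
    by (simp add: exp_add[symmetric])
  from mult_left_mono[OF this, of "exp (l * t)"]
  show "exp (l * t) * L2_norm (evolve \<Lambda> G 0) \<le> L2_norm (evolve \<Lambda> G t)"
    by (simp add: mult.assoc[symmetric] exp_add[symmetric])
qed

lemma evolve_grad_symbol:
  "evolve \<Lambda> (grad_symbol V) t = hartley (grad_symbol (\<lambda>\<xi>. exp (\<Lambda> \<xi> * t) *\<^sub>R V \<xi>))"
  "evolve \<Lambda> (\<lambda>\<xi>. \<Lambda> \<xi> *\<^sub>R grad_symbol V \<xi>) t = hartley (grad_symbol (\<lambda>\<xi>. exp (\<Lambda> \<xi> * t) *\<^sub>R \<Lambda> \<xi> *\<^sub>R V \<xi>))"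
  by (simp_all add: evolve_def grad_symbol_def[abs_def])

text \<open>The four relations say that the amplitudes form an eigenvector with eigenvalue \<Lambda>
  at each frequency. Multiplied by the common factor exp(\<Lambda> t), they become the equations at
  time t.\<close>

lemma evolve_solves_linear_system:
  fixes Np Nm Vp Vm :: "real^3 \<Rightarrow> real"
  assumes L: "continuous_on UNIV \<Lambda>" "\<And>\<xi>. \<Lambda> (- \<xi>) = \<Lambda> \<xi>" "\<And>\<xi>. 0 \<le> \<Lambda> \<xi>" "\<And>\<xi>. \<Lambda> \<xi> \<le> K" and K: "K > 0"
    and adm: "adm Np" "adm Nm" "adm Vp" "adm Vm"
    and even: "\<And>\<xi>. Np (- \<xi>) = Np \<xi>" "\<And>\<xi>. Nm (- \<xi>) = Nm \<xi>" "\<And>\<xi>. Vp (- \<xi>) = Vp \<xi>" "\<And>\<xi>. Vm (- \<xi>) = Vm \<xi>"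
    and eq: "\<And>\<xi>. \<Lambda> \<xi> * Np \<xi> = \<beta>1 * (norm \<xi>)\<^sup>2 * Vp \<xi>"
      "\<And>\<xi>. \<Lambda> \<xi> * Vp \<xi> + \<beta>1 * Np \<xi> + \<beta>2 * Nm \<xi> + (\<nu>1p + \<nu>2p) * (norm \<xi>)\<^sup>2 * Vp \<xi> = 0"
      "\<And>\<xi>. \<Lambda> \<xi> * Nm \<xi> = \<beta>4 * (norm \<xi>)\<^sup>2 * Vm \<xi>"
      "\<And>\<xi>. \<Lambda> \<xi> * Vm \<xi> + \<beta>3 * Np \<xi> + \<beta>4 * Nm \<xi> + (\<nu>1m + \<nu>2m) * (norm \<xi>)\<^sup>2 * Vm \<xi> = 0"
  shows "solves_linear_system \<beta>1 \<beta>2 \<beta>3 \<beta>4 \<nu>1p \<nu>2p \<nu>1m \<nu>2m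
    (evolve \<Lambda> Np) (evolve \<Lambda> (grad_symbol Vp)) (evolve \<Lambda> Nm) (evolve \<Lambda> (grad_symbol Vm))"
  unfolding solves_linear_system_def
proof (intro allI impI)
  fix t :: real assume t: "t \<ge> 0"
  let ?e = "\<lambda>G \<xi>. exp (\<Lambda> \<xi> * t) *\<^sub>R (G \<xi> :: real)"
  let ?d = "\<lambda>G \<xi>. exp (\<Lambda> \<xi> * t) *\<^sub>R \<Lambda> \<xi> *\<^sub>R (G \<xi> :: real)"
  have c: "continuous_on UNIV (\<lambda>\<xi>. exp (\<Lambda> \<xi> * t))" by (intro continuous_intros L)
  note e = adm[THEN adm_mult[OF _ c]] and d = adm_mult[OF adm_mult[OF _ L(1)] c]
  note D = has_time_deriv_evolve[OF L K _ t]
  have ee: "?e G (- \<xi>) = ?e G \<xi>" if "\<And>\<xi>. G (- \<xi>) = G \<xi>" for G \<xi>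
    using that L(2) by simp
  have ed: "evolve \<Lambda> (\<lambda>\<xi>. \<Lambda> \<xi> *\<^sub>R G \<xi>) t = hartley (?d G)" "evolve \<Lambda> G t = hartley (?e G)" for G
    by (simp_all add: evolve_def)
  have 1: "AE x in lebesgue. hartley (?d Np) x + \<beta>1 * weak_div (hartley (grad_symbol (?e Vp))) x = 0"
  proof (rule continuity_equation_hartley[where V="?e Vp" and D="?d Np", OF e(3) ee[of Vp, OF even(3)] d[OF adm(1)]])
    show "?d Np \<xi> = \<beta>1 * (norm \<xi>)\<^sup>2 * ?e Vp \<xi>" for \<xi>
      using arg_cong[OF eq(1)[of \<xi>], of "\<lambda>z. exp (\<Lambda> \<xi> * t) * z"] by (simp add: mult_ac)
  qed
  have 4: "AE x in lebesgue. hartley (?d Nm) x + \<beta>4 * weak_div (hartley (grad_symbol (?e Vm))) x = 0"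
  proof (rule continuity_equation_hartley[where V="?e Vm" and D="?d Nm", OF e(4) ee[of Vm, OF even(4)] d[OF adm(2)]])
    show "?d Nm \<xi> = \<beta>4 * (norm \<xi>)\<^sup>2 * ?e Vm \<xi>" for \<xi>
      using arg_cong[OF eq(3)[of \<xi>], of "\<lambda>z. exp (\<Lambda> \<xi> * t) * z"] by (simp add: mult_ac)
  qed
  have 2: "AE x in lebesgue. hartley (grad_symbol (?d Vp)) x + \<beta>1 *\<^sub>R weak_grad (hartley (?e Np)) x + \<beta>2 *\<^sub>R weak_grad (hartley (?e Nm)) x
    - \<nu>1p *\<^sub>R weak_laplacian (hartley (grad_symbol (?e Vp))) x
    - \<nu>2p *\<^sub>R weak_grad (weak_div (hartley (grad_symbol (?e Vp)))) x = 0"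
  proof (rule momentum_equation_hartley[where ?N1.0="?e Np" and ?N2.0="?e Nm" and V="?e Vp" and D="?d Vp", OF e(1,2,3) d[OF adm(3)] ee[of Np, OF even(1)] ee[of Nm, OF even(2)] ee[of Vp, OF even(3)]])
    show "?d Vp \<xi> + \<beta>1 * ?e Np \<xi> + \<beta>2 * ?e Nm \<xi> + (\<nu>1p + \<nu>2p) * (norm \<xi>)\<^sup>2 * ?e Vp \<xi> = 0" for \<xi>
      using arg_cong[OF eq(2)[of \<xi>], of "\<lambda>z. exp (\<Lambda> \<xi> * t) * z"] by (simp add: algebra_simps)
  qed
  have 3: "AE x in lebesgue. hartley (grad_symbol (?d Vm)) x + \<beta>3 *\<^sub>R weak_grad (hartley (?e Np)) x + \<beta>4 *\<^sub>R weak_grad (hartley (?e Nm)) x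
    - \<nu>1m *\<^sub>R weak_laplacian (hartley (grad_symbol (?e Vm))) x
    - \<nu>2m *\<^sub>R weak_grad (weak_div (hartley (grad_symbol (?e Vm)))) x = 0"
  proof (rule momentum_equation_hartley[where ?N1.0="?e Np" and ?N2.0="?e Nm" and V="?e Vm" and D="?d Vm", OF e(1,2,4) d[OF adm(4)] ee[of Np, OF even(1)] ee[of Nm, OF even(2)] ee[of Vm, OF even(4)]])
    show "?d Vm \<xi> + \<beta>3 * ?e Np \<xi> + \<beta>4 * ?e Nm \<xi> + (\<nu>1m + \<nu>2m) * (norm \<xi>)\<^sup>2 * ?e Vm \<xi> = 0" for \<xi>
      using arg_cong[OF eq(4)[of \<xi>], of "\<lambda>z. exp (\<Lambda> \<xi> * t) * z"] by (simp add: algebra_simps)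
  qed
  show "\<exists>dnp dup dnm dum.
        has_time_deriv L2_space L2_norm (evolve \<Lambda> Np) dnp t \<and>
        has_time_deriv L2_space L2_norm (evolve \<Lambda> (grad_symbol Vp)) dup t \<and>
        has_time_deriv L2_space L2_norm (evolve \<Lambda> Nm) dnm t \<and>
        has_time_deriv L2_space L2_norm (evolve \<Lambda> (grad_symbol Vm)) dum t \<and>
        (AE x in lebesgue. dnp x + \<beta>1 * weak_div (evolve \<Lambda> (grad_symbol Vp) t) x = 0) \<and>
        (AE x in lebesgue. dup x + \<beta>1 *\<^sub>R weak_grad (evolve \<Lambda> Np t) x + \<beta>2 *\<^sub>R weak_grad (evolve \<Lambda> Nm t) x
            - \<nu>1p *\<^sub>R weak_laplacian (evolve \<Lambda> (grad_symbol Vp) t) x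
            - \<nu>2p *\<^sub>R weak_grad (weak_div (evolve \<Lambda> (grad_symbol Vp) t)) x = 0) \<and>
        (AE x in lebesgue. dnm x + \<beta>4 * weak_div (evolve \<Lambda> (grad_symbol Vm) t) x = 0) \<and>
        (AE x in lebesgue. dum x + \<beta>3 *\<^sub>R weak_grad (evolve \<Lambda> Np t) x + \<beta>4 *\<^sub>R weak_grad (evolve \<Lambda> Nm t) x
            - \<nu>1m *\<^sub>R weak_laplacian (evolve \<Lambda> (grad_symbol Vm) t) x
            - \<nu>2m *\<^sub>R weak_grad (weak_div (evolve \<Lambda> (grad_symbol Vm) t)) x = 0)"
    by (intro exI conjI, (rule D adm adm_grad_symbol adm(3,4)[THEN adm_grad_symbol])+)
      (simp_all only: evolve_grad_symbol ed 1 2 3 4)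
qed

text \<open>The physical coefficients enter only through signs and the equation for \<theta>. Since
  all amplitudes have bounded support, one construction supplies every order of regularity in space
  and time.\<close>

lemma growing_solution:
  fixes \<beta>1 \<beta>2 \<beta>3 \<beta>4 \<nu>1p \<nu>1m \<nu>2p \<nu>2m \<theta> \<epsilon> :: real
  assumes pos: "\<beta>1 > 0" "\<beta>2 > 0" "\<beta>4 > 0" "\<nu>1p + \<nu>2p > 0" "\<nu>1m + \<nu>2m > 0" "\<theta> > 0" "\<epsilon> > 0"
    and \<theta>: "((\<nu>1p + \<nu>2p) * \<theta> + \<beta>1\<^sup>2) * ((\<nu>1m + \<nu>2m) * \<theta> + \<beta>4\<^sup>2) = \<beta>1 * \<beta>2 * \<beta>3 * \<beta>4"
  obtains np nm :: "real \<Rightarrow> real^3 \<Rightarrow> real" and up um :: "real \<Rightarrow> real^3 \<Rightarrow> real^3" where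
    "solves_linear_system \<beta>1 \<beta>2 \<beta>3 \<beta>4 \<nu>1p \<nu>2p \<nu>1m \<nu>2m np up nm um"
    "\<And>j k. C_time j (H_space k) (H_norm k) np" "\<And>j k. C_time j (H_space k) (H_norm k) nm"
    "\<And>j k. C_time j (H_space k) (H_norm k) up" "\<And>j k. C_time j (H_space k) (H_norm k) um"
    "\<And>j. C_time j L2_space L2_norm up" "\<And>j. C_time j L2_space L2_norm um"
    "L2_norm (np 0) > 0" "L2_norm (up 0) > 0" "L2_norm (nm 0) > 0" "L2_norm (um 0) > 0"
    "\<And>t. t \<ge> 0 \<Longrightarrow> exp ((\<theta> - \<epsilon>) * t) * L2_norm (np 0) \<le> L2_norm (np t) \<and> L2_norm (np t) \<le> exp (\<theta> * t) * L2_norm (np 0)"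
    "\<And>t. t \<ge> 0 \<Longrightarrow> exp ((\<theta> - \<epsilon>) * t) * L2_norm (nm 0) \<le> L2_norm (nm t) \<and> L2_norm (nm t) \<le> exp (\<theta> * t) * L2_norm (nm 0)"
    "\<And>t. t \<ge> 0 \<Longrightarrow> exp ((\<theta> - \<epsilon>) * t) * L2_norm (up 0) \<le> L2_norm (up t) \<and> L2_norm (up t) \<le> exp (\<theta> * t) * L2_norm (up 0)"
    "\<And>t. t \<ge> 0 \<Longrightarrow> exp ((\<theta> - \<epsilon>) * t) * L2_norm (um 0) \<le> L2_norm (um t) \<and> L2_norm (um t) \<le> exp (\<theta> * t) * L2_norm (um 0)"
proof -
  \<comment> \<open>The bound \<theta> / 2 keeps the band of growth rates positive when \<epsilon>
    exceeds \<theta>.\<close>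
  define l1 where "l1 = max (\<theta> - \<epsilon>) (\<theta> / 2)"
  define l2 where "l2 = (l1 + \<theta>) / 2"
  have l: "0 < l1" "l1 < l2" "l2 < \<theta>" "\<theta> - \<epsilon> \<le> l1" using pos by (auto simp: l1_def l2_def)
  obtain c d g where cd: "0 < c" "c < d" and g: "continuous_on {c..d} g"
    "\<And>y. y \<in> {c..d} \<Longrightarrow> l1 \<le> g y \<and> g y \<le> l2 \<and>
       ((g y)\<^sup>2 / y + (\<nu>1p + \<nu>2p) * g y + \<beta>1\<^sup>2) * ((g y)\<^sup>2 / y + (\<nu>1m + \<nu>2m) * g y + \<beta>4\<^sup>2) = \<beta>1 * \<beta>2 * \<beta>3 * \<beta>4"
    by (rule dispersion_relation[OF _ _ pos(4,5) \<theta> l(1-3)]) (use pos in auto)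
  \<comment> \<open>\<open>\<kappa>\<close> agrees with the squared frequency on the support of \<open>F\<close>; clamping keeps the symbols
    continuous and defined everywhere.\<close>
  define \<kappa> :: "real^3 \<Rightarrow> real" where "\<kappa> \<xi> = max c (min d ((norm \<xi>)\<^sup>2))" for \<xi>
  define \<Lambda> where "\<Lambda> \<xi> = g (\<kappa> \<xi>)" for \<xi>
  \<comment> \<open>A continuous radial bump that is positive exactly on the open annulus c <
    |\<xi>|^2 < d.\<close>
  define F :: "real^3 \<Rightarrow> real" where "F \<xi> = max 0 (((norm \<xi>)\<^sup>2 - c) * (d - (norm \<xi>)\<^sup>2))" for \<xi>
  \<comment> \<open>With \<open>Vp\<close> eliminated, the first momentum equation reads X Np +
    \<beta>1 \<beta>2 Nm = 0, where X is the factor in \<open>Nm\<close>; the pair (\<beta>1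
    \<beta>2, -X) spans its solutions.\<close>
  define Np where "Np \<xi> = (\<beta>1 * \<beta>2) *\<^sub>R F \<xi>" for \<xi>
  define Nm where "Nm \<xi> = (- ((\<Lambda> \<xi>)\<^sup>2 / \<kappa> \<xi> + (\<nu>1p + \<nu>2p) * \<Lambda> \<xi> + \<beta>1\<^sup>2)) *\<^sub>R F \<xi>" for \<xi>
  \<comment> \<open>The two velocity potentials are obtained by solving the continuity
    equations.\<close>
  define Vp where "Vp \<xi> = (\<Lambda> \<xi> / (\<beta>1 * \<kappa> \<xi>)) *\<^sub>R Np \<xi>" for \<xi>
  define Vm where "Vm \<xi> = (\<Lambda> \<xi> / (\<beta>4 * \<kappa> \<xi>)) *\<^sub>R Nm \<xi>" for \<xi>
  have \<kappa>: "\<kappa> \<xi> \<in> {c..d}" "\<kappa> \<xi> > 0" for \<xi> using cd by (auto simp: \<kappa>_def)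
  have \<kappa>_cont: "continuous_on UNIV \<kappa>"
    unfolding \<kappa>_def by (intro continuous_intros)
  have \<Lambda>_cont: "continuous_on UNIV \<Lambda>"
    unfolding \<Lambda>_def by (rule continuous_on_compose2[OF g(1) \<kappa>_cont]) (use \<kappa>(1) in auto)
  have \<Lambda>: "l1 \<le> \<Lambda> \<xi>" "\<Lambda> \<xi> \<le> l2" for \<xi> using g(2)[OF \<kappa>(1)] by (auto simp: \<Lambda>_def)
  have disp: "((\<Lambda> \<xi>)\<^sup>2 / \<kappa> \<xi> + (\<nu>1p + \<nu>2p) * \<Lambda> \<xi> + \<beta>1\<^sup>2) * ((\<Lambda> \<xi>)\<^sup>2 / \<kappa> \<xi> + (\<nu>1m + \<nu>2m) * \<Lambda> \<xi> + \<beta>4\<^sup>2) = \<beta>1 * \<beta>2 * \<beta>3 * \<beta>4" for \<xi>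
    using g(2)[OF \<kappa>(1)] by (auto simp: \<Lambda>_def)
  have even: "\<kappa> (- \<xi>) = \<kappa> \<xi>" "\<Lambda> (- \<xi>) = \<Lambda> \<xi>" "F (- \<xi>) = F \<xi>" "Np (- \<xi>) = Np \<xi>" "Nm (- \<xi>) = Nm \<xi>"
    "Vp (- \<xi>) = Vp \<xi>" "Vm (- \<xi>) = Vm \<xi>" for \<xi>
    by (simp_all add: \<kappa>_def \<Lambda>_def F_def Np_def Nm_def Vp_def Vm_def)
  \<comment> \<open>At every frequency either all amplitudes vanish or the clamped value is the true
    squared frequency, so the scalar equations need checking only with \<kappa>.\<close>
  have F_supp: "F \<xi> = 0 \<or> \<kappa> \<xi> = (norm \<xi>)\<^sup>2" for \<xi>
  proof (cases "c \<le> (norm \<xi>)\<^sup>2 \<and> (norm \<xi>)\<^sup>2 \<le> d")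
    case False
    then have "((norm \<xi>)\<^sup>2 - c) * (d - (norm \<xi>)\<^sup>2) \<le> 0"
      using cd by (auto simp: not_le intro: mult_nonpos_nonneg mult_nonneg_nonpos)
    then show ?thesis by (simp add: F_def)
  qed (auto simp: \<kappa>_def)
  have F: "adm F"
    unfolding adm_def
  proof (intro conjI exI allI impI)
    show "continuous_on UNIV F" unfolding F_def by (intro continuous_intros)
    fix \<xi> :: "real^3" assume "norm \<xi> > sqrt d"
    then have "(sqrt d)\<^sup>2 < (norm \<xi>)\<^sup>2" using cd by (intro power_strict_mono) auto
    then have "(norm \<xi>)\<^sup>2 > d" using cd by simp
    then have "((norm \<xi>)\<^sup>2 - c) * (d - (norm \<xi>)\<^sup>2) \<le> 0"
      using cd by (intro mult_nonneg_nonpos) auto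
    then show "F \<xi> = 0" by (simp add: F_def)
  qed
  have ne: "\<kappa> \<xi> \<noteq> 0" "\<beta>1 * \<kappa> \<xi> \<noteq> 0" "\<beta>4 * \<kappa> \<xi> \<noteq> 0" for \<xi> using \<kappa>(2)[of \<xi>] pos by auto
  have adm: "adm Np" "adm Nm"
    unfolding Np_def Nm_def
    by (intro adm_mult F continuous_intros \<Lambda>_cont \<kappa>_cont ballI ne)+
  have admV: "adm Vp" "adm Vm"
    unfolding Vp_def Vm_def
    by (intro adm_mult adm continuous_intros \<Lambda>_cont \<kappa>_cont ballI ne)+
  have eq1: "\<Lambda> \<xi> * Np \<xi> = \<beta>1 * (norm \<xi>)\<^sup>2 * Vp \<xi>" for \<xi>
    using F_supp[of \<xi>] ne[of \<xi>] pos by (auto simp: Vp_def Np_def)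
  have eq3: "\<Lambda> \<xi> * Nm \<xi> = \<beta>4 * (norm \<xi>)\<^sup>2 * Vm \<xi>" for \<xi>
    using F_supp[of \<xi>] ne[of \<xi>] pos by (auto simp: Vm_def Nm_def)
  have eq2: "\<Lambda> \<xi> * Vp \<xi> + \<beta>1 * Np \<xi> + \<beta>2 * Nm \<xi> + (\<nu>1p + \<nu>2p) * (norm \<xi>)\<^sup>2 * Vp \<xi> = 0" for \<xi>
    using F_supp[of \<xi>]
  proof
    assume "\<kappa> \<xi> = (norm \<xi>)\<^sup>2"
    then have "\<Lambda> \<xi> * Vp \<xi> + \<beta>1 * Np \<xi> + \<beta>2 * Nm \<xi> + (\<nu>1p + \<nu>2p) * (norm \<xi>)\<^sup>2 * Vp \<xi> =
      \<Lambda> \<xi> * Vp \<xi> + \<beta>1 * Np \<xi> + \<beta>2 * Nm \<xi> + (\<nu>1p + \<nu>2p) * \<kappa> \<xi> * Vp \<xi>" by simp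
    also have "\<dots> = 0"
      using ne[of \<xi>] pos by (simp add: Vp_def Np_def Nm_def field_simps power2_eq_square)
    finally show ?thesis .
  qed (simp add: Vp_def Np_def Nm_def)
  \<comment> \<open>The only equation not satisfied by construction. After elimination it becomes
    the vanishing of the determinant, and here the dispersion relation is used.\<close>
  have eq4: "\<Lambda> \<xi> * Vm \<xi> + \<beta>3 * Np \<xi> + \<beta>4 * Nm \<xi> + (\<nu>1m + \<nu>2m) * (norm \<xi>)\<^sup>2 * Vm \<xi> = 0" for \<xi>
    using F_supp[of \<xi>]
  proof
    assume "\<kappa> \<xi> = (norm \<xi>)\<^sup>2"
    then have "\<Lambda> \<xi> * Vm \<xi> + \<beta>3 * Np \<xi> + \<beta>4 * Nm \<xi> + (\<nu>1m + \<nu>2m) * (norm \<xi>)\<^sup>2 * Vm \<xi> =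
      \<Lambda> \<xi> * Vm \<xi> + \<beta>3 * Np \<xi> + \<beta>4 * Nm \<xi> + (\<nu>1m + \<nu>2m) * \<kappa> \<xi> * Vm \<xi>" by simp
    also have "\<dots> = \<beta>3 * Np \<xi> + ((\<Lambda> \<xi>)\<^sup>2 / \<kappa> \<xi> + (\<nu>1m + \<nu>2m) * \<Lambda> \<xi> + \<beta>4\<^sup>2) * Nm \<xi> / \<beta>4"
    proof -
      have "\<Lambda> * (\<Lambda> / (\<beta>4 * k) * N) + Z + \<beta>4 * N + n * k * (\<Lambda> / (\<beta>4 * k) * N) = Z + (\<Lambda>\<^sup>2 / k + n * \<Lambda> + \<beta>4\<^sup>2) * N / \<beta>4"
        if "k \<noteq> 0" for \<Lambda> k N Z n
        using that pos by (simp add: field_simps power2_eq_square)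
      from this[OF ne(1)] show ?thesis by (simp only: Vm_def real_scaleR_def)
    qed
    also have "\<dots> = (\<beta>1 * \<beta>2 * \<beta>3 * \<beta>4 - ((\<Lambda> \<xi>)\<^sup>2 / \<kappa> \<xi> + (\<nu>1p + \<nu>2p) * \<Lambda> \<xi> + \<beta>1\<^sup>2) * ((\<Lambda> \<xi>)\<^sup>2 / \<kappa> \<xi> + (\<nu>1m + \<nu>2m) * \<Lambda> \<xi> + \<beta>4\<^sup>2)) * F \<xi> / \<beta>4"
    proof -
      have "\<beta>3 * ((\<beta>1 * \<beta>2) * f) + Y * (- X * f) / \<beta>4 = (\<beta>1 * \<beta>2 * \<beta>3 * \<beta>4 - X * Y) * f / \<beta>4" for X Y f
        using pos by (simp add: field_simps)
      then show ?thesis by (simp only: Np_def Nm_def real_scaleR_def)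
    qed
    also have "\<dots> = 0" unfolding disp by simp
    finally show ?thesis .
  qed (simp add: Vm_def Np_def Nm_def)
  have L: "0 \<le> \<Lambda> \<xi>" "\<Lambda> \<xi> \<le> \<theta>" "\<theta> - \<epsilon> \<le> \<Lambda> \<xi>" "\<Lambda> \<xi> \<noteq> 0" for \<xi>
    using \<Lambda>[of \<xi>] l by auto
  \<comment> \<open>A frequency with |\<xi>0|^2 midway between c and d, where \<open>F\<close> is
    positive and hence all four amplitudes are nonzero.\<close>
  define \<xi>0 :: "real^3" where "\<xi>0 = sqrt ((c + d) / 2) *\<^sub>R axis 1 1"
  have n: "(norm \<xi>0)\<^sup>2 = (c + d) / 2" using cd by (simp add: \<xi>0_def)
  have "(c + d) / 2 - c = (d - c) / 2" "d - (c + d) / 2 = (d - c) / 2" by (simp_all add: field_simps)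
  then have "F \<xi>0 = max 0 (((d - c) / 2) * ((d - c) / 2))"
    by (simp only: F_def n)
  moreover have "((d - c) / 2) * ((d - c) / 2) > 0" using cd by (intro mult_pos_pos) auto
  ultimately have "F \<xi>0 > 0" by linarith
  then have "F \<xi>0 \<noteq> 0" "\<xi>0 \<noteq> 0" using n cd by auto
  moreover have "(\<Lambda> \<xi>0)\<^sup>2 / \<kappa> \<xi>0 + (\<nu>1p + \<nu>2p) * \<Lambda> \<xi>0 + \<beta>1\<^sup>2 > 0"
    using L(1)[of \<xi>0] \<kappa>(2)[of \<xi>0] pos by (intro add_nonneg_pos add_nonneg_nonneg) auto
  ultimately have "Np \<xi>0 \<noteq> 0" "Nm \<xi>0 \<noteq> 0" "\<xi>0 \<noteq> 0" using pos by (auto simp: Np_def Nm_def)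
  then have nz: "Np \<xi>0 \<noteq> 0" "Nm \<xi>0 \<noteq> 0" "grad_symbol Vp \<xi>0 \<noteq> 0" "grad_symbol Vm \<xi>0 \<noteq> 0"
    using ne[of \<xi>0] L(4)[of \<xi>0] by (auto simp: Vp_def Vm_def grad_symbol_def)
  note gV = admV[THEN adm_grad_symbol]
  show thesis
  proof (rule that)
    show "solves_linear_system \<beta>1 \<beta>2 \<beta>3 \<beta>4 \<nu>1p \<nu>2p \<nu>1m \<nu>2m
      (evolve \<Lambda> Np) (evolve \<Lambda> (grad_symbol Vp)) (evolve \<Lambda> Nm) (evolve \<Lambda> (grad_symbol Vm))"
      by (rule evolve_solves_linear_system[OF \<Lambda>_cont even(2) L(1,2) pos(6) adm admV even(4-7) eq1 eq2 eq3 eq4])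
    show "L2_norm (evolve \<Lambda> Np 0) > 0" "L2_norm (evolve \<Lambda> Nm 0) > 0"
      "L2_norm (evolve \<Lambda> (grad_symbol Vp) 0) > 0" "L2_norm (evolve \<Lambda> (grad_symbol Vm) 0) > 0"
      unfolding evolve_0 using nz by (auto intro: L2_norm_hartley_pos adm gV)
  qed (rule C_time_H_evolve[OF \<Lambda>_cont even(2) L(1,2) pos(6)] C_time_L2_evolve[OF \<Lambda>_cont even(2) L(1,2) pos(6)]
      L2_norm_evolve_bounds[OF \<Lambda>_cont L(3,2)] adm gV | assumption)+
qed

theorem theorem1p1:
  fixes gp gm mup mum lamp lamm :: real and f :: "real \<Rightarrow> real"
    and \<beta>1 \<beta>2 \<beta>3 \<beta>4 \<nu>1p \<nu>1m \<nu>2p \<nu>2m \<nu>p \<nu>m \<theta> :: real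
  assumes "gp \<ge> 1" and "gm \<ge> 1"
    and "mup > 0" and "mum > 0"
    and "2 * mup + 3 * lamp \<ge> 0" and "2 * mum + 3 * lamm \<ge> 0"
    and "C_halfline 3 f" and "deriv f 1 > 0"
    and "alpha4 gp gm f > 0"
    and "\<nu>1p = mup / rho_p gp gm f 1 1" and "\<nu>1m = mum / rho_m gp gm f 1 1"
    and "\<nu>2p = (mup + lamp) / rho_p gp gm f 1 1" and "\<nu>2m = (mum + lamm) / rho_m gp gm f 1 1"
    and "\<beta>1 = sqrt (alpha1 gp gm f)"
    and "\<beta>2 = alpha2 gp gm f * sqrt (alpha1 gp gm f) / alpha4 gp gm f"
    and "\<beta>3 = alpha3 gp gm f * sqrt (alpha4 gp gm f) / alpha1 gp gm f"
    and "\<beta>4 = sqrt (alpha4 gp gm f)"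
    and "\<nu>p = \<nu>1p + \<nu>2p" and "\<nu>m = \<nu>1m + \<nu>2m"
    and "\<theta> = (sqrt ((\<nu>p * \<beta>4\<^sup>2 + \<nu>m * \<beta>1\<^sup>2)\<^sup>2
                   + 4 * \<nu>p * \<nu>m * (\<beta>1 * \<beta>2 * \<beta>3 * \<beta>4 - \<beta>1\<^sup>2 * \<beta>4\<^sup>2))
              - (\<nu>p * \<beta>4\<^sup>2 + \<nu>m * \<beta>1\<^sup>2)) / (2 * \<nu>p * \<nu>m)"
  shows "\<theta> > 0 \<and>
    (\<forall>\<epsilon>>0. \<exists>(np :: real \<Rightarrow> real^3 \<Rightarrow> real) (up :: real \<Rightarrow> real^3 \<Rightarrow> real^3)
            (nm :: real \<Rightarrow> real^3 \<Rightarrow> real) (um :: real \<Rightarrow> real^3 \<Rightarrow> real^3).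
       solves_linear_system \<beta>1 \<beta>2 \<beta>3 \<beta>4 \<nu>1p \<nu>2p \<nu>1m \<nu>2m np up nm um \<and>
       C_time 0 (H_space 2) (H_norm 2) np \<and> C_time 1 (H_space 1) (H_norm 1) np \<and>
       C_time 0 (H_space 2) (H_norm 2) nm \<and> C_time 1 (H_space 1) (H_norm 1) nm \<and>
       C_time 0 (H_space 2) (H_norm 2) up \<and> C_time 1 L2_space L2_norm up \<and>
       C_time 0 (H_space 2) (H_norm 2) um \<and> C_time 1 L2_space L2_norm um \<and>
       L2_norm (np 0) * L2_norm (up 0) * L2_norm (nm 0) * L2_norm (um 0) > 0 \<and>
       (\<forall>t\<ge>0.
          exp ((\<theta> - \<epsilon>) * t) * L2_norm (np 0) \<le> L2_norm (np t) \<and>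
          L2_norm (np t) \<le> exp (\<theta> * t) * L2_norm (np 0) \<and>
          exp ((\<theta> - \<epsilon>) * t) * L2_norm (nm 0) \<le> L2_norm (nm t) \<and>
          L2_norm (nm t) \<le> exp (\<theta> * t) * L2_norm (nm 0) \<and>
          exp ((\<theta> - \<epsilon>) * t) * L2_norm (up 0) \<le> L2_norm (up t) \<and>
          L2_norm (up t) \<le> exp (\<theta> * t) * L2_norm (up 0) \<and>
          exp ((\<theta> - \<epsilon>) * t) * L2_norm (um 0) \<le> L2_norm (um t) \<and>
          L2_norm (um t) \<le> exp (\<theta> * t) * L2_norm (um 0)))"
proof -
  note co = coefficients[OF assms(1,2,8)]
  let ?a1 = "alpha1 gp gm f" and ?a2 = "alpha2 gp gm f" and ?a3 = "alpha3 gp gm f" and ?a4 = "alpha4 gp gm f"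
  have a4: "?a4 > 0" by fact
  have \<beta>: "\<beta>1 > 0" "\<beta>2 > 0" "\<beta>4 > 0"
    using co a4 assms(14,15,17) by auto
  have sq: "\<beta>1\<^sup>2 = ?a1" "\<beta>4\<^sup>2 = ?a4" using co a4 assms(14,17) by auto
  \<comment> \<open>The square roots are paired so that both quotients equal 1, which leaves
    \<alpha>2 \<alpha>3.\<close>
  have "\<beta>1 * \<beta>2 * \<beta>3 * \<beta>4 = (\<beta>1\<^sup>2 / ?a1) * (\<beta>4\<^sup>2 / ?a4) * (?a2 * ?a3)"
    unfolding assms(15,16) assms(14)[symmetric] assms(17)[symmetric] by (simp add: power2_eq_square mult_ac)
  then have "\<beta>1 * \<beta>2 * \<beta>3 * \<beta>4 = ?a2 * ?a3" using co a4 by (simp add: sq)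
  then have B: "\<beta>1\<^sup>2 * \<beta>4\<^sup>2 < \<beta>1 * \<beta>2 * \<beta>3 * \<beta>4" using co(6) by (simp add: sq)
  \<comment> \<open>On each side, 3 (\<mu> + \<lambda>) = (2 \<mu> + 3 \<lambda>) + \<mu>.\<close>
  have "mup + lamp > 0" "mum + lamm > 0" using assms(3-6) by linarith+
  then have "\<nu>1p > 0" "\<nu>2p > 0" "\<nu>1m > 0" "\<nu>2m > 0"
    using co(1,2) assms(3,4,10-13) by auto
  then have \<nu>: "\<nu>p > 0" "\<nu>m > 0" using assms(18,19) by auto
  have b2: "\<beta>1\<^sup>2 > 0" "\<beta>4\<^sup>2 > 0" using \<beta> by auto
  note \<theta> = growth_rate[OF b2 \<nu> B assms(20)]
  show ?thesis
  proof (intro conjI allI impI)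
    show "\<theta> > 0" by (rule \<theta>(1))
    fix \<epsilon> :: real assume \<epsilon>: "\<epsilon> > 0"
    show "\<exists>(np :: real \<Rightarrow> real^3 \<Rightarrow> real) (up :: real \<Rightarrow> real^3 \<Rightarrow> real^3)
            (nm :: real \<Rightarrow> real^3 \<Rightarrow> real) (um :: real \<Rightarrow> real^3 \<Rightarrow> real^3).
       solves_linear_system \<beta>1 \<beta>2 \<beta>3 \<beta>4 \<nu>1p \<nu>2p \<nu>1m \<nu>2m np up nm um \<and>
       C_time 0 (H_space 2) (H_norm 2) np \<and> C_time 1 (H_space 1) (H_norm 1) np \<and>
       C_time 0 (H_space 2) (H_norm 2) nm \<and> C_time 1 (H_space 1) (H_norm 1) nm \<and>
       C_time 0 (H_space 2) (H_norm 2) up \<and> C_time 1 L2_space L2_norm up \<and>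
       C_time 0 (H_space 2) (H_norm 2) um \<and> C_time 1 L2_space L2_norm um \<and>
       L2_norm (np 0) * L2_norm (up 0) * L2_norm (nm 0) * L2_norm (um 0) > 0 \<and>
       (\<forall>t\<ge>0.
          exp ((\<theta> - \<epsilon>) * t) * L2_norm (np 0) \<le> L2_norm (np t) \<and>
          L2_norm (np t) \<le> exp (\<theta> * t) * L2_norm (np 0) \<and>
          exp ((\<theta> - \<epsilon>) * t) * L2_norm (nm 0) \<le> L2_norm (nm t) \<and>
          L2_norm (nm t) \<le> exp (\<theta> * t) * L2_norm (nm 0) \<and>
          exp ((\<theta> - \<epsilon>) * t) * L2_norm (up 0) \<le> L2_norm (up t) \<and>
          L2_norm (up t) \<le> exp (\<theta> * t) * L2_norm (up 0) \<and>
          exp ((\<theta> - \<epsilon>) * t) * L2_norm (um 0) \<le> L2_norm (um t) \<and>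
          L2_norm (um t) \<le> exp (\<theta> * t) * L2_norm (um 0))"
    proof (rule growing_solution[OF \<beta> \<nu>[unfolded assms(18,19)] \<theta>(1) \<epsilon> \<theta>(2)[unfolded assms(18,19)]], goal_cases)
      case (1 np nm up um)
      then show ?case
        by (intro exI[of _ np] exI[of _ up] exI[of _ nm] exI[of _ um] conjI allI impI mult_pos_pos) simp_all
    qed
  qed
qed

end
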